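(* Let $u$ be the solution of $$ \begin{cases} u_{tt}-\Delta_g u=0, & (x,t)\in\Omega\times(0,+\infty),\\ u|_{\Gamma}=0, & t\in(0,+\infty),\\ u(x,0)=u_0(x),\quad u_t(x,0)=u_1(x), & x\in\Omega,\end{cases} $$ and let the initial data $(u_0,u_1)$ satisfy $$ u_0(x)=u_1(x)=0,\qquad |x|\ge R_0, $$ where $R_0>r_1$ is a constant. Then $$ u(x,t)=0\qquad\text{for } |x|\ge R_0+t. $$
   Context: Let $n\ge 2$, $r=r(x)=|x|$ the Euclidean norm, $\partial/\partial r=x/|x|$ for $x\ne0$. $(\mathbb{R}^n,g)$ is a smooth complete Riemannian manifold, $g=\sum g_{ij}(x)dx_idx_j$, $G(x)=(g_{ij}(x))$, and there is a constant $r_c>0$ with $G(x)\frac{\partial}{\partial r}=\frac{\partial}{\partial r}$ for $|x|\ge r_c$. $\nabla_g$, $\Delta_g$ are the gradient and Laplace–Beltrami operator of $g$; $dx_g=\sqrt{\det G(x)}\,dx$. $\Omega\subset\mathbb{R}^n$ is an exterior domain with compact smooth boundary $\Gamma$, with $|x|\ge r_c$ for all $x\in\Omega$; $r_0=\inf_{x\in\Gamma}|x|$, $r_1=\sup_{x\in\Gamma}|x|$. The system is well-posed in the energy class: $u_0\in\widehat H^1_0(\Omega)$, $u_1\in L^2(\Omega)$, $u\in C([0,+\infty),\widehat H^1_0(\Omega))$, $u_t\in C([0,+\infty),L^2(\Omega))$, where $\widehat H^1_0(\Omega)=\{w: w|_\Gamma=0,\ \int_\Omega|\nabla_g w|_g^2dx_g<+\infty\}$.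 *)

theory Defs
  imports "HOL-Analysis.Analysis"
begin

section \<open>Smooth functions\<close>

text \<open>Meaningful for open \<open>S\<close> only: \<^const>\<open>frechet_derivative\<close> is taken at interior points.\<close>

primrec Ck_on :: "nat \<Rightarrow> 'a::real_normed_vector set \<Rightarrow> ('a \<Rightarrow> 'b::real_normed_vector) \<Rightarrow> bool" where
  "Ck_on 0 S f \<longleftrightarrow> continuous_on S f"
| "Ck_on (Suc k) S f \<longleftrightarrow>
     f differentiable_on S \<and> (\<forall>v. Ck_on k S (\<lambda>x. frechet_derivative f (at x) v))"

definition smooth_on :: "'a::real_normed_vector set \<Rightarrow> ('a \<Rightarrow> 'b::real_normed_vector) \<Rightarrow> bool" where
  "smooth_on S f \<longleftrightarrow> (\<forall>k. Ck_on k S f)"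

text \<open>The elements of $C_c^\infty(S)$, extended by zero to the whole space.\<close>

definition test_function :: "'a::real_normed_vector set \<Rightarrow> ('a \<Rightarrow> real) \<Rightarrow> bool" where
  "test_function S \<phi> \<longleftrightarrow>
     smooth_on UNIV \<phi> \<and> compact (closure {x. \<phi> x \<noteq> 0}) \<and> closure {x. \<phi> x \<noteq> 0} \<subseteq> S"

definition partial :: "'n::finite \<Rightarrow> (real^'n \<Rightarrow> real) \<Rightarrow> real^'n \<Rightarrow> real" where
  "partial i f x = frechet_derivative f (at x) (axis i 1)"

definition grad :: "(real^'n::finite \<Rightarrow> real) \<Rightarrow> real^'n \<Rightarrow> real^'n" where
  "grad f x = (\<chi> i. partial i f x)"

section \<open>Riemannian metrics on Euclidean space\<close>

definition riemannian_metric :: "(real^'n::finite \<Rightarrow> real^'n^'n) \<Rightarrow> bool" where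
  "riemannian_metric G \<longleftrightarrow>
     smooth_on UNIV G \<and> (\<forall>x. transpose (G x) = G x \<and> (\<forall>v. v \<noteq> 0 \<longrightarrow> v \<bullet> (G x *v v) > 0))"

definition riem_norm :: "(real^'n::finite \<Rightarrow> real^'n^'n) \<Rightarrow> real^'n \<Rightarrow> real^'n \<Rightarrow> real" where
  "riem_norm G x v = sqrt (v \<bullet> (G x *v v))"

text \<open>Lengths are extended nonnegative: a \<^const>\<open>valid_path\<close> may have an unbounded derivative near a
  break point and then infinite length.\<close>

definition riem_length :: "(real^'n::finite \<Rightarrow> real^'n^'n) \<Rightarrow> (real \<Rightarrow> real^'n) \<Rightarrow> ennreal" where
  "riem_length G \<gamma> =
     (\<integral>\<^sup>+t\<in>{0..1}. ennreal (riem_norm G (\<gamma> t) (vector_derivative \<gamma> (at t))) \<partial>lebesgue)"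

definition riem_dist :: "(real^'n::finite \<Rightarrow> real^'n^'n) \<Rightarrow> real^'n \<Rightarrow> real^'n \<Rightarrow> real" where
  "riem_dist G x y =
     enn2real (INF \<gamma>\<in>{\<gamma>. valid_path \<gamma> \<and> pathstart \<gamma> = x \<and> pathfinish \<gamma> = y}. riem_length G \<gamma>)"

definition riem_complete :: "(real^'n::finite \<Rightarrow> real^'n^'n) \<Rightarrow> bool" where
  "riem_complete G \<longleftrightarrow> Metric_space.mcomplete UNIV (riem_dist G)"

text \<open>The volume measure $dx_g = \sqrt{\det G(x)}\,dx$.\<close>

definition riem_vol :: "(real^'n::finite \<Rightarrow> real^'n^'n) \<Rightarrow> (real^'n) measure" where
  "riem_vol G = density lebesgue (\<lambda>x. ennreal (sqrt (det (G x))))"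

text \<open>The Riemannian gradient $\nabla_g = G^{-1}\nabla$ as a function of the coordinate gradient
  \<open>D\<close>, which is \<open>grad f\<close> for smooth \<open>f\<close> and a weak gradient for Sobolev functions.\<close>

definition riem_grad :: "(real^'n::finite \<Rightarrow> real^'n^'n) \<Rightarrow> (real^'n \<Rightarrow> real^'n) \<Rightarrow> real^'n \<Rightarrow> real^'n" where
  "riem_grad G D x = matrix_inv (G x) *v D x"

definition riem_div :: "(real^'n::finite \<Rightarrow> real^'n^'n) \<Rightarrow> (real^'n \<Rightarrow> real^'n) \<Rightarrow> real^'n \<Rightarrow> real" where
  "riem_div G X x =
     (\<Sum>i\<in>UNIV. partial i (\<lambda>y. sqrt (det (G y)) * X y $ i) x) / sqrt (det (G x))"

definition laplace_beltrami :: "(real^'n::finite \<Rightarrow> real^'n^'n) \<Rightarrow> (real^'n \<Rightarrow> real) \<Rightarrow> real^'n \<Rightarrow> real" where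
  "laplace_beltrami G f = riem_div G (riem_grad G (grad f))"

section \<open>Exterior domains\<close>

definition exterior_domain :: "(real^'n::finite) set \<Rightarrow> bool" where
  "exterior_domain \<Omega> \<longleftrightarrow> open \<Omega> \<and> connected \<Omega> \<and> bounded (- \<Omega>) \<and> compact (frontier \<Omega>)"

text \<open>Near each boundary point \<open>\<Omega>\<close> is the sublevel set of a smooth function without critical
  points, so that it lies locally on one side of the hypersurface \<open>frontier \<Omega>\<close>.\<close>

definition smooth_boundary :: "(real^'n::finite) set \<Rightarrow> bool" where
  "smooth_boundary \<Omega> \<longleftrightarrow>
     (\<forall>p\<in>frontier \<Omega>. \<exists>U \<psi>. open U \<and> p \<in> U \<and> smooth_on U \<psi> \<and> (\<forall>x\<in>U. grad \<psi> x \<noteq> 0) \<and>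
        \<Omega> \<inter> U = {x\<in>U. \<psi> x < 0})"

section \<open>Function spaces\<close>

text \<open>Elements of the function spaces are represented by functions on the whole space, of which
  only the almost-everywhere class on \<open>\<Omega>\<close> matters. Squared norms are extended nonnegative, so that
  convergence to zero entails finiteness.\<close>

definition L2_sq :: "'a measure \<Rightarrow> 'a set \<Rightarrow> ('a \<Rightarrow> 'b::real_normed_vector) \<Rightarrow> ennreal" where
  "L2_sq M S w = (\<integral>\<^sup>+x\<in>S. ennreal ((norm (w x))\<^sup>2) \<partial>M)"

definition L2_space :: "'a measure \<Rightarrow> 'a set \<Rightarrow> ('a \<Rightarrow> real) set" where
  "L2_space M S = {w. set_borel_measurable M S w \<and> L2_sq M S w < \<infinity>}"

definition has_weak_grad :: "(real^'n::finite) set \<Rightarrow> (real^'n \<Rightarrow> real) \<Rightarrow> (real^'n \<Rightarrow> real^'n) \<Rightarrow> bool" where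
  "has_weak_grad \<Omega> w D \<longleftrightarrow>
     (\<forall>K. compact K \<and> K \<subseteq> \<Omega> \<longrightarrow> set_integrable lebesgue K w \<and> set_integrable lebesgue K D) \<and>
     (\<forall>\<phi> i. test_function \<Omega> \<phi> \<longrightarrow>
        (LINT x:\<Omega>|lebesgue. w x * partial i \<phi> x) = - (LINT x:\<Omega>|lebesgue. D x $ i * \<phi> x))"

definition weakly_differentiable_on :: "(real^'n::finite) set \<Rightarrow> (real^'n \<Rightarrow> real) \<Rightarrow> bool" where
  "weakly_differentiable_on \<Omega> w \<longleftrightarrow> (\<exists>D. has_weak_grad \<Omega> w D)"

text \<open>Determined up to a null set in \<open>\<Omega>\<close> when \<open>w\<close> is weakly differentiable.\<close>

definition weak_grad :: "(real^'n::finite) set \<Rightarrow> (real^'n \<Rightarrow> real) \<Rightarrow> real^'n \<Rightarrow> real^'n" where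
  "weak_grad \<Omega> w = (SOME D. has_weak_grad \<Omega> w D)"

text \<open>$\int_\Omega |\nabla_g w|_g^2\,dx_g$\<close>

definition dirichlet :: "(real^'n::finite \<Rightarrow> real^'n^'n) \<Rightarrow> (real^'n) set \<Rightarrow> (real^'n \<Rightarrow> real) \<Rightarrow> ennreal" where
  "dirichlet G \<Omega> w =
     L2_sq (riem_vol G) \<Omega> (\<lambda>x. riem_norm G x (riem_grad G (weak_grad \<Omega> w) x))"

text \<open>$w|_\Gamma = 0$ for Sobolev functions: \<open>w\<close> is a limit of functions in $C_c^\infty(\Omega)$ with
  respect to $H^1(\Omega \cap B_R)$ for every \<open>R\<close>. The convergence is local at infinity since the
  boundary condition concerns \<open>\<Gamma>\<close> only; the closure of $C_c^\infty(\Omega)$ in the Dirichlet norm would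
  be too small (for the Euclidean metric in dimension at least three it misses
  $1-|x|^{2-n}$ outside the unit ball).\<close>

definition vanishes_on_boundary :: "(real^'n::finite) set \<Rightarrow> (real^'n \<Rightarrow> real) \<Rightarrow> bool" where
  "vanishes_on_boundary \<Omega> w \<longleftrightarrow>
     (\<exists>\<phi>. (\<forall>k. test_function \<Omega> (\<phi> k)) \<and>
        (\<forall>R. (\<lambda>k::nat. L2_sq lebesgue (\<Omega> \<inter> ball 0 R) (\<lambda>x. \<phi> k x - w x)) \<longlonglongrightarrow> 0 \<and>
             (\<lambda>k. L2_sq lebesgue (\<Omega> \<inter> ball 0 R) (\<lambda>x. grad (\<phi> k) x - weak_grad \<Omega> w x)) \<longlonglongrightarrow> 0))"

text \<open>The space $\widehat H^1_0(\Omega)$; its norm is the square root of \<^const>\<open>dirichlet\<close>.\<close>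

definition H10_hat :: "(real^'n::finite \<Rightarrow> real^'n^'n) \<Rightarrow> (real^'n) set \<Rightarrow> (real^'n \<Rightarrow> real) set" where
  "H10_hat G \<Omega> =
     {w. weakly_differentiable_on \<Omega> w \<and> vanishes_on_boundary \<Omega> w \<and> dirichlet G \<Omega> w < \<infinity>}"

section \<open>Energy-class solutions of the wave equation\<close>

text \<open>\<open>u \<in> C([0,\<infinity>), H10_hat)\<close>, so that the Dirichlet condition is part of the space.\<close>

definition continuous_H10_hat ::
  "(real^'n::finite \<Rightarrow> real^'n^'n) \<Rightarrow> (real^'n) set \<Rightarrow> (real \<Rightarrow> real^'n \<Rightarrow> real) \<Rightarrow> bool" where
  "continuous_H10_hat G \<Omega> u \<longleftrightarrow>
     (\<forall>t\<ge>0. u t \<in> H10_hat G \<Omega> \<and>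
        ((\<lambda>s. dirichlet G \<Omega> (\<lambda>x. u s x - u t x)) \<longlongrightarrow> 0) (at t within {0..}))"

definition continuous_L2 :: "'a measure \<Rightarrow> 'a set \<Rightarrow> (real \<Rightarrow> 'a \<Rightarrow> real) \<Rightarrow> bool" where
  "continuous_L2 M S v \<longleftrightarrow>
     (\<forall>t\<ge>0. v t \<in> L2_space M S \<and>
        ((\<lambda>s. L2_sq M S (\<lambda>x. v s x - v t x)) \<longlongrightarrow> 0) (at t within {0..}))"

text \<open>\<open>v\<close> is the time derivative of \<open>u\<close> on \<open>[0,\<infinity>)\<close>, as the limit in $L^2$ of difference quotients;
  \<open>u t\<close> itself need not be square integrable.\<close>

definition has_L2_time_derivative ::
  "'a measure \<Rightarrow> 'a set \<Rightarrow> (real \<Rightarrow> 'a \<Rightarrow> real) \<Rightarrow> (real \<Rightarrow> 'a \<Rightarrow> real) \<Rightarrow> bool" where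
  "has_L2_time_derivative M S u v \<longleftrightarrow>
     (\<forall>t\<ge>0. ((\<lambda>s. L2_sq M S (\<lambda>x. (u s x - u t x) / (s - t) - v t x)) \<longlongrightarrow> 0) (at t within {0..}))"

text \<open>$u_{tt} - \Delta_g u = 0$ in the sense of distributions on $(0,\infty) \times \Omega$, where
  distributions are paired by means of $dx_g\,dt$, for which $\Delta_g$ is symmetric.
  The iterated integral does not depend on the choice of the representatives \<open>u t\<close>.\<close>

definition wave_equation ::
  "(real^'n::finite \<Rightarrow> real^'n^'n) \<Rightarrow> (real^'n) set \<Rightarrow> (real \<Rightarrow> real^'n \<Rightarrow> real) \<Rightarrow> bool" where
  "wave_equation G \<Omega> u \<longleftrightarrow>
     (\<forall>\<phi>. test_function ({0<..} \<times> \<Omega>) \<phi> \<longrightarrow>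
        (LINT t:{0<..}|lebesgue. (LINT x:\<Omega>|riem_vol G.
           u t x * ((deriv ^^ 2) (\<lambda>s. \<phi> (s, x)) t - laplace_beltrami G (\<lambda>y. \<phi> (t, y)) x))) = 0)"

definition wave_solution ::
  "(real^'n::finite \<Rightarrow> real^'n^'n) \<Rightarrow> (real^'n) set \<Rightarrow> (real^'n \<Rightarrow> real) \<Rightarrow> (real^'n \<Rightarrow> real) \<Rightarrow>
   (real \<Rightarrow> real^'n \<Rightarrow> real) \<Rightarrow> bool" where
  "wave_solution G \<Omega> u0 u1 u \<longleftrightarrow>
     continuous_H10_hat G \<Omega> u \<and>
     wave_equation G \<Omega> u \<and>
     (AE x\<in>\<Omega> in lebesgue. u 0 x = u0 x) \<and>
     (\<exists>v. continuous_L2 (riem_vol G) \<Omega> v \<and> has_L2_time_derivative (riem_vol G) \<Omega> u v \<and>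
          (AE x\<in>\<Omega> in lebesgue. v 0 x = u1 x))"

end

theory Submission
  imports Defs
begin

text \<open>Finite speed of propagation is an energy estimate over the outside of an expanding ball. Where
\<open>norm x \<ge> r_c\<close> the condition on \<open>G\<close> says that the radial field is a unit field for \<open>g\<close> and also that
$\nabla_g |x| = \partial/\partial r$. So \<open>norm x\<close> grows at most at unit rate along every unit speed
curve, and the energy outside the ball of radius \<open>R0 + t\<close> cannot increase. The set \<open>norm x \<ge> R0\<close> is
connected and misses the boundary, so it lies in \<open>\<Omega>\<close>, and the estimate takes place away from
the boundary.

A solution in the energy class is too rough for its energy to be differentiated. The argument is
applied to the primitive $z(t) = \int_0^t u$, which solves $z'' - \Delta_g z = 0$ at large
\<open>norm x\<close> because \<open>u1\<close> vanishes there, and which starts from zero. Its energy density is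
$u^2 + |\nabla_g z|_g^2$. For a weight \<open>\<omega>\<close> the energy is
$$E_\omega(t) = \int \omega u(t)^2 + 2 \int_0^t \int_0^s \int \omega \langle D(s), D(r) \rangle \, dr \, ds, $$
where \<open>D\<close> is the weak gradient of \<open>u\<close>. This formula contains only integrals of continuous scalar
functions of time, no integrals with values in $L^2$ and no measurability in space and time
jointly. The kernel $\int \omega \langle D(s), D(r) \rangle$ is of positive type, and
\<open>kernel_quadratic_nonneg\<close> turns pointwise quadratic inequalities into inequalities for energies.

The weight is $w_t(x) = f(q(x) - t)$, where $f$ (\<open>flat\<close>) is smooth and nondecreasing, vanishes on the
negative axis and is positive on the positive axis, and $q = s - s^2/(2L)$ with
$s = |x| - R_0$. For \<open>t \<ge> 0\<close> it is a smooth function supported in the annulus $0 \le s \le 2L$, and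
$|\nabla_g q|_g \le 1$ there. Moving the weight therefore loses at least as much energy as
flows in (\<open>energy_flux\<close>), the energy stays zero (\<open>energy_vanishes\<close>), and \<open>u t\<close> vanishes where \<open>q > t\<close>
(\<open>vanishing_in_cone\<close>). As $L$ tends to infinity these sets exhaust \<open>norm x > R0 + t\<close>.

The energy identity needs the equation tested with \<open>w u(t)\<close> at each fixed time. Separated test
functions in the distributional equation, with \<open>distributional_second_derivative\<close> in the time
variable, allow smooth functions of \<open>x\<close> (\<open>wave_equation_tested\<close>). The passage from these to \<open>w u(t)\<close>
uses the smooth approximations of \<open>u t\<close> which the definition of \<open>vanishes_on_boundary\<close> provides
(\<open>wave_equation_tested_solution\<close>). Continuity of \<open>D\<close> in time rests on the uniqueness of weak
gradients, hence on the fundamental lemma of the calculus of variations.\<close>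

section \<open>Calculus of differentiability classes\<close>

lemma Ck_on_cong:
  assumes "open S" "\<And>x. x \<in> S \<Longrightarrow> f x = g x"
  shows "Ck_on k S f \<longleftrightarrow> Ck_on k S g"
  using assms(2)
proof (induction k arbitrary: f g)
  case 0 then show ?case by (simp cong: continuous_on_cong)
next
  case (Suc k)
  have d: "(f has_derivative F) (at x) \<longleftrightarrow> (g has_derivative F) (at x)" if "x \<in> S" for x F
    using has_derivative_transform_within_open[OF _ assms(1) that, of f F UNIV g]
      has_derivative_transform_within_open[OF _ assms(1) that, of g F UNIV f] Suc.prems by auto
  have "f differentiable_on S \<longleftrightarrow> g differentiable_on S"
    by (simp add: differentiable_on_eq_differentiable_at[OF assms(1)] differentiable_def d)
  moreover have "frechet_derivative f (at x) v = frechet_derivative g (at x) v" if "x \<in> S" for x v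
    by (simp add: frechet_derivative_def d[OF that])
  ultimately show ?case
    using Suc.IH[of "\<lambda>x. frechet_derivative f (at x) v" "\<lambda>x. frechet_derivative g (at x) v" for v] by simp
qed

text \<open>Any family of derivatives may replace \<^const>\<open>frechet_derivative\<close>. All closure properties below
follow by induction on the order: the rules of differentiation express the derivative by
functions of the same form.\<close>

lemma Ck_on_SucI:
  assumes "open S" "\<And>x. x \<in> S \<Longrightarrow> (f has_derivative F x) (at x)"
    "\<And>v. Ck_on k S (\<lambda>x. F x v)"
  shows "Ck_on (Suc k) S f"
proof -
  have "f differentiable_on S"
    using assms(1,2) differentiable_on_eq_differentiable_at differentiable_def by blast
  moreover have "Ck_on k S (\<lambda>x. frechet_derivative f (at x) v)" for v
    using assms(3)[of v] Ck_on_cong[OF assms(1), of "\<lambda>x. frechet_derivative f (at x) v" "\<lambda>x. F x v" k]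
      frechet_derivative_at[OF assms(2)] by auto
  ultimately show ?thesis by simp
qed

lemma Ck_on_SucD:
  assumes "open S" "Ck_on (Suc k) S f"
  shows "x \<in> S \<Longrightarrow> (f has_derivative frechet_derivative f (at x)) (at x)"
    "Ck_on k S (\<lambda>x. frechet_derivative f (at x) v)"
  using assms by (auto simp: differentiable_on_eq_differentiable_at frechet_derivative_works)

lemma Ck_on_Suc_imp: "Ck_on (Suc k) S f \<Longrightarrow> Ck_on k S f"
proof (induction k arbitrary: f)
  case 0 then show ?case using differentiable_imp_continuous_on by auto
next
  case (Suc k) then show ?case by (metis Ck_on.simps(2))
qed

lemma Ck_on_continuous: "Ck_on k S f \<Longrightarrow> continuous_on S f"
  by (cases k) (auto intro: differentiable_imp_continuous_on)

lemma Ck_on_subset: "Ck_on k S f \<Longrightarrow> open S \<Longrightarrow> open T \<Longrightarrow> T \<subseteq> S \<Longrightarrow> Ck_on k T f"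
proof (induction k arbitrary: f)
  case 0 then show ?case by (auto intro: continuous_on_subset)
next
  case (Suc k)
  show ?case using Suc differentiable_on_subset[of f S T] by auto
qed

lemma Ck_on_Un:
  "Ck_on k S f \<Longrightarrow> Ck_on k T f \<Longrightarrow> open S \<Longrightarrow> open T \<Longrightarrow> Ck_on k (S \<union> T) f"
proof (induction k arbitrary: f)
  case 0 then show ?case by (auto intro: continuous_on_open_Un)
next
  case (Suc k)
  then show ?case by (auto simp: differentiable_on_eq_differentiable_at open_Un)
qed

lemma Ck_on_const: "open S \<Longrightarrow> Ck_on k S (\<lambda>x. c)"
proof (induction k arbitrary: c)
  case (Suc k)
  show ?case by (rule Ck_on_SucI[where F = "\<lambda>x v. 0"]) (use Suc in auto)
qed auto

lemma Ck_on_bounded_linear: "bounded_linear f \<Longrightarrow> open S \<Longrightarrow> Ck_on k S f"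
  by (cases k) (auto intro!: Ck_on_SucI[where F = "\<lambda>x. f"] Ck_on_const
      bounded_linear_imp_has_derivative linear_continuous_on simp del: Ck_on.simps(2))

lemma Ck_on_add:
  "Ck_on k S f \<Longrightarrow> Ck_on k S g \<Longrightarrow> open S \<Longrightarrow> Ck_on k S (\<lambda>x. f x + g x)"
proof (induction k arbitrary: f g)
  case 0 then show ?case by (auto intro: continuous_intros)
next
  case (Suc k)
  show ?case
    by (rule Ck_on_SucI[OF Suc.prems(3) has_derivative_add[OF Ck_on_SucD(1) Ck_on_SucD(1)]])
      (use Suc in auto)
qed

lemma Ck_on_sum:
  "(\<And>i. i \<in> I \<Longrightarrow> Ck_on k S (f i)) \<Longrightarrow> open S \<Longrightarrow> Ck_on k S (\<lambda>x. \<Sum>i\<in>I. f i x)"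
  by (induction I rule: infinite_finite_induct) (auto intro: Ck_on_const Ck_on_add)

lemma Ck_on_mult:
  fixes f g :: "'a::real_normed_vector \<Rightarrow> real"
  shows "Ck_on k S f \<Longrightarrow> Ck_on k S g \<Longrightarrow> open S \<Longrightarrow> Ck_on k S (\<lambda>x. f x * g x)"
proof (induction k arbitrary: f g)
  case 0 then show ?case by (auto intro: continuous_intros)
next
  case (Suc k)
  show ?case
    by (rule Ck_on_SucI[OF Suc.prems(3) has_derivative_mult[OF Ck_on_SucD(1) Ck_on_SucD(1)]])
      (auto intro!: Ck_on_add Suc.IH Ck_on_SucD(2)[OF Suc.prems(3)] Suc.prems
        Ck_on_Suc_imp[OF Suc.prems(1)] Ck_on_Suc_imp[OF Suc.prems(2)] simp del: Ck_on.simps)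
qed

lemma Ck_on_minus:
  fixes f :: "'a::real_normed_vector \<Rightarrow> real"
  shows "Ck_on k S f \<Longrightarrow> open S \<Longrightarrow> Ck_on k S (\<lambda>x. - f x)"
  using Ck_on_mult[OF Ck_on_const[of S k "-1"], of f] by simp

lemma Ck_on_diff:
  fixes f g :: "'a::real_normed_vector \<Rightarrow> real"
  shows "Ck_on k S f \<Longrightarrow> Ck_on k S g \<Longrightarrow> open S \<Longrightarrow> Ck_on k S (\<lambda>x. f x - g x)"
  using Ck_on_add[of k S f "\<lambda>x. - g x"] Ck_on_minus[of k S g] by simp

lemma Ck_on_prod:
  fixes f :: "'i \<Rightarrow> 'a::real_normed_vector \<Rightarrow> real"
  shows "(\<And>i. i \<in> I \<Longrightarrow> Ck_on k S (f i)) \<Longrightarrow> open S \<Longrightarrow> Ck_on k S (\<lambda>x. \<Prod>i\<in>I. f i x)"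
  by (induction I rule: infinite_finite_induct) (auto intro: Ck_on_const Ck_on_mult)

lemma Ck_on_linear_compose:
  "bounded_linear h \<Longrightarrow> Ck_on k S f \<Longrightarrow> open S \<Longrightarrow> Ck_on k S (\<lambda>x. h (f x))"
proof (induction k arbitrary: f)
  case 0 then show ?case
    by (auto intro: continuous_on_compose2[OF linear_continuous_on[of h UNIV]])
next
  case (Suc k)
  show ?case
    by (rule Ck_on_SucI[OF Suc.prems(3) bounded_linear.has_derivative[OF Suc.prems(1) Ck_on_SucD(1)]])
      (use Suc in auto)
qed

lemma Ck_on_compose_linear:
  "bounded_linear h \<Longrightarrow> Ck_on k UNIV f \<Longrightarrow> Ck_on k UNIV (\<lambda>x. f (h x))"
proof (induction k arbitrary: f)
  case 0 then show ?case
    by (auto intro: continuous_on_compose2 linear_continuous_on)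
next
  case (Suc k)
  show ?case
    by (rule Ck_on_SucI[OF open_UNIV has_derivative_compose[OF bounded_linear_imp_has_derivative Ck_on_SucD(1)]])
      (use Suc in auto)
qed

text \<open>For an outer function of one real variable the derivative of the composition is a product of a
composition with \<open>h'\<close> and a derivative of \<open>g\<close>, so products are the only other closure property that
the induction needs.\<close>

lemma Ck_on_compose:
  fixes g :: "'a::real_normed_vector \<Rightarrow> real" and h :: "real \<Rightarrow> real"
  shows "Ck_on k T h \<Longrightarrow> Ck_on k S g \<Longrightarrow> open S \<Longrightarrow> open T \<Longrightarrow> g ` S \<subseteq> T \<Longrightarrow> Ck_on k S (\<lambda>x. h (g x))"
proof (induction k arbitrary: h)
  case 0 then show ?case by (auto intro: continuous_on_compose2)
next
  case (Suc k)
  have lin: "frechet_derivative h (at (g x)) r = r * frechet_derivative h (at (g x)) 1" if "x \<in> S" for x r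
  proof -
    have "bounded_linear (frechet_derivative h (at (g x)))"
      using Ck_on_SucD(1)[OF Suc.prems(4,1), of "g x"] that Suc.prems(5) has_derivative_bounded_linear by auto
    from linear_scale[OF bounded_linear.linear[OF this], of r 1] show ?thesis by simp
  qed
  show ?case
  proof (rule Ck_on_SucI[where F = "\<lambda>x v. frechet_derivative g (at x) v * frechet_derivative h (at (g x)) 1"])
    fix x assume x: "x \<in> S"
    have "((\<lambda>x. h (g x)) has_derivative (\<lambda>v. frechet_derivative h (at (g x)) (frechet_derivative g (at x) v))) (at x)"
      by (rule has_derivative_compose[OF Ck_on_SucD(1) Ck_on_SucD(1)]) (use Suc.prems x in \<open>auto simp del: Ck_on.simps\<close>)
    then show "((\<lambda>x. h (g x)) has_derivative (\<lambda>v. frechet_derivative g (at x) v * frechet_derivative h (at (g x)) 1)) (at x)"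
      by (rule has_derivative_eq_rhs) (rule ext, rule lin[OF x])
  next
    fix v
    have "Ck_on k S (\<lambda>x. frechet_derivative h (at (g x)) 1)"
      by (rule Suc.IH[OF Ck_on_SucD(2)[OF Suc.prems(4,1)] Ck_on_Suc_imp[OF Suc.prems(2)] Suc.prems(3-5)])
    then show "Ck_on k S (\<lambda>x. frechet_derivative g (at x) v * frechet_derivative h (at (g x)) 1)"
      by (intro Ck_on_mult) (use Suc.prems in auto)
  qed (use Suc in auto)
qed

lemma Ck_on_real_SucI:
  fixes h :: "real \<Rightarrow> real"
  assumes "open S" "\<And>x. x \<in> S \<Longrightarrow> (h has_real_derivative h' x) (at x)" "Ck_on k S h'"
  shows "Ck_on (Suc k) S h"
  by (rule Ck_on_SucI[where F = "\<lambda>x v. h' x * v"])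
    (use assms in \<open>auto simp: has_field_derivative_def intro: Ck_on_mult Ck_on_const\<close>)

lemma Ck_on_inverse: "Ck_on k (- {0::real}) inverse"
proof (induction k)
  case 0 then show ?case by (auto intro: continuous_intros)
next
  case (Suc k)
  have d: "(inverse has_real_derivative - (inverse x * inverse x)) (at x)" if "x \<in> - {0}" for x :: real
    using DERIV_inverse'[OF DERIV_ident, of x UNIV] that by simp
  show ?case
    by (rule Ck_on_real_SucI[OF _ d]) (auto intro!: Ck_on_minus Ck_on_mult Suc)
qed

lemma Ck_on_sqrt: "Ck_on k {0::real<..} sqrt"
proof (induction k)
  case 0 then show ?case by (auto intro: continuous_intros)
next
  case (Suc k)
  have d: "(sqrt has_real_derivative inverse (sqrt x) * (1/2)) (at x)" if "x \<in> {0<..}" for x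
    using DERIV_real_sqrt[of x] that by simp
  have "Ck_on k {0::real<..} (\<lambda>x. inverse (sqrt x))"
    by (rule Ck_on_compose[OF Ck_on_inverse Suc]) auto
  then have "Ck_on k {0::real<..} (\<lambda>x. inverse (sqrt x) * (1/2))"
    by (intro Ck_on_mult Ck_on_const) auto
  then show ?case
    by (rule Ck_on_real_SucI[OF _ d, rotated 2]) auto
qed

lemma Ck_on_norm: "Ck_on k (- {0::'a::real_inner}) norm"
proof -
  have i: "Ck_on k UNIV (\<lambda>x::'a. x \<bullet> x)" for k
  proof (induction k)
    case 0 then show ?case by (auto intro: continuous_intros)
  next
    case (Suc k)
    show ?case
      by (rule Ck_on_SucI[where F = "\<lambda>x v. x \<bullet> v + v \<bullet> x"])
        (auto intro!: derivative_eq_intros Ck_on_add Ck_on_bounded_linear bounded_linear_inner_left bounded_linear_inner_right bounded_linear_add)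
  qed
  have "Ck_on k (- {0::'a}) (\<lambda>x. sqrt (x \<bullet> x))"
    by (rule Ck_on_compose[OF Ck_on_sqrt]) (auto intro: Ck_on_subset[OF i])
  then show ?thesis by (simp add: norm_eq_sqrt_inner[abs_def])
qed

section \<open>A smooth function that is flat at the origin\<close>

text \<open>The functions $p(1/x) e^{-1/x}$ on the positive axis, extended by zero, form a class that is closed
under differentiation; each of them is smooth for that reason.\<close>

definition flat_poly :: "real poly \<Rightarrow> real \<Rightarrow> real" where
  "flat_poly p x = (if x > 0 then poly p (inverse x) * exp (- inverse x) else 0)"

lemma flat_poly_tendsto_0: "((\<lambda>x. poly p (inverse x) * exp (- inverse x)) \<longlongrightarrow> 0) (at_right (0::real))"
proof -
  have 1: "((\<lambda>x::real. x ^ i * exp (- x)) \<longlongrightarrow> 0) at_top" for i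
    using tendsto_power_div_exp_0[of i] by (simp add: exp_minus divide_inverse)
  have "((\<lambda>x::real. \<Sum>i\<le>degree p. coeff p i * (x ^ i * exp (- x))) \<longlongrightarrow> (\<Sum>i\<le>degree p. coeff p i * 0)) at_top"
    by (intro tendsto_intros 1)
  then have "((\<lambda>x::real. poly p x * exp (- x)) \<longlongrightarrow> 0) at_top"
    by (simp add: poly_altdef sum_distrib_right mult.assoc)
  then show ?thesis
    by (rule filterlim_compose[OF _ filterlim_inverse_at_top_right])
qed

lemma flat_poly_deriv:
  "(flat_poly p has_real_derivative flat_poly (monom 1 2 * (p - pderiv p)) x) (at x)"
proof -
  consider "x > 0" | "x < 0" | "x = 0" by linarith
  then show ?thesis
  proof cases
    case 1
    have "((\<lambda>x. poly p (inverse x) * exp (- inverse x)) has_real_derivative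
        flat_poly (monom 1 2 * (p - pderiv p)) x) (at x)"
      using 1 by (auto intro!: derivative_eq_intros
          simp: flat_poly_def poly_monom algebra_simps power2_eq_square)
    then show ?thesis
      by (rule DERIV_cong_ev[THEN iffD1, rotated 3])
        (use 1 eventually_nhds_in_open[of "{0<..}" x] in \<open>auto simp: flat_poly_def elim: eventually_mono\<close>)
  next
    case 2
    have "((\<lambda>x. 0) has_real_derivative 0) (at x)" by simp
    then have "(flat_poly p has_real_derivative 0) (at x)"
      by (rule DERIV_cong_ev[THEN iffD1, rotated 3])
        (use 2 eventually_nhds_in_open[of "{..<0}" x] in \<open>auto simp: flat_poly_def elim: eventually_mono\<close>)
    then show ?thesis using 2 by (simp add: flat_poly_def)
  next
    case 3
    have "((\<lambda>h. flat_poly p h / h) \<longlongrightarrow> 0) (at_right 0)"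
      using flat_poly_tendsto_0[of "pCons 0 p"]
      by (rule Lim_transform_eventually)
        (auto simp: flat_poly_def divide_inverse algebra_simps eventually_at_filter)
    moreover have "((\<lambda>h. flat_poly p h / h) \<longlongrightarrow> 0) (at_left 0)"
      by (rule tendsto_eventually) (auto simp: flat_poly_def eventually_at_filter)
    ultimately have "((\<lambda>h. flat_poly p h / h) \<longlongrightarrow> 0) (at 0)"
      by (simp add: filterlim_at_split)
    then show ?thesis
      using 3 by (simp add: DERIV_def flat_poly_def)
  qed
qed

lemma Ck_on_flat_poly: "Ck_on k UNIV (flat_poly p)"
proof (induction k arbitrary: p)
  case 0
  then show ?case
    using DERIV_continuous_on[of UNIV "flat_poly p"] flat_poly_deriv by auto
next
  case (Suc k)
  show ?case by (rule Ck_on_real_SucI[OF open_UNIV flat_poly_deriv Suc])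
qed

text \<open>The first two derivatives of \<open>flat\<close> are named for the energy argument, where the first one is the
rate at which a moving weight decreases and the second one bounds the error of that rate.\<close>

definition flat :: "real \<Rightarrow> real" where
  "flat x = (if x > 0 then exp (- inverse x) else 0)"

definition flat' :: "real \<Rightarrow> real" where "flat' = flat_poly (monom 1 2)"

definition flat'' :: "real \<Rightarrow> real" where "flat'' = flat_poly (monom 1 2 * (monom 1 2 - pderiv (monom 1 2)))"

lemma flat_eq_flat_poly: "flat = flat_poly 1"
  by (auto simp: flat_def flat_poly_def)

lemma Ck_on_flat: "Ck_on k UNIV flat" and Ck_on_flat': "Ck_on k UNIV flat'" and Ck_on_flat'': "Ck_on k UNIV flat''"
  unfolding flat_eq_flat_poly flat'_def flat''_def by (rule Ck_on_flat_poly)+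

lemma DERIV_flat: "(flat has_real_derivative flat' x) (at x)"
  using flat_poly_deriv[of 1 x] by (simp add: flat_eq_flat_poly flat'_def)

lemma DERIV_flat': "(flat' has_real_derivative flat'' x) (at x)"
  unfolding flat'_def flat''_def by (rule flat_poly_deriv)

lemma flat_pos: "x > 0 \<Longrightarrow> flat x > 0" and flat_zero: "x \<le> 0 \<Longrightarrow> flat x = 0"
  and flat_nonneg: "flat x \<ge> 0" and flat_le_1: "flat x \<le> 1"
  by (auto simp: flat_def)

lemma flat'_nonneg: "flat' x \<ge> 0"
  by (auto simp: flat'_def flat_poly_def poly_monom)

text \<open>Scaled copies of \<open>flat\<close> converge to the indicator function of the positive axis, so that products of
them approximate indicator functions of boxes.\<close>

lemma flat_scaled_tendsto:
  "x > 0 \<Longrightarrow> (\<lambda>k. flat (real k * x)) \<longlonglongrightarrow> 1"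
proof -
  assume x: "x > 0"
  have "(\<lambda>k. exp (- inverse (real k * x))) \<longlonglongrightarrow> exp (- 0)"
    by (intro tendsto_intros tendsto_inverse_0_at_top filterlim_at_top_mult_tendsto_pos[OF tendsto_const x] filterlim_real_sequentially)
  then have "(\<lambda>k. exp (- inverse (real k * x))) \<longlonglongrightarrow> 1" by simp
  then show "(\<lambda>k. flat (real k * x)) \<longlonglongrightarrow> 1"
    by (rule Lim_transform_eventually)
      (use x in \<open>auto simp: flat_def intro!: eventually_mono[OF eventually_gt_at_top[of 0]]\<close>)
qed


section \<open>Matrices depending smoothly on a parameter\<close>

lemma Ck_on_entry:
  fixes G :: "'a::real_normed_vector \<Rightarrow> real^'n^'m"
  shows "Ck_on k S G \<Longrightarrow> open S \<Longrightarrow> Ck_on k S (\<lambda>x. G x $ i $ j)"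
  by (rule Ck_on_linear_compose[where h = "\<lambda>A. A $ i $ j"])
    (auto intro: bounded_linear_compose[OF bounded_linear_vec_nth bounded_linear_vec_nth])

lemma Ck_on_det:
  fixes G :: "'a::real_normed_vector \<Rightarrow> real^'n::finite^'n"
  assumes "open S" "\<And>i j. Ck_on k S (\<lambda>x. G x $ i $ j)"
  shows "Ck_on k S (\<lambda>x. det (G x))"
  unfolding det_def using assms by (intro Ck_on_sum Ck_on_mult Ck_on_prod Ck_on_const) auto

lemma matrix_inv_mult:
  fixes A :: "real^'n::finite^'n"
  assumes "det A \<noteq> 0"
  shows "A ** matrix_inv A = mat 1" "matrix_inv A ** A = mat 1"
proof -
  have "\<exists>B. A ** B = mat 1 \<and> B ** A = mat 1"
    using assms by (simp add: invertible_det_nz[symmetric] invertible_def)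
  from someI_ex[OF this] show "A ** matrix_inv A = mat 1" "matrix_inv A ** A = mat 1"
    by (simp_all add: matrix_inv_def)
qed

lemma matrix_inv_entry:
  fixes A :: "real^'n::finite^'n"
  assumes "det A \<noteq> 0"
  shows "matrix_inv A $ k $ l = det (\<chi> i j. if j = k then axis l 1 $ i else A $ i $ j) * inverse (det A)"
proof -
  have "A *v (matrix_inv A *v axis l 1) = axis l 1"
    by (simp add: matrix_vector_mul_assoc matrix_inv_mult[OF assms])
  then have "matrix_inv A *v axis l 1 =
      (\<chi> k. det (\<chi> i j. if j = k then axis l 1 $ i else A $ i $ j) / det A)"
    using cramer[OF assms] by simp
  moreover have "(matrix_inv A *v axis l 1) $ k = matrix_inv A $ k $ l"
    by (simp add: matrix_vector_mul_component inner_axis)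
  ultimately show ?thesis by (simp add: divide_inverse)
qed

text \<open>By Cramer's rule the entries of the inverse are quotients of determinants.\<close>

lemma Ck_on_matrix_inv:
  fixes G :: "'a::real_normed_vector \<Rightarrow> real^'n::finite^'n"
  assumes "open S" "Ck_on k S G" "\<And>x. x \<in> S \<Longrightarrow> det (G x) \<noteq> 0"
  shows "Ck_on k S (\<lambda>x. matrix_inv (G x) $ i $ j)"
proof -
  have "Ck_on k S (\<lambda>x. det (\<chi> i' j'. if j' = i then axis j 1 $ i' else G x $ i' $ j'))"
  proof (rule Ck_on_det[OF assms(1)])
    fix i' j'
    show "Ck_on k S (\<lambda>x. (\<chi> i' j'. if j' = i then axis j 1 $ i' else G x $ i' $ j') $ i' $ j')"
      by (cases "j' = i") (auto intro: Ck_on_const Ck_on_entry assms)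
  qed
  moreover have "Ck_on k S (\<lambda>x. inverse (det (G x)))"
    by (rule Ck_on_compose[OF Ck_on_inverse Ck_on_det]) (use assms in \<open>auto intro: Ck_on_entry\<close>)
  ultimately have "Ck_on k S (\<lambda>x. det (\<chi> i' j'. if j' = i then axis j 1 $ i' else G x $ i' $ j')
      * inverse (det (G x)))"
    by (intro Ck_on_mult assms(1))
  then show ?thesis
    by (rule Ck_on_cong[THEN iffD1, OF assms(1), rotated 1]) (simp add: matrix_inv_entry assms(3))
qed

text \<open>Positive definite matrices are invertible and form a convex set, so the determinant has the sign
that it has at the identity matrix.\<close>

lemma det_pos_if_positive_definite:
  fixes A :: "real^'n::finite^'n"
  assumes pos: "\<And>v. v \<noteq> 0 \<Longrightarrow> v \<bullet> (A *v v) > 0"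
  shows "det A > 0"
proof (rule ccontr)
  define B where "B s = (1 - s) *\<^sub>R mat 1 + s *\<^sub>R A" for s :: real
  have nz: "det (B s) \<noteq> 0" if "0 \<le> s" "s \<le> 1" for s
  proof -
    have "v = 0" if "B s *v v = 0" for v
    proof (rule ccontr)
      assume v: "v \<noteq> 0"
      have "v \<bullet> (B s *v v) = (1 - s) * (v \<bullet> v) + s * (v \<bullet> (A *v v))"
        by (simp add: B_def matrix_vector_mult_add_rdistrib scaleR_matrix_vector_assoc[symmetric] inner_add_right)
      moreover have "(1 - s) * (v \<bullet> v) + s * (v \<bullet> (A *v v)) > 0"
        using \<open>0 \<le> s\<close> \<open>s \<le> 1\<close> v pos[OF v]
        by (cases "s = 1") (auto intro!: add_pos_nonneg mult_pos_pos mult_nonneg_nonneg)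
      ultimately show False using that by simp
    qed
    then show ?thesis
      by (metis invertible_det_nz invertible_left_inverse matrix_left_invertible_ker)
  qed
  assume "\<not> det A > 0"
  moreover have "B 1 = A" "B 0 = mat 1" by (simp_all add: B_def)
  moreover have "continuous_on {0..1} (\<lambda>s. det (B s))"
    unfolding det_def B_def by (auto intro!: continuous_intros)
  ultimately have "\<exists>s\<ge>0. s \<le> 1 \<and> det (B s) = 0"
    by (intro IVT2') auto
  then show False using nz by auto
qed

lemma bounded_on_compact:
  fixes f :: "'a::t2_space \<Rightarrow> 'b::real_normed_vector"
  assumes "compact K" "continuous_on K f"
  obtains C where "C > 0" "\<And>x. x \<in> K \<Longrightarrow> norm (f x) \<le> C"
  using compact_imp_bounded[OF compact_continuous_image[OF assms(2,1)]]
  unfolding bounded_pos by auto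

lemma matrix_vector_bound_on_compact:
  fixes A :: "'a::t2_space \<Rightarrow> real^'n::finite^'n"
  assumes "compact K" "\<And>i j. continuous_on K (\<lambda>x. A x $ i $ j)"
  obtains C where "C > 0" "\<And>x v. x \<in> K \<Longrightarrow> norm (A x *v v) \<le> C * norm v"
proof -
  have c: "continuous_on K (\<lambda>x. \<Sum>i\<in>UNIV. \<Sum>j\<in>UNIV. \<bar>A x $ i $ j\<bar>)"
    by (intro continuous_on_sum continuous_on_rabs assms)
  obtain C where C: "C > 0" "\<And>x. x \<in> K \<Longrightarrow> norm (\<Sum>i\<in>UNIV. \<Sum>j\<in>UNIV. \<bar>A x $ i $ j\<bar>) \<le> C"
    using bounded_on_compact[OF assms(1) c] by blast
  have "norm (A x *v v) \<le> C * norm v" if "x \<in> K" for x v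
  proof -
    have "norm (A x *v v) \<le> (\<Sum>i\<in>UNIV. \<bar>(A x *v v) $ i\<bar>)" by (rule norm_le_l1_cart)
    also have "\<dots> \<le> (\<Sum>i\<in>UNIV. (\<Sum>j\<in>UNIV. \<bar>A x $ i $ j\<bar>) * norm v)"
    proof (rule sum_mono)
      fix i
      have "\<bar>(A x *v v) $ i\<bar> \<le> (\<Sum>j\<in>UNIV. \<bar>A x $ i $ j * v $ j\<bar>)"
        unfolding matrix_vector_mult_def by simp
      also have "\<dots> \<le> (\<Sum>j\<in>UNIV. \<bar>A x $ i $ j\<bar> * norm v)"
        by (rule sum_mono) (auto simp: abs_mult intro!: mult_left_mono component_le_norm_cart)
      finally show "\<bar>(A x *v v) $ i\<bar> \<le> (\<Sum>j\<in>UNIV. \<bar>A x $ i $ j\<bar>) * norm v" by (simp add: sum_distrib_right)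
    qed
    also have "\<dots> = (\<Sum>i\<in>UNIV. \<Sum>j\<in>UNIV. \<bar>A x $ i $ j\<bar>) * norm v" by (simp add: sum_distrib_right)
    also have "\<dots> \<le> C * norm v" using C(2)[OF that] by (intro mult_right_mono) auto
    finally show ?thesis .
  qed
  then show thesis using that C(1) by blast
qed

section \<open>Test functions\<close>

lemma test_functionI:
  assumes "\<And>k. Ck_on k UNIV \<phi>" "compact K" "K \<subseteq> S" "\<And>x. x \<notin> K \<Longrightarrow> \<phi> x = 0"
  shows "test_function S \<phi>"
proof -
  have "closure {x. \<phi> x \<noteq> 0} \<subseteq> K"
    by (rule closure_minimal) (use assms in \<open>auto intro: compact_imp_closed\<close>)
  then show ?thesis
    using assms compact_Int_closed[of K "closure {x. \<phi> x \<noteq> 0}"]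
    by (auto simp: test_function_def smooth_on_def Int_absorb1)
qed

lemma test_functionE:
  assumes "test_function S \<phi>"
  obtains K where "\<And>k. Ck_on k UNIV \<phi>" "compact K" "K \<subseteq> S" "\<And>x. x \<notin> K \<Longrightarrow> \<phi> x = 0"
  using assms closure_subset[of "{x. \<phi> x \<noteq> 0}"]
  by (auto simp: test_function_def smooth_on_def)

lemma Ck_on_partial:
  "Ck_on (Suc k) UNIV \<phi> \<Longrightarrow> Ck_on k UNIV (partial i \<phi>)"
  unfolding partial_def[abs_def] by simp

lemma continuous_on_partial: "(\<And>k. Ck_on k UNIV \<phi>) \<Longrightarrow> continuous_on S (partial i \<phi>)"
  using Ck_on_continuous[OF Ck_on_partial[of 0]] continuous_on_subset by blast

lemma frechet_derivative_eq_0_outside: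
  assumes "closed K" "\<And>x. x \<notin> K \<Longrightarrow> \<phi> x = 0" "x \<notin> K"
  shows "frechet_derivative \<phi> (at x) v = 0"
proof -
  have "(\<phi> has_derivative (\<lambda>v. 0)) (at x)"
    using has_derivative_transform_within_open[of "\<lambda>x. 0" "\<lambda>v. 0" x UNIV "- K" \<phi>] assms
    by (auto simp: closed_def)
  from frechet_derivative_at[OF this] show ?thesis by metis
qed

lemma partial_eq_0_outside:
  assumes "closed K" "\<And>x. x \<notin> K \<Longrightarrow> \<phi> x = 0" "x \<notin> K"
  shows "partial i \<phi> x = 0"
  unfolding partial_def by (rule frechet_derivative_eq_0_outside[OF assms])

lemma partial_mult:
  assumes "f differentiable at x" "g differentiable at x"
  shows "partial i (\<lambda>x. f x * g x) x = f x * partial i g x + partial i f x * g x"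
proof -
  have "((\<lambda>x. f x * g x) has_derivative
      (\<lambda>v. f x * frechet_derivative g (at x) v + frechet_derivative f (at x) v * g x)) (at x)"
    using assms by (intro has_derivative_mult) (auto simp: frechet_derivative_works)
  from frechet_derivative_at[OF this] show ?thesis
    unfolding partial_def by metis
qed

lemma Ck_on_differentiable: "(\<And>k. Ck_on k UNIV f) \<Longrightarrow> f differentiable at x"
  by (metis Ck_on.simps(2) UNIV_I differentiable_on_eq_differentiable_at open_UNIV)

section \<open>The fundamental lemma of the calculus of variations\<close>

definition box_bump :: "'a::euclidean_space \<Rightarrow> 'a \<Rightarrow> nat \<Rightarrow> 'a \<Rightarrow> real" where
  "box_bump a b k x = (\<Prod>i\<in>Basis. flat (real k * (x \<bullet> i - a \<bullet> i)) * flat (real k * (b \<bullet> i - x \<bullet> i)))"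

lemma Ck_on_box_bump: "Ck_on m UNIV (box_bump a b k)"
  unfolding box_bump_def
  by (intro Ck_on_prod Ck_on_mult Ck_on_compose[OF Ck_on_flat] Ck_on_const Ck_on_diff
      Ck_on_bounded_linear bounded_linear_inner_left) auto

lemma box_bump_zero: "x \<notin> box a b \<Longrightarrow> box_bump a b k x = 0"
proof -
  assume "x \<notin> box a b"
  then obtain i where i: "i \<in> Basis" "x \<bullet> i \<le> a \<bullet> i \<or> b \<bullet> i \<le> x \<bullet> i"
    by (force simp: mem_box)
  then have "flat (real k * (x \<bullet> i - a \<bullet> i)) * flat (real k * (b \<bullet> i - x \<bullet> i)) = 0"
    by (auto intro!: flat_zero simp: mult_nonneg_nonpos)
  then show ?thesis
    unfolding box_bump_def using i(1) by (intro prod_zero) auto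
qed

lemma box_bump_nonneg: "box_bump a b k x \<ge> 0" and box_bump_le_1: "box_bump a b k x \<le> 1"
  unfolding box_bump_def
  by (auto intro!: prod_nonneg prod_le_1 mult_nonneg_nonneg mult_le_one flat_nonneg flat_le_1)

lemma box_bump_tendsto: fixes a b x :: "'a::euclidean_space" shows "(\<lambda>k. box_bump a b k x) \<longlonglongrightarrow> indicator (box a b) x"
proof (cases "x \<in> box a b")
  case True
  then have "(\<lambda>k. box_bump a b k x) \<longlonglongrightarrow> (\<Prod>i\<in>(Basis::'a set). 1 * 1)"
    unfolding box_bump_def by (intro tendsto_prod tendsto_mult[OF flat_scaled_tendsto flat_scaled_tendsto]) (auto simp: mem_box)
  then show ?thesis using True by simp
qed (simp add: box_bump_zero)

lemma test_function_box_bump: "cbox a b \<subseteq> S \<Longrightarrow> test_function S (box_bump a b k)"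
  by (rule test_functionI[OF Ck_on_box_bump compact_cbox])
    (use box_subset_cbox[of a b] in \<open>auto intro!: box_bump_zero\<close>)

text \<open>Bumps in the box converge boundedly to its indicator function.\<close>

lemma integral_box_eq_0:
  fixes f :: "'a::euclidean_space \<Rightarrow> real"
  assumes "open S"
    and int: "\<And>K. compact K \<Longrightarrow> K \<subseteq> S \<Longrightarrow> set_integrable lebesgue K f"
    and orth: "\<And>\<phi>. test_function S \<phi> \<Longrightarrow> (LINT x:S|lebesgue. f x * \<phi> x) = 0"
    and sub: "cbox c d \<subseteq> S"
  shows "(LINT x:box c d|lebesgue. f x) = 0"
proof -
  have F: "integrable lebesgue (\<lambda>x. indicator (cbox c d) x *\<^sub>R f x)"
    using int[OF compact_cbox sub] by (simp add: set_integrable_def)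
  have cb: "box_bump c d k \<in> borel_measurable lebesgue" for k
    using borel_measurable_continuous_onI[OF Ck_on_continuous[OF Ck_on_box_bump[of 0 c d k]]]
    by (auto intro: measurable_completion)
  have eq: "(\<lambda>x. indicator S x *\<^sub>R (f x * box_bump c d k x)) = (\<lambda>x. (indicator (cbox c d) x *\<^sub>R f x) * box_bump c d k x)" for k
    using sub box_subset_cbox[of c d] box_bump_zero[of _ c d k] by (force simp: indicator_def fun_eq_iff)
  have "(\<lambda>k. LINT x|lebesgue. indicator S x *\<^sub>R (f x * box_bump c d k x)) \<longlonglongrightarrow>
      (LINT x|lebesgue. (indicator (cbox c d) x *\<^sub>R f x) * indicator (box c d) x)"
    unfolding eq
  proof (rule integral_dominated_convergence[where w = "\<lambda>x. norm (indicator (cbox c d) x *\<^sub>R f x)"])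
    show "AE x in lebesgue. (\<lambda>k. (indicator (cbox c d) x *\<^sub>R f x) * box_bump c d k x) \<longlonglongrightarrow>
        (indicator (cbox c d) x *\<^sub>R f x) * indicator (box c d) x"
      by (intro AE_I2 tendsto_intros box_bump_tendsto)
    show "AE x in lebesgue. norm ((indicator (cbox c d) x *\<^sub>R f x) * box_bump c d k x)
        \<le> norm (indicator (cbox c d) x *\<^sub>R f x)" for k
      by (intro AE_I2) (subst norm_mult, intro mult_right_le_one_le norm_ge_zero,
          simp_all add: box_bump_nonneg box_bump_le_1)
    show "(\<lambda>x. indicat_real (cbox c d) x *\<^sub>R f x * box_bump c d k x) \<in> borel_measurable lebesgue" for k
      using F cb by (intro borel_measurable_times) auto
    show "(\<lambda>x. indicat_real (cbox c d) x *\<^sub>R f x * indicator (box c d) x) \<in> borel_measurable lebesgue"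
      using F by (intro borel_measurable_times borel_measurable_indicator) auto
  qed (use F in auto)
  moreover have "(LINT x|lebesgue. indicator S x *\<^sub>R (f x * box_bump c d k x)) = 0" for k
    using orth[OF test_function_box_bump[OF sub]] by (simp add: set_lebesgue_integral_def)
  ultimately have "(LINT x|lebesgue. (indicator (cbox c d) x *\<^sub>R f x) * indicator (box c d) x) = 0"
    using LIMSEQ_unique[OF _ tendsto_const] by auto
  moreover have "(\<lambda>x. (indicator (cbox c d) x *\<^sub>R f x) * indicator (box c d) x) = (\<lambda>x. indicator (box c d) x *\<^sub>R f x)"
    using box_subset_cbox[of c d] by (force simp: indicator_def fun_eq_iff)
  ultimately show ?thesis by (simp add: set_lebesgue_integral_def)
qed

text \<open>Boxes are closed under intersection and generate the Borel sets, so the integral vanishes over every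
Borel set.\<close>

lemma AE_eq_0_if_integral_boxes_eq_0:
  fixes F :: "'a::euclidean_space \<Rightarrow> real"
  assumes F: "integrable lebesgue F" and total: "integral\<^sup>L lebesgue F = 0"
    and boxes: "\<And>c d. (LINT x:box c d|lebesgue. F x) = 0"
  shows "AE x in lebesgue. F x = 0"
proof -
  have si: "set_integrable lebesgue A F" if "A \<in> sets lebesgue" for A
    using integrable_mult_indicator[OF that F] by (simp add: set_integrable_def)
  have sets_borel_eq: "sigma_sets UNIV (range (\<lambda>(a, b). box a b :: 'a set)) = sets borel"
    by (simp add: borel_eq_box)
  have borel: "(LINT x:A|lebesgue. F x) = 0" if "A \<in> sets borel" for A
  proof -
    have "A \<in> sigma_sets UNIV (range (\<lambda>(a, b). box a b))"
      using that unfolding borel_eq_box by simp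
    then show ?thesis
    proof (rule sigma_sets_induct_disjoint[rotated 2, consumes 1, case_names a b c d e f])
      fix A :: "'a set" assume "A \<in> range (\<lambda>(a, b). box a b)"
      then show "(LINT x:A|lebesgue. F x) = 0" using boxes by auto
    next
      fix A :: "'a set" assume A': "A \<in> sigma_sets UNIV (range (\<lambda>(a, b). box a b))" "(LINT x:A|lebesgue. F x) = 0"
      then have A: "A \<in> sets lebesgue"
        unfolding sets_borel_eq by (auto intro: sets_completionI_sets)
      have "(LINT x:A \<union> (UNIV - A)|lebesgue. F x) = (LINT x:A|lebesgue. F x) + (LINT x:UNIV - A|lebesgue. F x)"
        by (rule set_integral_Un) (use A in \<open>auto intro!: si\<close>)
      then show "(LINT x:UNIV - A|lebesgue. F x) = 0" using A' total by (simp add: set_lebesgue_integral_def)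
    next
      fix A :: "nat \<Rightarrow> 'a set"
      assume dis: "disjoint_family A" and sets: "range A \<subseteq> sigma_sets UNIV (range (\<lambda>(a, b). box a b))"
        and 0: "\<And>i. (LINT x:A i|lebesgue. F x) = 0"
      have A: "A i \<in> sets lebesgue" for i
        using sets unfolding sets_borel_eq by (auto intro: sets_completionI_sets)
      show "(LINT x:(\<Union>i. A i)|lebesgue. F x) = 0"
        by (subst lebesgue_integral_countable_add)
          (use A dis in \<open>auto intro!: si simp: 0 disjoint_family_on_def\<close>)
    next
      show "Int_stable (range (\<lambda>(a, b). box a b :: 'a set))"
        by (auto simp: Int_stable_def box_Int_box)
    qed (auto simp: set_lebesgue_integral_def)
  qed
  \<comment> \<open>a Borel representative, because only Borel sets are generated by boxes\<close>
  obtain F' where F': "F' \<in> borel_measurable lborel" "AE x in lborel. F x = F' x"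
    using completion_ex_borel_measurable_real[of F lborel] F by auto
  have ae: "AE x in lebesgue. F x = F' x" using F'(2) by (rule AE_completion)
  have F'l: "F' \<in> borel_measurable lebesgue" using F'(1) by (rule measurable_completion)
  have "integrable lebesgue F'"
    using integrable_cong_AE[THEN iffD1, OF _ F'l ae F] F by auto
  then have int: "integrable lborel F'" using F'(1) by (simp add: integrable_completion)
  have "AE x in lborel. F' x = 0"
  proof (rule sigma_finite_measure.density_zero[OF lborel.sigma_finite_measure_axioms int])
    fix A :: "'a set" assume A: "A \<in> sets lborel"
    have "(LINT x:A|lborel. F' x) = (LINT x:A|lebesgue. F' x)"
      using A F'(1) by (simp add: set_lebesgue_integral_def integral_completion)
    also have "\<dots> = (LINT x:A|lebesgue. F x)"
      using ae A F'l F unfolding set_lebesgue_integral_def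
      by (intro integral_cong_AE) (auto intro!: borel_measurable_times borel_measurable_indicator elim: eventually_mono)
    finally show "(LINT x:A|lborel. F' x) = 0" using borel A by simp
  qed
  then have "AE x in lebesgue. F' x = 0" by (rule AE_completion)
  with ae show ?thesis by eventually_elim simp
qed

text \<open>The domain is a countable union of closed boxes, each of which contains its own test functions.\<close>

lemma fundamental_lemma:
  fixes f :: "'a::euclidean_space \<Rightarrow> real"
  assumes S: "open S"
    and int: "\<And>K. compact K \<Longrightarrow> K \<subseteq> S \<Longrightarrow> set_integrable lebesgue K f"
    and orth: "\<And>\<phi>. test_function S \<phi> \<Longrightarrow> (LINT x:S|lebesgue. f x * \<phi> x) = 0"
  shows "AE x\<in>S in lebesgue. f x = 0"
proof -
  obtain \<D> where D: "countable \<D>" "\<D> \<subseteq> Pow S" "\<And>X. X \<in> \<D> \<Longrightarrow> \<exists>a b. X = cbox a b" "\<Union>\<D> = S"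
    using open_countable_Union_open_cbox[OF S] by metis
  have "AE x\<in>X in lebesgue. f x = 0" if X: "X \<in> \<D>" for X
  proof -
    obtain a b where ab: "X = cbox a b" "cbox a b \<subseteq> S" using D X by blast
    let ?F = "\<lambda>x. indicator (box a b) x *\<^sub>R f x"
    have "set_integrable lebesgue (box a b) f"
      using set_integrable_subset[OF int[OF compact_cbox ab(2)]] box_subset_cbox[of a b] by auto
    then have F: "integrable lebesgue ?F" by (simp add: set_integrable_def)
    have z: "(LINT x:box c d|lebesgue. f x) = 0" if "box c d \<subseteq> box a b" for c d
    proof (cases "box c d = {}")
      case False
      then have "cbox c d \<subseteq> cbox a b" using that
        by (metis closure_box closure_mono closure_cbox[of a b] box_subset_cbox closure_minimal closed_cbox subset_trans)
      then show ?thesis using integral_box_eq_0[OF S int orth] ab by blast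
    qed (simp add: set_lebesgue_integral_def)
    have "AE x in lebesgue. ?F x = 0"
    proof (rule AE_eq_0_if_integral_boxes_eq_0[OF F])
      show "integral\<^sup>L lebesgue ?F = 0" using z[of a b] by (simp add: set_lebesgue_integral_def)
      fix c d :: 'a
      obtain c' d' where "box c d \<inter> box a b = box c' d'" using box_Int_box by blast
      then show "(LINT x:box c d|lebesgue. ?F x) = 0"
        using z[of c' d'] by (simp add: set_lebesgue_integral_def indicator_inter_arith[symmetric] flip: mult.assoc) (metis inf_le2)
    qed
    moreover have "AE x in lebesgue. x \<notin> cbox a b - box a b"
      using negligible_frontier_interval[of a b] by (intro AE_not_in) (simp add: negligible_iff_null_sets)
    ultimately show ?thesis unfolding ab by eventually_elim (auto simp: indicator_def split: if_splits)
  qed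
  then have "AE x in lebesgue. \<forall>X\<in>\<D>. x \<in> X \<longrightarrow> f x = 0"
    by (intro AE_ball_countable[OF D(1), THEN iffD2]) auto
  then show ?thesis by eventually_elim (use D(4) in auto)
qed

section \<open>Second derivatives in the sense of distributions\<close>

lemma set_lebesgue_integral_eq_integral_if_support:
  fixes f :: "real \<Rightarrow> real"
  assumes "continuous_on {a..b} f" "{a..b} \<subseteq> S" "\<And>t. t \<notin> {a..b} \<Longrightarrow> f t = 0"
  shows "(LINT t:S|lebesgue. f t) = integral {a..b} f"
proof -
  have "(\<lambda>t. indicator S t *\<^sub>R f t) = (\<lambda>t. indicator {a..b} t *\<^sub>R f t)"
    using assms(2,3) by (force simp: indicator_def fun_eq_iff)
  moreover have "set_integrable lborel {a..b} f"
    using borel_integrable_atLeastAtMost' assms(1) by blast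
  ultimately show ?thesis
    using set_borel_integral_eq_integral(2)[of "{a..b}" f]
    by (simp add: set_lebesgue_integral_def integral_completion set_integrable_def)
qed

lemma integral_eq_if_zero_outside:
  fixes f :: "'a::euclidean_space \<Rightarrow> real"
  assumes "S \<subseteq> T" "\<And>x. x \<notin> S \<Longrightarrow> f x = 0"
  shows "integral T f = integral S f"
proof (rule integral_spike_set)
  have "{x \<in> T - S. f x \<noteq> 0} = {}" "{x \<in> S - T. f x \<noteq> 0} = {}" using assms by auto
  then show "negligible {x \<in> T - S. f x \<noteq> 0}" "negligible {x \<in> S - T. f x \<noteq> 0}"
    by (simp_all only: negligible_empty)
qed

text \<open>Vanishing of the integral is what makes the primitive vanish to the right of the support as well.\<close>

lemma test_function_primitive:
  fixes \<zeta> :: "real \<Rightarrow> real"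
  assumes ck: "\<And>k. Ck_on k UNIV \<zeta>" and a: "0 < a" "a \<le> b"
    and supp: "\<And>t. t \<notin> {a..b} \<Longrightarrow> \<zeta> t = 0" and int: "integral {a..b} \<zeta> = 0"
  obtains \<theta> where "test_function {0<..} \<theta>" "\<And>t. (\<theta> has_real_derivative \<zeta> t) (at t)"
    "\<And>t. t \<notin> {a..b} \<Longrightarrow> \<theta> t = 0"
proof -
  \<comment> \<open>the lower limit lies strictly between zero and the support, so that the integral can be differentiated at every point of the support\<close>
  define \<theta> where "\<theta> t = integral {a/2..t} \<zeta>" for t
  have cont: "continuous_on S \<zeta>" for S
    using Ck_on_continuous[OF ck] continuous_on_subset by blast
  have z0: "\<theta> t = 0" if "t \<le> a" for t
  proof -
    have "integral {a/2..t} \<zeta> = integral {a/2..t} (\<lambda>_. 0)"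
      by (rule integral_spike[of "{a}"]) (use that in \<open>auto intro!: supp[symmetric] supp\<close>)
    then show ?thesis by (simp add: \<theta>_def)
  qed
  have z1: "\<theta> t = 0" if t: "b \<le> t" for t
  proof -
    have i: "\<zeta> integrable_on {x..y}" for x y using integrable_continuous_real[OF cont] .
    have "integral {b..t} \<zeta> = integral {b..t} (\<lambda>_. 0)"
      by (rule integral_spike[of "{b}"]) (auto intro!: supp[symmetric] supp)
    then have "integral {b..t} \<zeta> = 0" by simp
    moreover have "integral {a/2..a} \<zeta> + integral {a..b} \<zeta> = integral {a/2..b} \<zeta>"
      by (rule Henstock_Kurzweil_Integration.integral_combine) (use a i in auto)
    moreover have "integral {a/2..b} \<zeta> + integral {b..t} \<zeta> = integral {a/2..t} \<zeta>"
      by (rule Henstock_Kurzweil_Integration.integral_combine) (use a t i in auto)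
    ultimately show ?thesis using int z0[of a] by (simp add: \<theta>_def)
  qed
  have der: "(\<theta> has_real_derivative \<zeta> t) (at t)" for t
  proof (cases "t < a")
    case True
    have "((\<lambda>_. 0) has_real_derivative 0) (at t)" by simp
    then have "(\<theta> has_real_derivative 0) (at t)"
      by (rule has_field_derivative_transform_within_open[of _ _ _ "{..<a}"]) (use True z0 in auto)
    then show ?thesis using supp[of t] True by simp
  next
    case False
    have "((\<lambda>u. integral {a/2..u} \<zeta>) has_vector_derivative \<zeta> t) (at t within {a/2..t+1})"
      by (rule integral_has_vector_derivative[OF cont]) (use a False in auto)
    moreover have "at t within {a/2..t+1} = at t"
      by (rule at_within_interior) (use a False in auto)
    ultimately show ?thesis
      by (simp add: \<theta>_def[abs_def] has_real_derivative_iff_has_vector_derivative)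
  qed
  have z: "\<theta> t = 0" if "t \<notin> {a..b}" for t
    using that z0[of t] z1[of t] by auto
  have "test_function {0<..} \<theta>"
  proof (rule test_functionI[of _ "{a..b}"])
    show "Ck_on k UNIV \<theta>" for k
      by (rule Ck_on_Suc_imp[OF Ck_on_real_SucI[OF open_UNIV der ck]])
  qed (use a z in auto)
  then show thesis using that der z by blast
qed

text \<open>The lemma of du Bois-Reymond. If \<open>P\<close> is a primitive of \<open>g\<close>, integration by parts shows that \<open>p - P\<close> is
orthogonal to all derivatives of test functions, that is, to all test functions of vanishing
integral, and hence it is constant.\<close>

lemma distributional_second_derivative:
  fixes f p g :: "real \<Rightarrow> real"
  assumes f: "\<And>t. t > 0 \<Longrightarrow> (f has_real_derivative p t) (at t)"
    and p: "continuous_on {0..} p" and g: "continuous_on {0..} g"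
    and weak: "\<And>\<theta>. test_function {0<..} \<theta> \<Longrightarrow>
      (LINT t:{0<..}|lebesgue. deriv (deriv \<theta>) t * f t - \<theta> t * g t) = 0"
    and t: "t \<ge> 0"
  shows "p t - p 0 = integral {0..t} g"
proof -
  define P where "P t = integral {0..t} g" for t
  have P: "(P has_real_derivative g t) (at t)" if "t > 0" for t
  proof -
    have "(P has_vector_derivative g t) (at t within {0..t+1})"
      unfolding P_def[abs_def]
      by (rule integral_has_vector_derivative) (use that in \<open>auto intro: continuous_on_subset[OF g]\<close>)
    moreover have "at t within {0..t+1} = at t"
      by (rule at_within_interior) (use that in auto)
    ultimately show ?thesis
      by (simp add: has_real_derivative_iff_has_vector_derivative)
  qed
  have Pc: "continuous_on {0..} P"
  proof -
    have c: "continuous_on {0..b} P" for b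
      unfolding P_def[abs_def]
      by (rule indefinite_integral_continuous_1) (auto intro!: integrable_continuous_real intro: continuous_on_subset[OF g])
    have "continuous (at t within {0..}) P" if "t \<ge> 0" for t
    proof -
      have "at t within {0..} = at t within {0..t+1}"
        by (rule at_within_nhd[of _ "{..<t+1}"]) auto
      then show ?thesis using c[of "t+1"] that by (auto simp: continuous_on_eq_continuous_within)
    qed
    then show ?thesis by (auto simp: continuous_on_eq_continuous_within)
  qed
  define h where "h t = p t - P t" for t
  have hc: "continuous_on {0..} h" unfolding h_def by (intro continuous_intros p Pc)
  \<comment> \<open>orthogonality to test functions of vanishing integral\<close>
  have key: "integral {a..b} (\<lambda>t. \<zeta> t * h t) = 0"
    if ck: "\<And>k. Ck_on k UNIV \<zeta>" and a: "0 < a" "a \<le> b"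
      and supp: "\<And>t. t \<notin> {a..b} \<Longrightarrow> \<zeta> t = 0" and int: "integral {a..b} \<zeta> = 0" for \<zeta> a b
  proof -
    obtain \<theta> where th: "test_function {0<..} \<theta>" "\<And>t. (\<theta> has_real_derivative \<zeta> t) (at t)"
      "\<And>t. t \<notin> {a..b} \<Longrightarrow> \<theta> t = 0"
      using test_function_primitive[OF ck a supp int] by blast
    define \<zeta>' where "\<zeta>' = deriv \<zeta>"
    have z': "(\<zeta> has_real_derivative \<zeta>' t) (at t)" for t
      using Ck_on_differentiable[OF ck, of t] unfolding \<zeta>'_def
      by (metis DERIV_deriv_iff_real_differentiable)
    have z'_eq: "\<zeta>' t = frechet_derivative \<zeta> (at t) 1" for t
      using fun_cong[OF frechet_derivative_at[OF z'[unfolded has_field_derivative_def]], of t 1] by simp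
    have z'c: "continuous_on S \<zeta>'" for S
      unfolding z'_eq[abs_def]
      by (rule continuous_on_subset[OF Ck_on_continuous[OF Ck_on_SucD(2)[OF open_UNIV ck]]]) auto
    have z'0: "\<zeta>' t = 0" if "t \<notin> {a..b}" for t
      unfolding z'_eq by (rule frechet_derivative_eq_0_outside[OF closed_atLeastAtMost supp that])
    have dth: "deriv \<theta> = \<zeta>" using th(2) DERIV_imp_deriv by blast
    have sub: "{a/2..b+1} \<subseteq> {0..}" "{a/2..b+1} \<subseteq> {0<..}" using a by auto
    have fc: "continuous_on {a/2..b+1} f"
      by (rule DERIV_continuous_on[OF has_field_derivative_at_within[OF f]]) (use a in auto)
    have zc: "continuous_on S \<zeta>" and thc: "continuous_on S \<theta>" for S
      using DERIV_continuous_on[of S] z' th(2) has_field_derivative_at_within by blast+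
    note [continuous_intros] = fc zc thc z'c continuous_on_subset[OF p sub(1)]
      continuous_on_subset[OF g sub(1)] continuous_on_subset[OF Pc sub(1)]
    have "((\<lambda>t. \<zeta>' t * f t + \<zeta> t * p t) has_integral \<zeta> (b+1) * f (b+1) - \<zeta> (a/2) * f (a/2)) {a/2..b+1}"
      by (rule fundamental_theorem_of_calculus)
        (use a in \<open>auto intro!: derivative_eq_intros has_field_derivative_at_within[OF z'] has_field_derivative_at_within[OF f]
          simp flip: has_real_derivative_iff_has_vector_derivative\<close>)
    then have 1: "((\<lambda>t. \<zeta>' t * f t + \<zeta> t * p t) has_integral 0) {a/2..b+1}"
      using a by (simp add: supp)
    have "((\<lambda>t. \<zeta> t * P t + \<theta> t * g t) has_integral \<theta> (b+1) * P (b+1) - \<theta> (a/2) * P (a/2)) {a/2..b+1}"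
      by (rule fundamental_theorem_of_calculus)
        (use a in \<open>auto intro!: derivative_eq_intros has_field_derivative_at_within[OF th(2)] has_field_derivative_at_within[OF P]
          simp flip: has_real_derivative_iff_has_vector_derivative\<close>)
    then have 2: "((\<lambda>t. \<zeta> t * P t + \<theta> t * g t) has_integral 0) {a/2..b+1}"
      using a by (simp add: th(3))
    have "(LINT t:{0<..}|lebesgue. \<zeta>' t * f t - \<theta> t * g t) = 0"
      using weak[OF th(1)] by (simp add: dth \<zeta>'_def)
    also have "(LINT t:{0<..}|lebesgue. \<zeta>' t * f t - \<theta> t * g t) = integral {a/2..b+1} (\<lambda>t. \<zeta>' t * f t - \<theta> t * g t)"
      by (rule set_lebesgue_integral_eq_integral_if_support[OF _ sub(2)])
        (use a z'0 th(3) in \<open>auto intro!: continuous_intros\<close>)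
    finally have "integral {a/2..b+1} (\<lambda>t. \<zeta>' t * f t - \<theta> t * g t) = 0" .
    moreover have "(\<lambda>t. \<zeta>' t * f t - \<theta> t * g t) integrable_on {a/2..b+1}"
      by (intro integrable_continuous_real continuous_intros)
    ultimately have 3: "((\<lambda>t. \<zeta>' t * f t - \<theta> t * g t) has_integral 0) {a/2..b+1}"
      by (simp add: has_integral_integrable_integral)
    have "((\<lambda>t. \<zeta> t * h t) has_integral 0 - 0 - 0) {a/2..b+1}"
      by (rule has_integral_eq[OF _ has_integral_diff[OF has_integral_diff[OF 1 2] 3]])
        (simp add: h_def algebra_simps)
    then have "integral {a/2..b+1} (\<lambda>t. \<zeta> t * h t) = 0" by (simp add: integral_unique)
    moreover have "integral {a/2..b+1} (\<lambda>t. \<zeta> t * h t) = integral {a..b} (\<lambda>t. \<zeta> t * h t)"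
      by (rule integral_eq_if_zero_outside) (use a supp in auto)
    ultimately show ?thesis by simp
  qed
  \<comment> \<open>a fixed bump, subtracted from a given test function to make its integral vanish\<close>
  define \<beta> :: "real \<Rightarrow> real" where "\<beta> = box_bump 1 2 1"
  define J where "J = integral {1..2} \<beta>"
  have \<beta>: "Ck_on k UNIV \<beta>" "t \<notin> {1..2} \<Longrightarrow> \<beta> t = 0" for k t
    unfolding \<beta>_def by (auto intro!: Ck_on_box_bump box_bump_zero)
  have \<beta>c: "continuous_on S \<beta>" for S
    using Ck_on_continuous[OF \<beta>(1)] continuous_on_subset by blast
  have J: "J \<noteq> 0"
  proof
    assume "J = 0"
    moreover have "\<beta> integrable_on {1..2}" by (rule integrable_continuous_real[OF \<beta>c])
    ultimately have "(\<beta> has_integral 0) (cbox 1 2)"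
      by (simp add: J_def has_integral_integrable_integral)
    then have "\<beta> (3/2) = 0"
      by (rule has_integral_0_cbox_imp_0[OF \<beta>c _ , rotated])
        (auto simp: \<beta>_def box_bump_nonneg)
    moreover have "\<beta> (3/2) > 0"
      by (simp add: \<beta>_def box_bump_def flat_pos)
    ultimately show False by simp
  qed
  define C where "C = integral {1..2} (\<lambda>t. \<beta> t * h t) / J"
  have "AE t\<in>{0<..} in lebesgue. h t - C = 0"
  proof (rule fundamental_lemma)
    fix K :: "real set" assume K: "compact K" "K \<subseteq> {0<..}"
    have "integrable lborel (\<lambda>t. indicator K t *\<^sub>R (h t - C))"
      using K by (intro borel_integrable_compact continuous_intros continuous_on_subset[OF hc]) auto
    then show "set_integrable lebesgue K (\<lambda>t. h t - C)"
      unfolding set_integrable_def by (simp add: integrable_completion)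
  next
    fix \<eta> :: "real \<Rightarrow> real" assume "test_function {0<..} \<eta>"
    then obtain K where K: "\<And>k. Ck_on k UNIV \<eta>" "compact K" "K \<subseteq> {0<..}" "\<And>x. x \<notin> K \<Longrightarrow> \<eta> x = 0"
      by (rule test_functionE) metis
    have Kc: "compact (K \<union> {1, 2})" and ne: "K \<union> {1, 2} \<noteq> {}" using K(2) by auto
    obtain a where a: "a \<in> K \<union> {1, 2}" "\<forall>t\<in>K \<union> {1, 2}. a \<le> t" using compact_attains_inf[OF Kc ne] by blast
    obtain b where b: "b \<in> K \<union> {1, 2}" "\<forall>t\<in>K \<union> {1, 2}. t \<le> b" using compact_attains_sup[OF Kc ne] by blast
    have ab: "0 < a" "a \<le> b" "a \<le> 1" "2 \<le> b" using a b K(3) by auto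
    have \<eta>0: "\<eta> t = 0" if "t \<notin> {a..b}" for t using that a b K(4) by auto
    have \<eta>c: "continuous_on S \<eta>" for S
      using Ck_on_continuous[OF K(1)] continuous_on_subset by blast
    have hc': "continuous_on {a..b} h" using ab by (intro continuous_on_subset[OF hc]) auto
    note [continuous_intros] = \<eta>c \<beta>c hc'
    define c where "c = integral {a..b} \<eta> / J"
    have J': "integral {a..b} \<beta> = J"
      unfolding J_def by (rule integral_eq_if_zero_outside) (use ab \<beta>(2) in auto)
    have "integral {a..b} (\<lambda>t. \<beta> t * h t) = integral {1..2} (\<lambda>t. \<beta> t * h t)"
      by (rule integral_eq_if_zero_outside) (use ab \<beta>(2) in auto)
    then have C': "integral {a..b} (\<lambda>t. \<beta> t * h t) = C * J"
      using J by (simp add: C_def)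
    have "integral {a..b} (\<lambda>t. (\<eta> t - c * \<beta> t) * h t) = 0"
    proof (rule key)
      show "Ck_on k UNIV (\<lambda>t. \<eta> t - c * \<beta> t)" for k
        by (intro Ck_on_diff Ck_on_mult Ck_on_const K \<beta>) auto
      show "integral {a..b} (\<lambda>t. \<eta> t - c * \<beta> t) = 0"
        by (subst Henstock_Kurzweil_Integration.integral_diff, (intro integrable_continuous_real continuous_intros)+)
          (simp add: J' c_def J)
      fix t assume "t \<notin> {a..b}" then show "\<eta> t - c * \<beta> t = 0" using \<eta>0 \<beta>(2)[of t] ab by auto
    qed (use ab in auto)
    also have "(\<lambda>t. (\<eta> t - c * \<beta> t) * h t) = (\<lambda>t. \<eta> t * h t - c * (\<beta> t * h t))"
      by (auto simp: algebra_simps)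
    also have "integral {a..b} \<dots> = integral {a..b} (\<lambda>t. \<eta> t * h t) - c * (C * J)"
      by (subst Henstock_Kurzweil_Integration.integral_diff, (intro integrable_continuous_real continuous_intros)+)
        (simp add: C')
    finally have "integral {a..b} (\<lambda>t. \<eta> t * h t) = C * integral {a..b} \<eta>"
      using J by (simp add: c_def)
    moreover have "integral {a..b} (\<lambda>t. (h t - C) * \<eta> t) = integral {a..b} (\<lambda>t. \<eta> t * h t) - C * integral {a..b} \<eta>"
      unfolding left_diff_distrib
      by (subst Henstock_Kurzweil_Integration.integral_diff, (intro integrable_continuous_real continuous_intros)+)
        (simp add: mult.commute)
    ultimately have "integral {a..b} (\<lambda>t. (h t - C) * \<eta> t) = 0" by simp
    then show "(LINT t:{0<..}|lebesgue. (h t - C) * \<eta> t) = 0"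
      by (subst set_lebesgue_integral_eq_integral_if_support[of a b])
        (use ab \<eta>0 in \<open>auto intro!: continuous_intros\<close>)
  qed auto
  then have "AE t\<in>{0<..} in lebesgue. t \<in> {t \<in> {0..}. h t = C}" by eventually_elim auto
  then have "t \<in> {t \<in> {0..}. h t = C}" if "t \<in> {0<..}" for t
    using mem_closed_if_AE_lebesgue_open[OF open_greaterThan
        continuous_closed_preimage_constant[OF hc closed_atLeast]] that by blast
  then have "h t = C" if "t \<in> {0<..}" for t using that by blast
  then have "h t = C" if "t \<ge> 0" for t
    using continuous_constant_on_closure[of "{0<..}" h C t] hc that by (simp add: closure_greaterThan)
  from this[of t] this[of 0] show ?thesis using t by (simp add: h_def P_def)
qed

section \<open>Continuous kernels of positive type\<close>

text \<open>The bound in terms of the oscillation allows the same estimate to be used for all rows of a kernel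
at once.\<close>

lemma Riemann_sum_error:
  fixes f :: "real \<Rightarrow> real"
  assumes h: "h \<ge> 0" and f: "continuous_on {0..real M * h} f"
    and osc: "\<And>s s'. s \<in> {0..real M * h} \<Longrightarrow> s' \<in> {0..real M * h} \<Longrightarrow> \<bar>s - s'\<bar> \<le> h \<Longrightarrow> \<bar>f s - f s'\<bar> \<le> e"
  shows "\<bar>integral {0..real M * h} f - h * (\<Sum>i<M. f (real i * h))\<bar> \<le> e * (real M * h)"
  using f osc
proof (induction M)
  case (Suc M)
  have sub: "{0..real M * h} \<subseteq> {0..real (Suc M) * h}" using h by (auto simp: algebra_simps)
  have IH: "\<bar>integral {0..real M * h} f - h * (\<Sum>i<M. f (real i * h))\<bar> \<le> e * (real M * h)"
    using Suc.prems sub by (intro Suc.IH) (auto intro: continuous_on_subset)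
  have le: "0 \<le> real M * h" "real M * h \<le> real (Suc M) * h" using h by (auto simp: algebra_simps)
  have int: "f integrable_on {0..real (Suc M) * h}" using Suc.prems(1) by (rule integrable_continuous_real)
  have int': "f integrable_on {real M * h..real (Suc M) * h}"
    by (rule integrable_on_subinterval[OF int]) (use le in auto)
  have split: "integral {0..real M * h} f + integral {real M * h..real (Suc M) * h} f = integral {0..real (Suc M) * h} f"
    by (rule Henstock_Kurzweil_Integration.integral_combine[OF le int])
  have "norm (integral {real M * h..real (Suc M) * h} (\<lambda>s. f s - f (real M * h))) \<le> e * (real (Suc M) * h - real M * h)"
    by (rule integral_bound)
      (use le h order_trans[OF le(1)] in \<open>auto intro!: continuous_intros continuous_on_subset[OF Suc.prems(1)] Suc.prems(2) simp: algebra_simps\<close>)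
  moreover have "integral {real M * h..real (Suc M) * h} (\<lambda>s. f s - f (real M * h)) =
      integral {real M * h..real (Suc M) * h} f - h * f (real M * h)"
    using le int' by (subst Henstock_Kurzweil_Integration.integral_diff) (auto simp: algebra_simps)
  ultimately have "\<bar>integral {real M * h..real (Suc M) * h} f - h * f (real M * h)\<bar> \<le> e * h"
    by (simp add: algebra_simps)
  then show ?case
    using IH split by (simp add: algebra_simps)
qed simp

lemma triangle_integral_increment:
  fixes k :: "real \<Rightarrow> real \<Rightarrow> real"
  assumes c: "\<And>s. s \<in> {0..T} \<Longrightarrow> continuous_on {0..T} (k s)"
    and B: "\<And>s s'. s \<in> {0..T} \<Longrightarrow> s' \<in> {0..T} \<Longrightarrow> \<bar>k s s'\<bar> \<le> B"
    and s: "0 \<le> s'" "s' \<le> s" "s \<le> T"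
    and e: "\<And>r. r \<in> {0..T} \<Longrightarrow> \<bar>k s r - k s' r\<bar> \<le> e"
  shows "\<bar>integral {0..s} (k s) - integral {0..s'} (k s')\<bar> \<le> e * T + B * (s - s')"
proof -
  have int: "k r integrable_on {x..y}" if "r \<in> {0..T}" "0 \<le> x" "y \<le> T" for r x y
    using that by (intro integrable_continuous_real continuous_on_subset[OF c]) auto
  have e0: "e \<ge> 0" using e[of 0] s by force
  have split: "integral {0..s'} (k s) + integral {s'..s} (k s) = integral {0..s} (k s)"
    by (rule Henstock_Kurzweil_Integration.integral_combine) (use s int in auto)
  have "norm (integral {0..s'} (\<lambda>r. k s r - k s' r)) \<le> e * (s' - 0)"
    by (rule integral_bound)
      (use s e in \<open>auto intro!: continuous_intros continuous_on_subset[OF c]\<close>)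
  moreover have "integral {0..s'} (\<lambda>r. k s r - k s' r) = integral {0..s'} (k s) - integral {0..s'} (k s')"
    by (rule Henstock_Kurzweil_Integration.integral_diff) (use s int in auto)
  moreover have "e * s' \<le> e * T" using e0 s by (intro mult_left_mono) auto
  moreover have "norm (integral {s'..s} (k s)) \<le> B * (s - s')"
    by (rule integral_bound) (use s B in \<open>auto intro!: continuous_on_subset[OF c]\<close>)
  ultimately show ?thesis using split by (simp add: abs_le_iff)
qed

lemma kernel_uniform:
  fixes k :: "real \<Rightarrow> real \<Rightarrow> real"
  assumes k: "continuous_on ({0..T} \<times> {0..T}) (\<lambda>(s, s'). k s s')"
  shows "s \<in> {0..T} \<Longrightarrow> continuous_on {0..T} (k s)"
    and "\<exists>B\<ge>0. \<forall>s\<in>{0..T}. \<forall>s'\<in>{0..T}. \<bar>k s s'\<bar> \<le> B"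
    and "e > 0 \<Longrightarrow> \<exists>d>0. \<forall>s\<in>{0..T}. \<forall>s'\<in>{0..T}. \<forall>r\<in>{0..T}. \<forall>r'\<in>{0..T}.
      \<bar>s - s'\<bar> < d \<longrightarrow> \<bar>r - r'\<bar> < d \<longrightarrow> \<bar>k s r - k s' r'\<bar> < e"
proof -
  have comp: "compact ({0..T} \<times> {0..T})" by (intro compact_Times compact_Icc)
  show "s \<in> {0..T} \<Longrightarrow> continuous_on {0..T} (k s)"
    using continuous_on_compose2[OF k, of "{0..T}" "Pair s"]
      continuous_on_Pair[OF continuous_on_const[of _ s] continuous_on_id[of "{0..T}"]]
    by (auto simp: image_subset_iff)
  obtain B where "B > 0" "\<And>x. x \<in> {0..T} \<times> {0..T} \<Longrightarrow> norm ((\<lambda>(s, s'). k s s') x) \<le> B"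
    using bounded_on_compact[OF comp k] by metis
  then show "\<exists>B\<ge>0. \<forall>s\<in>{0..T}. \<forall>s'\<in>{0..T}. \<bar>k s s'\<bar> \<le> B"
    by (intro exI[of _ B]) force
  assume "e > 0"
  with compact_uniformly_continuous[OF k comp] obtain d where d: "d > 0"
    "\<And>x x'. x \<in> {0..T} \<times> {0..T} \<Longrightarrow> x' \<in> {0..T} \<times> {0..T} \<Longrightarrow> dist x' x < d \<Longrightarrow>
      dist ((\<lambda>(s, s'). k s s') x') ((\<lambda>(s, s'). k s s') x) < e"
    unfolding uniformly_continuous_on_def by metis
  have "\<bar>k s r - k s' r'\<bar> < e" if "s \<in> {0..T}" "s' \<in> {0..T}" "r \<in> {0..T}" "r' \<in> {0..T}"
    "\<bar>s - s'\<bar> < d/2" "\<bar>r - r'\<bar> < d/2" for s s' r r'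
  proof -
    have "dist (s, r) (s', r') \<le> dist s s' + dist r r'"
      unfolding dist_prod_def by (simp add: sqrt_sum_squares_le_sum)
    also have "\<dots> < d" using that by (simp add: dist_real_def)
    finally show ?thesis using d(2)[of "(s', r')" "(s, r)"] that by (simp add: dist_real_def)
  qed
  then show "\<exists>d>0. \<forall>s\<in>{0..T}. \<forall>s'\<in>{0..T}. \<forall>r\<in>{0..T}. \<forall>r'\<in>{0..T}.
      \<bar>s - s'\<bar> < d \<longrightarrow> \<bar>r - r'\<bar> < d \<longrightarrow> \<bar>k s r - k s' r'\<bar> < e"
    using d(1) by (intro exI[of _ "d/2"]) auto
qed

lemma continuous_on_triangle_integral:
  fixes k :: "real \<Rightarrow> real \<Rightarrow> real"
  assumes k: "continuous_on ({0..T} \<times> {0..T}) (\<lambda>(s, s'). k s s')"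
  shows "continuous_on {0..T} (\<lambda>s. integral {0..s} (k s))"
proof (cases "T \<ge> 0")
  case T: True
  obtain B where B: "B \<ge> 0" "\<And>s s'. s \<in> {0..T} \<Longrightarrow> s' \<in> {0..T} \<Longrightarrow> \<bar>k s s'\<bar> \<le> B"
    using kernel_uniform(2)[OF k] by auto
  show ?thesis
    unfolding continuous_on_iff
  proof (intro ballI allI impI)
    fix s e :: real assume s: "s \<in> {0..T}" and e: "e > 0"
    define e' where "e' = e / (4 * (T + 1))"
    have e': "e' > 0" "e' * T < e / 2"
      using e T by (auto simp: e'_def field_simps intro!: add_pos_nonneg)
    obtain d where d: "d > 0" "\<And>s s' r. s \<in> {0..T} \<Longrightarrow> s' \<in> {0..T} \<Longrightarrow> r \<in> {0..T} \<Longrightarrow>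
        \<bar>s - s'\<bar> < d \<Longrightarrow> \<bar>k s r - k s' r\<bar> < e'"
      using kernel_uniform(3)[OF k e'(1)] by (metis abs_zero diff_self)
    define d' where "d' = min d (e / (2 * (B + 1)))"
    have d': "d' > 0" "d' \<le> d" using d(1) e B(1) by (auto simp: d'_def)
    have *: "\<bar>integral {0..b} (k b) - integral {0..a} (k a)\<bar> < e"
      if "0 \<le> a" "a \<le> b" "b \<le> T" "b - a < d'" for a b
    proof -
      have "\<bar>integral {0..b} (k b) - integral {0..a} (k a)\<bar> \<le> e' * T + B * (b - a)"
        by (rule triangle_integral_increment[OF kernel_uniform(1)[OF k] B(2)])
          (use that d' d(2)[of b a] in \<open>auto intro!: less_imp_le\<close>)
      moreover have "B * (b - a) \<le> e / 2"
      proof -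
        have "B * (b - a) \<le> (B + 1) * (e / (2 * (B + 1)))"
          using that B(1) by (intro mult_mono) (auto simp: d'_def)
        moreover have "B + 1 > 0" using B(1) by simp
        then have "(B + 1) * (e / (2 * (B + 1))) = e / 2" by (simp add: field_simps)
        ultimately show ?thesis by (simp only:)
      qed
      ultimately show ?thesis using e'(2) by linarith
    qed
    show "\<exists>d>0. \<forall>x'\<in>{0..T}. dist x' s < d \<longrightarrow>
        dist (integral {0..x'} (k x')) (integral {0..s} (k s)) < e"
    proof (intro exI[of _ d'] conjI ballI impI)
      fix x' assume x: "x' \<in> {0..T}" "dist x' s < d'"
      show "dist (integral {0..x'} (k x')) (integral {0..s} (k s)) < e"
        using *[of s x'] *[of x' s] x s by (cases "s \<le> x'") (auto simp: dist_real_def abs_minus_commute)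
    qed (use d' in auto)
  qed
qed auto

text \<open>In the application \<open>k s r\<close> is $\langle X(s), X(r)\rangle$ and \<open>c s\<close> is $\langle Y, X(s)\rangle$, and the
conclusion is the inequality $n_0 + \langle Z, Z\rangle - 2 \langle Y, Z\rangle \ge 0$ for the vector
$Z = \int_0^T X$, which need not be formed: by hypothesis the inequality holds for the Riemann sums in
place of $Z$. The square integral of the kernel is written as twice the integral over the triangle
\<open>r \<le> s\<close>, since this form is differentiated in \<open>T\<close> by the fundamental theorem of calculus. The
diagonal terms that the triangle misses are of the order of the step.\<close>

lemma kernel_quadratic_nonneg:
  fixes k :: "real \<Rightarrow> real \<Rightarrow> real" and c :: "real \<Rightarrow> real"
  assumes T: "T > 0"
    and k: "continuous_on ({0..T} \<times> {0..T}) (\<lambda>(s, s'). k s s')" and c: "continuous_on {0..T} c"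
    and sym: "\<And>s s'. k s s' = k s' s"
    and pos: "\<And>N h. h \<ge> 0 \<Longrightarrow> 0 \<le> n0 + h\<^sup>2 * (\<Sum>i<N. \<Sum>j<N. k (real i * h) (real j * h)) - 2 * h * (\<Sum>i<N. c (real i * h))"
  shows "0 \<le> n0 + 2 * integral {0..T} (\<lambda>s. integral {0..s} (k s)) - 2 * integral {0..T} c"
proof (rule field_le_epsilon)
  fix e :: real assume e: "e > 0"
  define g where "g s = integral {0..s} (k s)" for s
  have gc: "continuous_on {0..T} g"
    unfolding g_def[abs_def] by (rule continuous_on_triangle_integral[OF k])
  \<comment> \<open>the three Riemann sums contribute at most six errors of size e/20, the diagonal contributes e/5\<close>
  define e' where "e' = e / (20 * (T + 1)\<^sup>2)"
  have e': "e' > 0" "e' * T\<^sup>2 \<le> e / 20" "e' * T \<le> e / 20"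
  proof -
    show "e' > 0" using e T by (auto simp: e'_def)
    have "T\<^sup>2 \<le> (T + 1)\<^sup>2" "T \<le> (T + 1)\<^sup>2" using T by (auto simp: power2_eq_square algebra_simps)
    then show "e' * T\<^sup>2 \<le> e / 20" "e' * T \<le> e / 20"
      using e T by (auto simp: e'_def field_simps intro!: mult_left_mono)
  qed
  obtain B where B: "B \<ge> 0" "\<And>s s'. s \<in> {0..T} \<Longrightarrow> s' \<in> {0..T} \<Longrightarrow> \<bar>k s s'\<bar> \<le> B"
    using kernel_uniform(2)[OF k] by auto
  obtain d1 where d1: "d1 > 0" "\<And>s r r'. s \<in> {0..T} \<Longrightarrow> r \<in> {0..T} \<Longrightarrow> r' \<in> {0..T} \<Longrightarrow>
      \<bar>r - r'\<bar> < d1 \<Longrightarrow> \<bar>k s r - k s r'\<bar> < e'"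
    using kernel_uniform(3)[OF k e'(1)] by (metis abs_zero diff_self)
  obtain d2 where d2: "d2 > 0" "\<And>s s'. s \<in> {0..T} \<Longrightarrow> s' \<in> {0..T} \<Longrightarrow> \<bar>s - s'\<bar> < d2 \<Longrightarrow> \<bar>g s - g s'\<bar> < e'"
    using compact_uniformly_continuous[OF gc compact_Icc] e'(1)
    unfolding uniformly_continuous_on_def dist_real_def by (metis abs_minus_commute)
  obtain d3 where d3: "d3 > 0" "\<And>s s'. s \<in> {0..T} \<Longrightarrow> s' \<in> {0..T} \<Longrightarrow> \<bar>s - s'\<bar> < d3 \<Longrightarrow> \<bar>c s - c s'\<bar> < e'"
    using compact_uniformly_continuous[OF c compact_Icc] e'(1)
    unfolding uniformly_continuous_on_def dist_real_def by (metis abs_minus_commute)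
  define d where "d = Min {d1, d2, d3, e / (5 * (T * B + 1))}"
  have dpos: "d > 0" using d1 d2 d3 e B T by (auto simp: d_def intro!: divide_pos_pos add_nonneg_pos)
  obtain N :: nat where N: "T / d < real N" using reals_Archimedean2 by blast
  have N0: "N > 0" using N T dpos by (metis divide_pos_pos gr0I less_trans of_nat_0 order_less_asym)
  define h where "h = T / real N"
  have h: "h > 0" "real N * h = T" "h < d"
    using N N0 T dpos by (auto simp: h_def field_simps)
  have hd: "h < d1" "h < d2" "h < d3" "h \<le> e / (5 * (T * B + 1))" using h(3) by (auto simp: d_def)
  have pt: "real i * h \<in> {0..T}" "real i * h \<le> T" if "i < N" for i
    using that h by (auto simp flip: h(2) intro!: mult_right_mono)
  have 1: "\<bar>integral {0..T} g - h * (\<Sum>i<N. g (real i * h))\<bar> \<le> e' * T"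
    using Riemann_sum_error[of h N g e'] h gc d2(2) hd by (force intro: less_imp_le)
  have 2: "\<bar>integral {0..T} c - h * (\<Sum>i<N. c (real i * h))\<bar> \<le> e' * T"
    using Riemann_sum_error[of h N c e'] h c d3(2) hd by (force intro: less_imp_le)
  have 3: "\<bar>g (real i * h) - h * (\<Sum>j<i. k (real i * h) (real j * h))\<bar> \<le> e' * T" if i: "i < N" for i
  proof -
    have sub: "{0..real i * h} \<subseteq> {0..T}" using pt[OF i] by auto
    have "\<bar>integral {0..real i * h} (k (real i * h)) - h * (\<Sum>j<i. k (real i * h) (real j * h))\<bar> \<le> e' * (real i * h)"
    proof (rule Riemann_sum_error)
      show "continuous_on {0..real i * h} (k (real i * h))"
        by (rule continuous_on_subset[OF kernel_uniform(1)[OF k pt(1)[OF i]] sub])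
      show "\<bar>k (real i * h) s - k (real i * h) s'\<bar> \<le> e'"
        if "s \<in> {0..real i * h}" "s' \<in> {0..real i * h}" "\<bar>s - s'\<bar> \<le> h" for s s'
        using d1(2)[OF pt(1)[OF i], of s s'] that sub hd by force
    qed (use h in auto)
    also have "\<dots> \<le> e' * T" using pt[OF i] e' by (intro mult_left_mono) auto
    finally show ?thesis by (simp add: g_def)
  qed
  have 4: "\<bar>h * (\<Sum>i<N. g (real i * h)) - h * (\<Sum>i<N. h * (\<Sum>j<i. k (real i * h) (real j * h)))\<bar> \<le> e' * T\<^sup>2"
  proof -
    have "\<bar>(\<Sum>i<N. g (real i * h) - h * (\<Sum>j<i. k (real i * h) (real j * h)))\<bar> \<le> (\<Sum>i<N. e' * T)"
      by (rule order_trans[OF sum_abs sum_mono]) (use 3 in auto)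
    then have "h * \<bar>(\<Sum>i<N. g (real i * h) - h * (\<Sum>j<i. k (real i * h) (real j * h)))\<bar> \<le> h * (real N * (e' * T))"
      using h by (intro mult_left_mono) auto
    also have "\<dots> = e' * T\<^sup>2" using h(2) by (simp add: power2_eq_square algebra_simps)
    finally show ?thesis
      using h by (simp add: sum_subtractf right_diff_distrib[symmetric] abs_mult)
  qed
  have sq: "(\<Sum>i<n. \<Sum>j<n. k (real i * h) (real j * h)) =
      2 * (\<Sum>i<n. \<Sum>j<i. k (real i * h) (real j * h)) + (\<Sum>i<n. k (real i * h) (real i * h))" for n
  proof (induction n)
    case (Suc n)
    have "(\<Sum>i<Suc n. \<Sum>j<Suc n. k (real i * h) (real j * h)) =
      (\<Sum>i<n. \<Sum>j<n. k (real i * h) (real j * h)) + (\<Sum>i<n. k (real i * h) (real n * h))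
      + (\<Sum>j<n. k (real n * h) (real j * h)) + k (real n * h) (real n * h)"
      by (simp add: sum.distrib)
    moreover have "(\<Sum>i<n. k (real i * h) (real n * h)) = (\<Sum>j<n. k (real n * h) (real j * h))"
      by (rule sum.cong[OF refl sym])
    ultimately show ?case using Suc by simp
  qed simp
  have 5: "h\<^sup>2 * (\<Sum>i<N. k (real i * h) (real i * h)) \<le> e / 5"
  proof -
    have "(\<Sum>i<N. k (real i * h) (real i * h)) \<le> (\<Sum>i<N. B)"
      by (rule sum_mono) (use B(2) pt in \<open>auto simp: abs_le_iff\<close>)
    then have "h\<^sup>2 * (\<Sum>i<N. k (real i * h) (real i * h)) \<le> h\<^sup>2 * (real N * B)"
      by (intro mult_left_mono) auto
    also have "\<dots> = h * (T * B)" using h(2) by (simp add: power2_eq_square algebra_simps)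
    also have "\<dots> \<le> e / (5 * (T * B + 1)) * (T * B + 1)"
      using hd(4) T B h by (intro mult_mono) auto
    also have "\<dots> = e / 5"
    proof -
      have "T * B + 1 > 0" using T B by (intro add_nonneg_pos) auto
      then show ?thesis by (simp add: field_simps)
    qed
    finally show ?thesis .
  qed
  have 6: "0 \<le> n0 + 2 * (h * (\<Sum>i<N. h * (\<Sum>j<i. k (real i * h) (real j * h))))
      + h\<^sup>2 * (\<Sum>i<N. k (real i * h) (real i * h)) - 2 * (h * (\<Sum>i<N. c (real i * h)))"
    using pos[OF less_imp_le[OF h(1)], of N] unfolding sq
    by (simp add: sum_distrib_left power2_eq_square algebra_simps)
  show "0 \<le> n0 + 2 * integral {0..T} (\<lambda>s. integral {0..s} (k s)) - 2 * integral {0..T} c + e"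
    unfolding g_def[symmetric] using 1 2 4 5 6 e' by (simp only: abs_le_iff) linarith
qed

section \<open>Square integrable functions and bounded bilinear forms\<close>

definition L2 :: "'c measure \<Rightarrow> ('c \<Rightarrow> 'a::euclidean_space) \<Rightarrow> bool" where
  "L2 M f \<longleftrightarrow> f \<in> borel_measurable M \<and> integrable M (\<lambda>x. (norm (f x))\<^sup>2)"

lemma L2_add: assumes "L2 M f" "L2 M g" shows "L2 M (\<lambda>x. f x + g x)"
  unfolding L2_def
proof
  show m: "(\<lambda>x. f x + g x) \<in> borel_measurable M" using assms by (auto simp: L2_def intro: borel_measurable_add)
  have b: "(norm (f x + g x))\<^sup>2 \<le> 2 * (norm (f x))\<^sup>2 + 2 * (norm (g x))\<^sup>2" for x
    using power_mono[OF norm_triangle_ineq[of "f x" "g x"], of 2] sum_squares_bound[of "norm (f x)" "norm (g x)"]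
    by (simp add: power2_sum)
  show "integrable M (\<lambda>x. (norm (f x + g x))\<^sup>2)"
    by (rule Bochner_Integration.integrable_bound[of M "\<lambda>x. 2 * (norm (f x))\<^sup>2 + 2 * (norm (g x))\<^sup>2"])
      (use assms m b in \<open>auto simp: L2_def\<close>)
qed

lemma L2_scaleR: "L2 M f \<Longrightarrow> L2 M (\<lambda>x. c *\<^sub>R f x)"
  by (auto simp: L2_def power_mult_distrib)

lemma L2_diff: "L2 M f \<Longrightarrow> L2 M g \<Longrightarrow> L2 M (\<lambda>x. f x - g x)"
  using L2_add[of M f "\<lambda>x. (-1) *\<^sub>R g x"] L2_scaleR[of M g "-1"] by simp

lemma L2_sum: "(\<And>i. i \<in> I \<Longrightarrow> L2 M (f i)) \<Longrightarrow> L2 M (\<lambda>x. \<Sum>i\<in>I. f i x)"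
  by (induction I rule: infinite_finite_induct) (auto intro: L2_add simp: L2_def[of M "\<lambda>_. 0"])

text \<open>The discriminant, for the Cauchy-Schwarz inequality.\<close>

lemma square_le_if_quadratic_nonneg:
  fixes A B X :: real
  assumes "A \<ge> 0" "\<And>l. 0 \<le> l\<^sup>2 * A - 2 * l * X + B"
  shows "X\<^sup>2 \<le> A * B"
proof (cases "A = 0")
  case True
  have "X = 0"
  proof (rule ccontr)
    assume "X \<noteq> 0"
    then show False using assms(2)[of "(B + 1) / (2 * X)"] True by simp
  qed
  then show ?thesis using True by simp
next
  case False
  then show ?thesis using assms(2)[of "X / A"] assms(1)
    by (simp add: power2_eq_square field_simps)
qed

definition L2_tendsto :: "'c measure \<Rightarrow> ('i \<Rightarrow> 'c \<Rightarrow> 'a::euclidean_space) \<Rightarrow> ('c \<Rightarrow> 'a) \<Rightarrow> 'i filter \<Rightarrow> bool" where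
  "L2_tendsto M f g F \<longleftrightarrow> (\<forall>\<^sub>F s in F. L2 M (f s)) \<and> L2 M g \<and> ((\<lambda>s. LINT x|M. (norm (f s x - g x))\<^sup>2) \<longlongrightarrow> 0) F"

lemma L2_tendsto_const: "L2 M f \<Longrightarrow> L2_tendsto M (\<lambda>_. f) f F"
  by (simp add: L2_tendsto_def)

lemma L2_tendsto_compose:
  "L2_tendsto M f g F \<Longrightarrow> filterlim r F F' \<Longrightarrow> L2_tendsto M (\<lambda>s. f (r s)) g F'"
  unfolding L2_tendsto_def by (auto intro: filterlim_compose eventually_compose_filterlim)

definition pairing :: "'c measure \<Rightarrow> ('c \<Rightarrow> 'a \<Rightarrow> 'b \<Rightarrow> real) \<Rightarrow> ('c \<Rightarrow> 'a) \<Rightarrow> ('c \<Rightarrow> 'b) \<Rightarrow> real" where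
  "pairing M \<beta> f g = (LINT x|M. \<beta> x (f x) (g x))"

text \<open>Pairings of square integrable functions by means of a bounded family of bilinear forms. The
instances are the products of the functions, the inner products of their gradients, and the
pairing of a function with the radial part of a gradient, each with a bounded weight.\<close>

locale L2_form =
  fixes M :: "'c measure" and \<beta> :: "'c \<Rightarrow> 'a::euclidean_space \<Rightarrow> 'b::euclidean_space \<Rightarrow> real"
  assumes bilinear: "bilinear (\<beta> x)"
    and bounded_form: "\<exists>C. \<forall>x\<in>space M. \<forall>a b. \<bar>\<beta> x a b\<bar> \<le> C * norm a * norm b"
    and measurable_form: "f \<in> borel_measurable M \<Longrightarrow> g \<in> borel_measurable M \<Longrightarrow> (\<lambda>x. \<beta> x (f x) (g x)) \<in> borel_measurable M"
begin

definition C :: real where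
  "C = (SOME C. 0 \<le> C \<and> (\<forall>x\<in>space M. \<forall>a b. \<bar>\<beta> x a b\<bar> \<le> C * norm a * norm b))"

lemma C_nonneg: "0 \<le> C" and bound: "x \<in> space M \<Longrightarrow> \<bar>\<beta> x a b\<bar> \<le> C * norm a * norm b"
proof -
  obtain C0 where C0: "\<forall>x\<in>space M. \<forall>a b. \<bar>\<beta> x a b\<bar> \<le> C0 * norm a * norm b"
    using bounded_form by blast
  have "\<bar>\<beta> x a b\<bar> \<le> \<bar>C0\<bar> * norm a * norm b" if "x \<in> space M" for x a b
  proof -
    have "C0 * norm a * norm b \<le> \<bar>C0\<bar> * norm a * norm b" by (intro mult_right_mono) auto
    then show ?thesis using C0 that order_trans by blast
  qed
  then have "\<exists>C. 0 \<le> C \<and> (\<forall>x\<in>space M. \<forall>a b. \<bar>\<beta> x a b\<bar> \<le> C * norm a * norm b)"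
    by (intro exI[of _ "\<bar>C0\<bar>"]) auto
  then have "0 \<le> C \<and> (\<forall>x\<in>space M. \<forall>a b. \<bar>\<beta> x a b\<bar> \<le> C * norm a * norm b)"
    unfolding C_def by (rule someI_ex)
  then show "0 \<le> C" "x \<in> space M \<Longrightarrow> \<bar>\<beta> x a b\<bar> \<le> C * norm a * norm b" by auto
qed

abbreviation form :: "('c \<Rightarrow> 'a) \<Rightarrow> ('c \<Rightarrow> 'b) \<Rightarrow> real" where
  "form \<equiv> pairing M \<beta>"

lemma integrable_norm_mult:
  assumes "L2 M (f :: 'c \<Rightarrow> 'a)" "L2 M (g :: 'c \<Rightarrow> 'b)"
  shows "integrable M (\<lambda>x. norm (f x) * norm (g x))"
proof (rule Bochner_Integration.integrable_bound[of M "\<lambda>x. (norm (f x))\<^sup>2 + (norm (g x))\<^sup>2"])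
  have "norm (f x) * norm (g x) \<le> (norm (f x))\<^sup>2 + (norm (g x))\<^sup>2" for x
    using sum_squares_bound[of "norm (f x)" "norm (g x)", unfolded mult.assoc]
      mult_nonneg_nonneg[OF norm_ge_zero norm_ge_zero, of "f x" "g x"] by linarith
  then show "AE x in M. norm (norm (f x) * norm (g x)) \<le> norm ((norm (f x))\<^sup>2 + (norm (g x))\<^sup>2)"
    by (intro AE_I2) auto
qed (use assms in \<open>auto simp: L2_def\<close>)

lemma integrable_form:
  assumes "L2 M f" "L2 M g" shows "integrable M (\<lambda>x. \<beta> x (f x) (g x))"
proof (rule Bochner_Integration.integrable_bound[of M "\<lambda>x. C * (norm (f x) * norm (g x))"])
  show "integrable M (\<lambda>x. C * (norm (f x) * norm (g x)))"
    using integrable_norm_mult[OF assms] by simp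
  show "AE x in M. norm (\<beta> x (f x) (g x)) \<le> norm (C * (norm (f x) * norm (g x)))"
    using bound C_nonneg by (intro AE_I2) (auto simp: abs_mult mult.assoc)
qed (use assms in \<open>auto simp: L2_def intro: measurable_form\<close>)

lemma abs_form_le:
  assumes "L2 M f" "L2 M g"
  shows "\<bar>form f g\<bar> \<le> C * sqrt (LINT x|M. (norm (f x))\<^sup>2) * sqrt (LINT x|M. (norm (g x))\<^sup>2)"
proof -
  define X where "X = (LINT x|M. norm (f x) * norm (g x))"
  define A where "A = (LINT x|M. (norm (f x))\<^sup>2)"
  define B where "B = (LINT x|M. (norm (g x))\<^sup>2)"
  have int: "integrable M (\<lambda>x. (norm (f x))\<^sup>2)" "integrable M (\<lambda>x. (norm (g x))\<^sup>2)"
    "integrable M (\<lambda>x. norm (f x) * norm (g x))"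
    using assms integrable_norm_mult[OF assms] by (auto simp: L2_def)
  have AB: "A \<ge> 0" "B \<ge> 0" "X \<ge> 0" by (auto simp: A_def B_def X_def)
  have "X\<^sup>2 \<le> A * B"
  proof (rule square_le_if_quadratic_nonneg[OF AB(1)])
    fix l :: real
    have "0 \<le> (LINT x|M. (l * norm (f x) - norm (g x))\<^sup>2)" by simp
    also have "\<dots> = (LINT x|M. l\<^sup>2 * (norm (f x))\<^sup>2 - 2 * l * (norm (f x) * norm (g x)) + (norm (g x))\<^sup>2)"
      by (simp add: power2_diff power_mult_distrib algebra_simps)
    also have "\<dots> = l\<^sup>2 * A - 2 * l * X + B"
      using int by (simp add: A_def B_def X_def)
    finally show "0 \<le> l\<^sup>2 * A - 2 * l * X + B" .
  qed
  then have "X \<le> sqrt A * sqrt B"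
    using AB real_le_rsqrt by (simp add: real_sqrt_mult[symmetric])
  moreover have "\<bar>form f g\<bar> \<le> C * X"
  proof -
    have "\<bar>form f g\<bar> \<le> (LINT x|M. \<bar>\<beta> x (f x) (g x)\<bar>)"
      unfolding pairing_def using integral_norm_bound[of M "\<lambda>x. \<beta> x (f x) (g x)"] by simp
    also have "\<dots> \<le> (LINT x|M. C * (norm (f x) * norm (g x)))"
      using integrable_form[OF assms] int(3) bound by (intro integral_mono) (auto simp: mult.assoc)
    finally show ?thesis by (simp add: X_def)
  qed
  ultimately show ?thesis
    using C_nonneg mult_left_mono[of X "sqrt A * sqrt B" C] by (simp add: A_def B_def mult.assoc)
qed

lemma form_diff_left: "L2 M f \<Longrightarrow> L2 M f' \<Longrightarrow> L2 M g \<Longrightarrow> form (\<lambda>x. f x - f' x) g = form f g - form f' g"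
  by (simp add: pairing_def bilinear_lsub[OF bilinear] integrable_form)

lemma form_diff_right: "L2 M f \<Longrightarrow> L2 M g \<Longrightarrow> L2 M g' \<Longrightarrow> form f (\<lambda>x. g x - g' x) = form f g - form f g'"
  by (simp add: pairing_def bilinear_rsub[OF bilinear] integrable_form)

lemma form_scale_left: "form (\<lambda>x. c *\<^sub>R f x) g = c * form f g"
  by (simp add: pairing_def bilinear_lmul[OF bilinear])

lemma form_scale_right: "form f (\<lambda>x. c *\<^sub>R g x) = c * form f g"
  by (simp add: pairing_def bilinear_rmul[OF bilinear])

lemma form_tendsto:
  assumes f: "L2_tendsto M f f0 F" and g: "L2_tendsto M g g0 F"
  shows "((\<lambda>s. form (f s) (g s)) \<longlongrightarrow> form f0 g0) F"
proof -
  let ?a = "\<lambda>s. LINT x|M. (norm (f s x - f0 x))\<^sup>2" and ?b = "\<lambda>s. LINT x|M. (norm (g s x - g0 x))\<^sup>2"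
  let ?A = "LINT x|M. (norm (f0 x))\<^sup>2" and ?B = "LINT x|M. (norm (g0 x))\<^sup>2"
  have L: "L2 M f0" "L2 M g0" using f g by (auto simp: L2_tendsto_def)
  have "((\<lambda>s. C * sqrt (?a s) * sqrt (?b s) + C * sqrt (?a s) * sqrt ?B + C * sqrt ?A * sqrt (?b s)) \<longlongrightarrow>
      C * sqrt 0 * sqrt 0 + C * sqrt 0 * sqrt ?B + C * sqrt ?A * sqrt 0) F"
    using f g by (intro tendsto_intros) (auto simp: L2_tendsto_def)
  then have lim: "((\<lambda>s. C * sqrt (?a s) * sqrt (?b s) + C * sqrt (?a s) * sqrt ?B + C * sqrt ?A * sqrt (?b s)) \<longlongrightarrow> 0) F"
    by simp
  have "\<forall>\<^sub>F s in F. L2 M (f s) \<and> L2 M (g s)"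
    using f g by (auto simp: L2_tendsto_def intro: eventually_conj)
  then have "\<forall>\<^sub>F s in F. norm (form (f s) (g s) - form f0 g0) \<le>
      C * sqrt (?a s) * sqrt (?b s) + C * sqrt (?a s) * sqrt ?B + C * sqrt ?A * sqrt (?b s)"
  proof eventually_elim
    case (elim s)
    have "form (f s) (g s) - form f0 g0 = form (\<lambda>x. f s x - f0 x) (\<lambda>x. g s x - g0 x)
        + form (\<lambda>x. f s x - f0 x) g0 + form f0 (\<lambda>x. g s x - g0 x)"
      using elim L by (simp add: form_diff_left form_diff_right L2_diff)
    then show ?case
      using abs_form_le[of "\<lambda>x. f s x - f0 x" "\<lambda>x. g s x - g0 x"] abs_form_le[of "\<lambda>x. f s x - f0 x" g0]
        abs_form_le[of f0 "\<lambda>x. g s x - g0 x"] elim L by (simp add: L2_diff)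
  qed
  then have "((\<lambda>s. form (f s) (g s) - form f0 g0) \<longlongrightarrow> 0) F"
    by (rule Lim_null_comparison[OF _ lim])
  then show ?thesis by (simp add: LIM_zero_iff)
qed

lemma form_sum_sum:
  assumes "\<And>i. i \<in> I \<Longrightarrow> L2 M (f i)" "\<And>j. j \<in> J \<Longrightarrow> L2 M (g j)" "finite I" "finite J"
  shows "form (\<lambda>x. \<Sum>i\<in>I. f i x) (\<lambda>x. \<Sum>j\<in>J. g j x) = (\<Sum>i\<in>I. \<Sum>j\<in>J. form (f i) (g j))"
proof -
  have "(\<lambda>x. \<beta> x (\<Sum>i\<in>I. f i x) (\<Sum>j\<in>J. g j x)) = (\<lambda>x. \<Sum>i\<in>I. \<Sum>j\<in>J. \<beta> x (f i x) (g j x))"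
    using bilinear_sum[OF bilinear, of _ "\<lambda>i. f i _" I "\<lambda>j. g j _" J]
    by (simp add: sum.cartesian_product)
  then show ?thesis
    using assms integrable_form by (simp add: pairing_def)
qed

lemma uniform_limit_form:
  assumes f: "\<And>s. s \<in> S \<Longrightarrow> L2 M (f s)" "\<And>s. s \<in> S \<Longrightarrow> (LINT x|M. (norm (f s x))\<^sup>2) \<le> B"
    and e: "L2_tendsto M e e0 F"
  shows "uniform_limit S (\<lambda>k s. form (f s) (e k)) (\<lambda>s. form (f s) e0) F"
proof (rule uniform_limitI)
  fix \<epsilon> :: real assume \<epsilon>: "\<epsilon> > 0"
  have e0: "L2 M e0" using e by (simp add: L2_tendsto_def)
  have "((\<lambda>k. C * sqrt B * sqrt (LINT x|M. (norm (e k x - e0 x))\<^sup>2)) \<longlongrightarrow> C * sqrt B * sqrt 0) F"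
    using e by (intro tendsto_intros) (auto simp: L2_tendsto_def)
  then have "\<forall>\<^sub>F k in F. C * sqrt B * sqrt (LINT x|M. (norm (e k x - e0 x))\<^sup>2) < \<epsilon>"
    using \<epsilon> by (auto dest: order_tendstoD(2))
  moreover have "\<forall>\<^sub>F k in F. L2 M (e k)" using e by (auto simp: L2_tendsto_def)
  ultimately show "\<forall>\<^sub>F k in F. \<forall>s\<in>S. dist (form (f s) (e k)) (form (f s) e0) < \<epsilon>"
  proof eventually_elim
    case (elim k)
    show ?case
    proof
      fix s assume s: "s \<in> S"
      let ?e = "sqrt (LINT x|M. (norm (e k x - e0 x))\<^sup>2)"
      have "\<bar>form (f s) (\<lambda>x. e k x - e0 x)\<bar> \<le> C * sqrt (LINT x|M. (norm (f s x))\<^sup>2) * ?e"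
        using elim f s e0 by (intro abs_form_le L2_diff) auto
      also have "\<dots> \<le> C * sqrt B * ?e"
        using C_nonneg f(2)[OF s] by (intro mult_right_mono mult_left_mono) auto
      finally show "dist (form (f s) (e k)) (form (f s) e0) < \<epsilon>"
        using elim f s e0 by (simp add: form_diff_right dist_real_def)
    qed
  qed
qed

end

definition weight :: "'c measure \<Rightarrow> ('c \<Rightarrow> real) \<Rightarrow> bool" where
  "weight M \<omega> \<longleftrightarrow> \<omega> \<in> borel_measurable M \<and> (\<exists>B. \<forall>x\<in>space M. \<bar>\<omega> x\<bar> \<le> B)"

lemma weightI: "\<omega> \<in> borel_measurable M \<Longrightarrow> (\<And>x. x \<in> space M \<Longrightarrow> \<bar>\<omega> x\<bar> \<le> B) \<Longrightarrow> weight M \<omega>"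
  unfolding weight_def by blast

lemma weight_const: "weight M (\<lambda>_. c)"
  by (rule weightI) auto

lemma weight_mult:
  assumes "weight M \<omega>" "weight M \<omega>'" shows "weight M (\<lambda>x. \<omega> x * \<omega>' x)"
proof -
  obtain B B' where B: "\<And>x. x \<in> space M \<Longrightarrow> \<bar>\<omega> x\<bar> \<le> B" "\<And>x. x \<in> space M \<Longrightarrow> \<bar>\<omega>' x\<bar> \<le> B'"
    using assms by (auto simp: weight_def)
  show ?thesis
  proof (rule weightI)
    show "\<bar>\<omega> x * \<omega>' x\<bar> \<le> B * B'" if "x \<in> space M" for x
      unfolding abs_mult using B[OF that] by (intro mult_mono) auto
  qed (use assms in \<open>auto simp: weight_def\<close>)
qed

lemma weight_add_mult:
  assumes "weight M \<omega>" "weight M \<omega>'" shows "weight M (\<lambda>x. \<omega> x + c * \<omega>' x)"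
proof -
  have c: "weight M (\<lambda>x. c * \<omega>' x)" by (rule weight_mult[OF weight_const assms(2)])
  obtain B B' where "\<And>x. x \<in> space M \<Longrightarrow> \<bar>\<omega> x\<bar> \<le> B" "\<And>x. x \<in> space M \<Longrightarrow> \<bar>c * \<omega>' x\<bar> \<le> B'"
    using assms(1) c unfolding weight_def by blast
  then have "\<bar>\<omega> x + c * \<omega>' x\<bar> \<le> B + B'" if "x \<in> space M" for x
    using abs_triangle_ineq[of "\<omega> x" "c * \<omega>' x"] that by force
  then show ?thesis by (rule weightI[rotated]) (use assms in \<open>auto simp: weight_def\<close>)
qed

text \<open>Weights do not lead out of the class, so one set of limit rules serves all weights.\<close>

lemma L2_form_weighted:
  assumes "L2_form M \<beta>" "weight M \<omega>"
  shows "L2_form M (\<lambda>x r s. \<omega> x * \<beta> x r s)"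
proof -
  interpret L2_form M \<beta> by fact
  obtain B where B: "\<And>x. x \<in> space M \<Longrightarrow> \<bar>\<omega> x\<bar> \<le> B" using assms(2) by (auto simp: weight_def)
  show ?thesis
  proof
    show "bilinear (\<lambda>r s. \<omega> x * \<beta> x r s)" for x
      using bilinear[of x] by (auto simp: bilinear_def linear_iff algebra_simps)
    have "\<bar>\<omega> x * \<beta> x r s\<bar> \<le> (B * C) * norm r * norm s" if x: "x \<in> space M" for x r s
    proof -
      have "\<bar>\<omega> x\<bar> * \<bar>\<beta> x r s\<bar> \<le> B * (C * norm r * norm s)"
        using B[OF x] bound[OF x] by (intro mult_mono) auto
      then show ?thesis by (simp add: abs_mult mult.assoc)
    qed
    then show "\<exists>C. \<forall>x\<in>space M. \<forall>r s. \<bar>\<omega> x * \<beta> x r s\<bar> \<le> C * norm r * norm s" by blast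
  qed (use assms(2) in \<open>auto simp: weight_def intro!: borel_measurable_times measurable_form\<close>)
qed

lemma L2_form_mult: "L2_form M (\<lambda>x (r::real) s. r * s)"
  by unfold_locales (auto simp: bilinear_def abs_mult algebra_simps intro!: linearI exI[of _ 1])

section \<open>The energy argument\<close>

text \<open>Taylor's formula for a moving weight, with a remainder that is uniform over a bounded range of \<open>y\<close>.\<close>

lemma flat_taylor_bound:
  fixes B T :: real
  obtains C where "C \<ge> 0"
    "\<And>y d. \<bar>y\<bar> \<le> B \<Longrightarrow> \<bar>d\<bar> \<le> 1 \<Longrightarrow> \<bar>flat (y - d) - flat y + d * flat' y\<bar> \<le> C * d\<^sup>2"
proof -
  obtain C where C: "C > 0" "\<And>y. y \<in> {-(B+1)..B+1} \<Longrightarrow> norm (flat'' y) \<le> C"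
    using bounded_on_compact[OF compact_Icc, of "-(B+1)" "B+1" flat''] Ck_on_continuous[OF Ck_on_flat'']
      continuous_on_subset by (metis subset_UNIV)
  have "\<bar>flat (y - d) - flat y + d * flat' y\<bar> \<le> C * d\<^sup>2" if y: "\<bar>y\<bar> \<le> B" "\<bar>d\<bar> \<le> 1" for y d
  proof -
    let ?S = "{min y (y - d)..max y (y - d)}"
    have S: "?S \<subseteq> {-(B+1)..B+1}" using y by auto
    have S': "norm (flat'' z) \<le> C" if "z \<in> ?S" for z using C(2) S that by blast
    have lip: "norm (flat' z - flat' y) \<le> C * norm (z - y)" if "z \<in> ?S" for z
      by (rule field_differentiable_bound[of ?S flat' flat'', OF _ has_field_derivative_at_within[OF DERIV_flat'] S'])
        (use that in \<open>auto simp: convex_real_interval\<close>)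
    have "norm ((flat (y - d) - flat' y * (y - d)) - (flat y - flat' y * y)) \<le> (C * \<bar>d\<bar>) * norm ((y - d) - y)"
    proof (rule field_differentiable_bound[of ?S _ "\<lambda>z. flat' z - flat' y"])
      fix z assume z: "z \<in> ?S"
      show "((\<lambda>z. flat z - flat' y * z) has_field_derivative flat' z - flat' y) (at z within ?S)"
        by (auto intro!: derivative_eq_intros has_field_derivative_at_within[OF DERIV_flat])
      have "C * norm (z - y) \<le> C * \<bar>d\<bar>" using z C(1) by (intro mult_left_mono) auto
      then show "norm (flat' z - flat' y) \<le> C * \<bar>d\<bar>" using lip[OF z] by linarith
    qed (auto simp: convex_real_interval)
    then show ?thesis by (simp add: algebra_simps power2_eq_square)
  qed
  then show thesis using that[of C] C(1) by auto
qed

text \<open>The energy argument without geometry. In the application \<open>M\<close> is the Riemannian volume on a compact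
annulus, \<open>D t\<close> the gradient of \<open>u t\<close>, \<open>a\<close> the inner product of covectors, \<open>b\<close> the radial component,
\<open>q\<close> a function of \<open>norm x\<close>, and \<open>\<kappa>\<close> its radial derivative. The assumption \<open>b_le_a\<close> says that the radial
covector has norm at most one, which is the speed limit. The assumption \<open>weak\<close> is the wave equation,
integrated in time from zero velocity and tested with the product of \<open>u t\<close> and the weight at time \<open>t\<close>.\<close>

locale energy_setting = finite_measure M
  for M :: "'c measure" +
  fixes a :: "'c \<Rightarrow> 'v::euclidean_space \<Rightarrow> 'v \<Rightarrow> real" and b :: "'c \<Rightarrow> 'v \<Rightarrow> real"
    and q \<kappa> :: "'c \<Rightarrow> real" and Q :: real
    and u v :: "real \<Rightarrow> 'c \<Rightarrow> real" and D :: "real \<Rightarrow> 'c \<Rightarrow> 'v"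
  assumes a_form: "L2_form M a" and a_sym: "a x p p' = a x p' p"
    and b_form: "L2_form M (\<lambda>x r p. r * b x p)"
    and b_le_a: "x \<in> space M \<Longrightarrow> (b x p)\<^sup>2 \<le> a x p p"
    and q_measurable: "q \<in> borel_measurable M" and q_bound: "x \<in> space M \<Longrightarrow> \<bar>q x\<bar> \<le> Q"
    and \<kappa>_measurable: "\<kappa> \<in> borel_measurable M" and \<kappa>_bound: "x \<in> space M \<Longrightarrow> \<bar>\<kappa> x\<bar> \<le> 1"
    and u_L2: "t \<ge> 0 \<Longrightarrow> L2 M (u t)"
    and u_derivative: "t \<ge> 0 \<Longrightarrow> L2_tendsto M (\<lambda>s x. (u s x - u t x) / (s - t)) (v t) (at t within {0..})"
    and D_continuous: "t \<ge> 0 \<Longrightarrow> L2_tendsto M D (D t) (at t within {0..})"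
    and u_0: "AE x in M. u 0 x = 0"
    and weak: "t > 0 \<Longrightarrow> (LINT x|M. flat (q x - t) * (u t x * v t x)) =
      - integral {0..t} (\<lambda>s. (LINT x|M. flat (q x - t) * a x (D s x) (D t x)) +
          (LINT x|M. (flat' (q x - t) * \<kappa> x) * (u t x * b x (D s x))))"
begin

definition uu :: "('c \<Rightarrow> real) \<Rightarrow> ('c \<Rightarrow> real) \<Rightarrow> ('c \<Rightarrow> real) \<Rightarrow> real" where
  "uu \<omega> = pairing M (\<lambda>x r s. \<omega> x * (r * s))"
definition DD :: "('c \<Rightarrow> real) \<Rightarrow> ('c \<Rightarrow> 'v) \<Rightarrow> ('c \<Rightarrow> 'v) \<Rightarrow> real" where
  "DD \<omega> = pairing M (\<lambda>x r s. \<omega> x * a x r s)"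
definition uD :: "('c \<Rightarrow> real) \<Rightarrow> ('c \<Rightarrow> real) \<Rightarrow> ('c \<Rightarrow> 'v) \<Rightarrow> real" where
  "uD \<omega> = pairing M (\<lambda>x r s. \<omega> x * (r * b x s))"

lemmas uu_form = L2_form_weighted[OF L2_form_mult, of M]
lemmas DD_form = L2_form_weighted[OF a_form]
lemmas uD_form = L2_form_weighted[OF b_form]

lemmas uu_tendsto = L2_form.form_tendsto[OF uu_form, folded uu_def]
  and uu_diff_left = L2_form.form_diff_left[OF uu_form, folded uu_def]
  and uu_diff_right = L2_form.form_diff_right[OF uu_form, folded uu_def]
  and uu_scale_left = L2_form.form_scale_left[OF uu_form, folded uu_def]
  and uu_scale_right = L2_form.form_scale_right[OF uu_form, folded uu_def]
  and uu_integrable = L2_form.integrable_form[OF uu_form]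
  and DD_tendsto = L2_form.form_tendsto[OF DD_form, folded DD_def]
  and DD_scale_left = L2_form.form_scale_left[OF DD_form, folded DD_def]
  and DD_scale_right = L2_form.form_scale_right[OF DD_form, folded DD_def]
  and DD_sum_sum = L2_form.form_sum_sum[OF DD_form, folded DD_def]
  and DD_integrable = L2_form.integrable_form[OF DD_form]
  and uD_tendsto = L2_form.form_tendsto[OF uD_form, folded uD_def]
  and uD_scale_right = L2_form.form_scale_right[OF uD_form, folded uD_def]
  and uD_sum_sum = L2_form.form_sum_sum[OF uD_form, folded uD_def]
  and uD_integrable = L2_form.integrable_form[OF uD_form]

lemma D_L2: "t \<ge> 0 \<Longrightarrow> L2 M (D t)" and v_L2: "t \<ge> 0 \<Longrightarrow> L2 M (v t)"
  using D_continuous[of t] u_derivative[of t] by (auto simp: L2_tendsto_def)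

text \<open>Continuity in time, in a form that can be composed with the two coordinates of a kernel.\<close>

lemma L2_tendsto_along:
  fixes f :: "real \<Rightarrow> 'c \<Rightarrow> 'w::euclidean_space" and t :: real
  assumes L2: "\<And>t. t \<ge> 0 \<Longrightarrow> L2 M (f t)" and f: "L2_tendsto M f (f t) (at t within {0..})"
    and r: "(r \<longlongrightarrow> t) F" "\<forall>\<^sub>F s in F. r s \<ge> 0"
  shows "L2_tendsto M (\<lambda>s. f (r s)) (f t) F"
proof -
  have "continuous (at t within {0..}) (\<lambda>s. LINT x|M. (norm (f s x - f t x))\<^sup>2)"
    using f by (simp add: L2_tendsto_def continuous_within)
  from continuous_within_tendsto_compose[OF this _ r(1)] r(2)
  have "((\<lambda>s. LINT x|M. (norm (f (r s) x - f t x))\<^sup>2) \<longlongrightarrow> 0) F" by simp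
  moreover have "\<forall>\<^sub>F s in F. L2 M (f (r s))" using r(2) by eventually_elim (rule L2)
  ultimately show ?thesis using f by (simp add: L2_tendsto_def)
qed

lemma D_tendsto:
  "t \<ge> 0 \<Longrightarrow> (r \<longlongrightarrow> t) F \<Longrightarrow> \<forall>\<^sub>F s in F. r s \<ge> 0 \<Longrightarrow> L2_tendsto M (\<lambda>s. D (r s)) (D t) F"
  by (rule L2_tendsto_along[OF D_L2 D_continuous])

lemma u_continuous: assumes t: "t \<ge> 0" shows "L2_tendsto M u (u t) (at t within {0..})"
proof -
  let ?d = "\<lambda>s x. (u s x - u t x) / (s - t)"
  have "((\<lambda>s. (s - t)\<^sup>2 * uu (\<lambda>_. 1) (?d s) (?d s)) \<longlongrightarrow> (t - t)\<^sup>2 * uu (\<lambda>_. 1) (v t) (v t)) (at t within {0..})"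
    by (intro tendsto_intros uu_tendsto weight_const u_derivative t)
  then have "((\<lambda>s. LINT x|M. (norm (u s x - u t x))\<^sup>2) \<longlongrightarrow> 0) (at t within {0..})"
  proof (rule Lim_transform_eventually[OF tendsto_eq_rhs])
    have "(s - t)\<^sup>2 * uu (\<lambda>_. 1) (?d s) (?d s) = (LINT x|M. (norm (u s x - u t x))\<^sup>2)" if "s \<noteq> t" for s
    proof -
      have "(s - t)\<^sup>2 * uu (\<lambda>_. 1) (?d s) (?d s) = (LINT x|M. (s - t)\<^sup>2 * (?d s x * ?d s x))"
        by (simp add: uu_def pairing_def)
      also have "(\<lambda>x. (s - t)\<^sup>2 * (?d s x * ?d s x)) = (\<lambda>x. (norm (u s x - u t x))\<^sup>2)"
        using that by (auto simp: power2_eq_square)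
      finally show ?thesis .
    qed
    then show "\<forall>\<^sub>F s in at t within {0..}. (s - t)\<^sup>2 * uu (\<lambda>_. 1) (?d s) (?d s) = (LINT x|M. (norm (u s x - u t x))\<^sup>2)"
      by (auto simp: eventually_at_filter)
  qed simp
  moreover have "\<forall>\<^sub>F s in at t within {0..}. L2 M (u s)"
    using u_L2 by (auto simp: eventually_at_filter)
  ultimately show ?thesis using u_L2[OF t] by (simp add: L2_tendsto_def)
qed

lemma u_tendsto:
  "t \<ge> 0 \<Longrightarrow> (r \<longlongrightarrow> t) F \<Longrightarrow> \<forall>\<^sub>F s in F. r s \<ge> 0 \<Longrightarrow> L2_tendsto M (\<lambda>s. u (r s)) (u t) F"
  by (rule L2_tendsto_along[OF u_L2 u_continuous])

lemma kernel_continuous: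
  assumes "weight M \<omega>"
  shows "continuous_on ({0..T} \<times> {0..T}) (\<lambda>(s, r). DD \<omega> (D s) (D r))"
proof -
  have "((\<lambda>p. DD \<omega> (D (fst p)) (D (snd p))) \<longlongrightarrow> DD \<omega> (D (fst p0)) (D (snd p0))) (at p0 within {0..T} \<times> {0..T})"
    if "p0 \<in> {0..T} \<times> {0..T}" for p0
  proof (intro DD_tendsto assms D_tendsto tendsto_intros)
    show "\<forall>\<^sub>F p in at p0 within {0..T} \<times> {0..T}. fst p \<ge> 0" "\<forall>\<^sub>F p in at p0 within {0..T} \<times> {0..T}. snd p \<ge> 0"
      by (auto simp: eventually_at_filter mem_Times_iff intro!: always_eventually)
  qed (use that in auto)
  then show ?thesis unfolding continuous_on_def case_prod_unfold by auto
qed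

lemma cross_continuous:
  assumes "weight M \<omega>" "L2 M f"
  shows "continuous_on {0..T} (\<lambda>s. uD \<omega> f (D s))"
proof -
  have "((\<lambda>s. uD \<omega> f (D s)) \<longlongrightarrow> uD \<omega> f (D s0)) (at s0 within {0..T})" if "s0 \<in> {0..T}" for s0
    by (intro uD_tendsto D_tendsto L2_tendsto_const assms tendsto_ident_at)
      (use that in \<open>auto simp: eventually_at_filter\<close>)
  then show ?thesis unfolding continuous_on_def by auto
qed

lemma DD_commute: "DD \<omega> f g = DD \<omega> g f"
  unfolding DD_def pairing_def by (simp add: a_sym)

text \<open>Twice the energy of $z(t) = \int_0^t u$: the double integral is $\int \omega |\nabla z(t)|^2$ by the symmetry
of the kernel.\<close>

definition E :: "('c \<Rightarrow> real) \<Rightarrow> real \<Rightarrow> real" where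
  "E \<omega> t = uu \<omega> (u t) (u t) + 2 * integral {0..t} (\<lambda>s. integral {0..s} (\<lambda>r. DD \<omega> (D s) (D r)))"

text \<open>With $|S|^2$ for $a(S, S)$, this is the integral of $p (f^2 + |S|^2 - 2 \eta f \, b(S)) \ge 0$, which holds pointwise because $|\eta| \le 1$ and
$b(S)^2 \le |S|^2$. With \<open>S\<close> a Riemann sum for the integral of \<open>D\<close> this is the hypothesis of
\<open>kernel_quadratic_nonneg\<close>.\<close>

lemma energy_nonneg:
  assumes p: "weight M p" "\<And>x. x \<in> space M \<Longrightarrow> p x \<ge> 0"
    and \<eta>: "\<eta> \<in> borel_measurable M" "\<And>x. x \<in> space M \<Longrightarrow> \<bar>\<eta> x\<bar> \<le> 1" and f: "L2 M f" and t: "t > 0"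
  shows "0 \<le> uu p f f + 2 * integral {0..t} (\<lambda>s. integral {0..s} (\<lambda>r. DD p (D s) (D r)))
    - 2 * integral {0..t} (\<lambda>s. uD (\<lambda>x. p x * \<eta> x) f (D s))"
proof (rule kernel_quadratic_nonneg[OF t kernel_continuous[OF p(1)] cross_continuous[OF _ f]])
  have w\<eta>: "weight M \<eta>" by (rule weightI[OF \<eta>])
  show w: "weight M (\<lambda>x. p x * \<eta> x)" by (rule weight_mult[OF p(1) w\<eta>])
  fix N :: nat and h :: real assume h: "h \<ge> 0"
  let ?D = "\<lambda>i x. h *\<^sub>R D (real i * h) x"
  let ?S = "\<lambda>x. \<Sum>i<N. ?D i x"
  have L: "L2 M (?D i)" for i using h by (intro L2_scaleR D_L2) auto
  have S: "L2 M ?S" by (intro L2_sum L)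
  have "DD p ?S ?S = (\<Sum>i<N. \<Sum>j<N. h * (h * DD p (D (real i * h)) (D (real j * h))))"
    using L by (subst DD_sum_sum[OF p(1)]) (auto simp: DD_scale_left[OF p(1)] DD_scale_right[OF p(1)])
  then have 2: "DD p ?S ?S = h\<^sup>2 * (\<Sum>i<N. \<Sum>j<N. DD p (D (real i * h)) (D (real j * h)))"
    by (simp add: sum_distrib_left power2_eq_square mult.assoc)
  have "uD (\<lambda>x. p x * \<eta> x) (\<lambda>x. \<Sum>i\<in>{0::nat}. f x) ?S = (\<Sum>i\<in>{0::nat}. \<Sum>j<N. h * uD (\<lambda>x. p x * \<eta> x) f (D (real j * h)))"
    using L f by (subst uD_sum_sum[OF w]) (auto simp: uD_scale_right[OF w])
  then have 3: "uD (\<lambda>x. p x * \<eta> x) f ?S = h * (\<Sum>i<N. uD (\<lambda>x. p x * \<eta> x) f (D (real i * h)))"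
    by (simp add: sum_distrib_left)
  have "0 \<le> (LINT x|M. p x * (f x * f x) + p x * a x (?S x) (?S x) - 2 * ((p x * \<eta> x) * (f x * b x (?S x))))"
  proof (rule integral_nonneg_AE, rule AE_I2)
    fix x assume x: "x \<in> space M"
    have "2 * (\<eta> x * (f x * b x (?S x))) \<le> 2 * (\<bar>f x\<bar> * \<bar>b x (?S x)\<bar>)"
      using mult_right_mono[OF \<eta>(2)[OF x], of "\<bar>f x * b x (?S x)\<bar>"] abs_le_D1[of "\<eta> x * (f x * b x (?S x))"]
      by (simp add: abs_mult)
    also have "\<dots> \<le> (f x)\<^sup>2 + (b x (?S x))\<^sup>2"
      using sum_squares_bound[of "\<bar>f x\<bar>" "\<bar>b x (?S x)\<bar>"] by (simp add: mult.assoc)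
    also have "\<dots> \<le> f x * f x + a x (?S x) (?S x)"
      using b_le_a[OF x] by (simp add: power2_eq_square)
    finally have "0 \<le> p x * (f x * f x + a x (?S x) (?S x) - 2 * (\<eta> x * (f x * b x (?S x))))"
      using p(2)[OF x] by (intro mult_nonneg_nonneg) auto
    then show "0 \<le> p x * (f x * f x) + p x * a x (?S x) (?S x) - 2 * ((p x * \<eta> x) * (f x * b x (?S x)))"
      by (simp add: algebra_simps)
  qed
  also have "\<dots> = uu p f f + DD p ?S ?S - 2 * uD (\<lambda>x. p x * \<eta> x) f ?S"
    using uu_integrable[OF p(1) f f] DD_integrable[OF p(1) S S] uD_integrable[OF w f S]
    by (simp add: uu_def DD_def uD_def pairing_def)
  finally show "0 \<le> uu p f f + h\<^sup>2 * (\<Sum>i<N. \<Sum>j<N. DD p (D (real i * h)) (D (real j * h))) -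
      2 * h * (\<Sum>i<N. uD (\<lambda>x. p x * \<eta> x) f (D (real i * h)))"
    by (simp add: 2 3 mult.assoc)
qed (rule DD_commute)

lemma pairing_add_weight:
  assumes "weight M \<omega>" "weight M \<omega>'"
  shows "L2 M f \<Longrightarrow> L2 M g \<Longrightarrow> uu (\<lambda>x. \<omega> x + c * \<omega>' x) f g = uu \<omega> f g + c * uu \<omega>' f g"
    and "L2 M d \<Longrightarrow> L2 M d' \<Longrightarrow> DD (\<lambda>x. \<omega> x + c * \<omega>' x) d d' = DD \<omega> d d' + c * DD \<omega>' d d'"
  using uu_integrable[OF assms(1), of f g] uu_integrable[OF assms(2), of f g]
    DD_integrable[OF assms(1), of d d'] DD_integrable[OF assms(2), of d d']
  by (simp_all add: uu_def DD_def pairing_def distrib_right mult.assoc)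

lemma kernel_integrable:
  assumes "weight M \<omega>" "0 \<le> s"
  shows "(\<lambda>r. DD \<omega> (D s) (D r)) integrable_on {0..s}"
  by (rule integrable_continuous_real[OF kernel_uniform(1)[OF kernel_continuous]]) (use assms in auto)

lemma E_add:
  assumes w: "weight M \<omega>" "weight M \<omega>'" and t: "t \<ge> 0"
  shows "E (\<lambda>x. \<omega> x + c * \<omega>' x) t = E \<omega> t + c * E \<omega>' t"
proof -
  let ?I = "\<lambda>\<omega> s. integral {0..s} (\<lambda>r. DD \<omega> (D s) (D r))"
  have 1: "?I (\<lambda>x. \<omega> x + c * \<omega>' x) s = ?I \<omega> s + c * ?I \<omega>' s" if s: "s \<ge> 0" for s
  proof -
    have "?I (\<lambda>x. \<omega> x + c * \<omega>' x) s = integral {0..s} (\<lambda>r. DD \<omega> (D s) (D r) + c * DD \<omega>' (D s) (D r))"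
      by (rule Henstock_Kurzweil_Integration.integral_cong) (use pairing_add_weight(2)[OF w] D_L2 s in auto)
    also have "\<dots> = ?I \<omega> s + c * ?I \<omega>' s"
      using kernel_integrable[OF w(1) s] kernel_integrable[OF w(2) s]
      by (subst Henstock_Kurzweil_Integration.integral_add) (auto intro: integrable_on_mult_right)
    finally show ?thesis .
  qed
  have i: "?I \<omega> integrable_on {0..t}" if "weight M \<omega>" for \<omega>
    by (rule integrable_continuous_real[OF continuous_on_triangle_integral[OF kernel_continuous[OF that]]])
  have "integral {0..t} (?I (\<lambda>x. \<omega> x + c * \<omega>' x)) = integral {0..t} (\<lambda>s. ?I \<omega> s + c * ?I \<omega>' s)"
    by (rule Henstock_Kurzweil_Integration.integral_cong) (use 1 in auto)
  also have "\<dots> = integral {0..t} (?I \<omega>) + c * integral {0..t} (?I \<omega>')"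
    using i[OF w(1)] i[OF w(2)]
    by (subst Henstock_Kurzweil_Integration.integral_add) (auto intro: integrable_on_mult_right)
  finally show ?thesis
    using pairing_add_weight(1)[OF w u_L2[OF t] u_L2[OF t]] by (simp add: E_def algebra_simps)
qed

lemma E_nonneg: "weight M p \<Longrightarrow> (\<And>x. x \<in> space M \<Longrightarrow> p x \<ge> 0) \<Longrightarrow> t > 0 \<Longrightarrow> 0 \<le> E p t"
  using energy_nonneg[of p "\<lambda>_. 0" "u t" t] u_L2[of t] by (simp add: E_def uD_def pairing_def)

lemma abs_E_le:
  assumes w: "weight M \<omega>" and c: "\<And>x. x \<in> space M \<Longrightarrow> \<bar>\<omega> x\<bar> \<le> c" and t: "t > 0"
  shows "\<bar>E \<omega> t\<bar> \<le> c * E (\<lambda>_. 1) t"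
proof -
  have c1: "\<bar>\<omega> x + (- c) * 1\<bar> = c - \<omega> x" if "x \<in> space M" for x using c[OF that] by auto
  have "0 \<le> E (\<lambda>x. c + (-1) * \<omega> x) t" "0 \<le> E (\<lambda>x. \<omega> x + c * 1) t"
    by (intro E_nonneg weight_add_mult weight_const w t; use c in \<open>force simp: abs_le_iff\<close>)+
  moreover have "E (\<lambda>x. c + (-1) * \<omega> x) t = E (\<lambda>x. 0 + c * 1) t - E \<omega> t"
    using E_add[OF weight_const[of M c] w, of t "-1"] t by simp
  moreover have "E (\<lambda>x. 0 + c * 1) t = E (\<lambda>_. 0) t + c * E (\<lambda>_. 1) t"
    using E_add[OF weight_const[of M 0] weight_const[of M 1], of t c] t by simp
  moreover have "E (\<lambda>_. 0) t = 0" by (simp add: E_def uu_def DD_def pairing_def)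
  moreover have "E (\<lambda>x. \<omega> x + c * 1) t = E \<omega> t + c * E (\<lambda>_. 1) t"
    using E_add[OF w weight_const[of M 1], of t c] t by simp
  ultimately show ?thesis by (simp add: abs_le_iff)
qed

lemma E_deriv:
  assumes w: "weight M \<omega>" and t: "t > 0"
  shows "(E \<omega> has_real_derivative 2 * uu \<omega> (u t) (v t) + 2 * integral {0..t} (\<lambda>s. DD \<omega> (D s) (D t))) (at t)"
proof -
  let ?d = "\<lambda>s x. (u s x - u t x) / (s - t)"
  have at: "at t within {0..} = at t" by (rule at_within_interior) (use t in auto)
  have ev: "\<forall>\<^sub>F s in at t. s > 0" using t eventually_at_in_open'[of "{0<..}" t] by (auto elim: eventually_mono)
  have "((\<lambda>s. uu \<omega> (?d s) (u s) + uu \<omega> (u t) (?d s)) \<longlongrightarrow> uu \<omega> (v t) (u t) + uu \<omega> (u t) (v t)) (at t)"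
    using u_derivative[of t] u_continuous[of t] t u_L2[of t] unfolding at
    by (intro tendsto_add uu_tendsto w L2_tendsto_const) auto
  moreover have "uu \<omega> (v t) (u t) = uu \<omega> (u t) (v t)" by (simp add: uu_def pairing_def mult.commute[of "v t _"])
  ultimately have 1: "((\<lambda>s. uu \<omega> (?d s) (u s) + uu \<omega> (u t) (?d s)) \<longlongrightarrow> 2 * uu \<omega> (u t) (v t)) (at t)" by simp
  have "((\<lambda>s. (uu \<omega> (u s) (u s) - uu \<omega> (u t) (u t)) / (s - t)) \<longlongrightarrow> 2 * uu \<omega> (u t) (v t)) (at t)"
  proof (rule Lim_transform_eventually[OF 1])
    show "\<forall>\<^sub>F s in at t. uu \<omega> (?d s) (u s) + uu \<omega> (u t) (?d s) = (uu \<omega> (u s) (u s) - uu \<omega> (u t) (u t)) / (s - t)"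
      using ev
    proof eventually_elim
      case (elim s)
      have L: "L2 M (u s)" "L2 M (u t)" using elim t u_L2 by auto
      have d: "?d s = (\<lambda>x. inverse (s - t) *\<^sub>R (u s x - u t x))" by (auto simp: divide_inverse)
      show ?case
        unfolding d uu_scale_left[OF w] uu_scale_right[OF w]
        using L by (simp add: uu_diff_left[OF w] uu_diff_right[OF w] L2_diff divide_inverse algebra_simps)
    qed
  qed
  then have 2: "((\<lambda>s. uu \<omega> (u s) (u s)) has_real_derivative 2 * uu \<omega> (u t) (v t)) (at t)"
    by (simp add: has_field_derivative_iff)
  let ?I = "\<lambda>s. integral {0..s} (\<lambda>r. DD \<omega> (D s) (D r))"
  have "((\<lambda>t. integral {0..t} ?I) has_vector_derivative ?I t) (at t within {0..t+1})"
    by (rule integral_has_vector_derivative[OF continuous_on_triangle_integral[OF kernel_continuous[OF w]]]) (use t in auto)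
  moreover have "at t within {0..t+1} = at t" by (rule at_within_interior) (use t in auto)
  ultimately have "((\<lambda>t. integral {0..t} ?I) has_real_derivative ?I t) (at t)"
    by (simp add: has_real_derivative_iff_has_vector_derivative)
  from DERIV_add[OF 2 DERIV_cmult[OF this, of 2]] show ?thesis
    unfolding E_def[abs_def] by (simp add: DD_commute[of \<omega> "D t"])
qed

lemma potential_nonneg:
  assumes p: "weight M p" "\<And>x. x \<in> space M \<Longrightarrow> p x \<ge> 0" and t: "t > 0"
  shows "0 \<le> integral {0..t} (\<lambda>s. integral {0..s} (\<lambda>r. DD p (D s) (D r)))"
  using energy_nonneg[OF p, of "\<lambda>_. 0" "\<lambda>_. 0" t] t by (simp add: uu_def uD_def pairing_def L2_def)

abbreviation w :: "real \<Rightarrow> 'c \<Rightarrow> real" where "w t x \<equiv> flat (q x - t)"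
abbreviation w' :: "real \<Rightarrow> 'c \<Rightarrow> real" where "w' t x \<equiv> flat' (q x - t)"

lemma weight_w: "weight M (w t)" and weight_w': "weight M (w' t)"
proof -
  have m: "(\<lambda>x. f (q x - t)) \<in> borel_measurable M" if "\<And>k. Ck_on k UNIV f" for f :: "real \<Rightarrow> real"
    using borel_measurable_continuous_onI[OF Ck_on_continuous[OF that]] q_measurable
    by (intro measurable_compose[of "\<lambda>x. q x - t" M borel f]) auto
  show "weight M (w t)"
    unfolding weight_def using m[OF Ck_on_flat] by (auto simp: flat_nonneg flat_le_1 intro!: exI[of _ 1])
  obtain B where B: "B > 0" "\<And>y. y \<in> {-(Q+\<bar>t\<bar>)..Q+\<bar>t\<bar>} \<Longrightarrow> norm (flat' y) \<le> B"
    using bounded_on_compact[OF compact_Icc, of "-(Q+\<bar>t\<bar>)" "Q+\<bar>t\<bar>" flat'] Ck_on_continuous[OF Ck_on_flat']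
      continuous_on_subset by (metis subset_UNIV)
  have "\<bar>w' t x\<bar> \<le> B" if "x \<in> space M" for x
  proof -
    have "q x - t \<in> {-(Q+\<bar>t\<bar>)..Q+\<bar>t\<bar>}" using q_bound[OF that] by (simp add: abs_le_iff) linarith
    then show ?thesis using B(2) by simp
  qed
  then show "weight M (w' t)"
    unfolding weight_def using m[OF Ck_on_flat'] B(1) by (intro conjI exI[of _ B]) auto
qed

text \<open>For the weight frozen at time \<open>t\<close> the left-hand side is the derivative of the energy. The weak
equation cancels all of it but the flux through the region where the weight varies, and there the
energy density dominates the flux. The bound on the right is the rate at which the energy drops
when the weight moves.\<close>

lemma energy_flux:
  assumes t: "t > 0"
  shows "2 * uu (w t) (u t) (v t) + 2 * integral {0..t} (\<lambda>s. DD (w t) (D s) (D t)) \<le> E (w' t) t"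
proof -
  let ?c = "\<lambda>\<eta> s. uD (\<lambda>x. w' t x * \<eta> x) (u t) (D s)"
  have w\<kappa>: "weight M (\<lambda>x. w' t x * \<kappa> x)"
    by (rule weight_mult[OF weight_w']) (rule weightI[OF \<kappa>_measurable \<kappa>_bound])
  have i1: "(\<lambda>s. DD (w t) (D s) (D t)) integrable_on {0..t}"
    using kernel_integrable[OF weight_w, of t t] t by (simp add: DD_commute[of _ "D t"])
  have i2: "?c \<kappa> integrable_on {0..t}"
    by (rule integrable_continuous_real[OF cross_continuous[OF w\<kappa> u_L2]]) (use t in auto)
  have "uu (w t) (u t) (v t) = - integral {0..t} (\<lambda>s. DD (w t) (D s) (D t) + ?c \<kappa> s)"
    using weak[OF t] by (simp add: uu_def DD_def uD_def pairing_def)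
  also have "\<dots> = - integral {0..t} (\<lambda>s. DD (w t) (D s) (D t)) - integral {0..t} (?c \<kappa>)"
    by (subst Henstock_Kurzweil_Integration.integral_add[OF i1 i2]) simp
  finally have "2 * uu (w t) (u t) (v t) + 2 * integral {0..t} (\<lambda>s. DD (w t) (D s) (D t)) = - 2 * integral {0..t} (?c \<kappa>)"
    by simp
  moreover have "0 \<le> E (w' t) t - 2 * integral {0..t} (?c (\<lambda>x. - \<kappa> x))"
    unfolding E_def by (rule energy_nonneg[OF weight_w' _ _ _ u_L2 t])
      (use \<kappa>_measurable \<kappa>_bound flat'_nonneg t in auto)
  moreover have "?c (\<lambda>x. - \<kappa> x) = (\<lambda>s. - ?c \<kappa> s)"
    by (auto simp: uD_def pairing_def)
  ultimately show ?thesis by simp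
qed

text \<open>The weight and the energy change at the same time. With the weight frozen the energy is
differentiable by \<open>E_deriv\<close>; the change of the weight contributes its own rate, because the energy is
linear in the weight and the Taylor remainder is of second order.\<close>

lemma moving_energy_deriv:
  assumes t: "t > 0"
  shows "((\<lambda>t. E (w t) t) has_real_derivative
    2 * uu (w t) (u t) (v t) + 2 * integral {0..t} (\<lambda>s. DD (w t) (D s) (D t)) - E (w' t) t) (at t)"
proof -
  let ?d = "2 * uu (w t) (u t) (v t) + 2 * integral {0..t} (\<lambda>s. DD (w t) (D s) (D t))"
  obtain K where K: "K \<ge> 0" "\<And>y d. \<bar>y\<bar> \<le> Q + \<bar>t\<bar> \<Longrightarrow> \<bar>d\<bar> \<le> 1 \<Longrightarrow> \<bar>flat (y - d) - flat y + d * flat' y\<bar> \<le> K * d\<^sup>2"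
    using flat_taylor_bound[of "Q + \<bar>t\<bar>"] by metis
  define rem where "rem s x = w s x - w t x + (s - t) * w' t x" for s x
  have wrem: "weight M (rem s)" for s
    using weight_add_mult[OF weight_add_mult[OF weight_w[of s] weight_w[of t], of "-1"] weight_w'[of t], of "s - t"]
    by (simp add: rem_def[abs_def])
  have split: "E (w s) s = E (w t) s - (s - t) * E (w' t) s + E (rem s) s" if s: "s > 0" for s
  proof -
    have "w s = (\<lambda>x. (w t x + (- (s - t)) * w' t x) + 1 * rem s x)" by (auto simp: rem_def algebra_simps)
    then have "E (w s) s = E (\<lambda>x. (w t x + (- (s - t)) * w' t x) + 1 * rem s x) s" by (rule arg_cong)
    also have "\<dots> = E (w t) s + (- (s - t)) * E (w' t) s + 1 * E (rem s) s"
      using s by (simp only: E_add weight_add_mult weight_w weight_w' wrem less_imp_le)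
    finally show ?thesis by (simp add: algebra_simps)
  qed
  have rem: "\<bar>E (rem s) s\<bar> \<le> K * (s - t)\<^sup>2 * E (\<lambda>_. 1) s" if s: "s > 0" "\<bar>s - t\<bar> \<le> 1" for s
  proof (rule abs_E_le[OF wrem _ s(1)])
    fix x assume "x \<in> space M"
    then have "\<bar>q x - t\<bar> \<le> Q + \<bar>t\<bar>" using q_bound[of x] by linarith
    from K(2)[OF this s(2)] show "\<bar>rem s x\<bar> \<le> K * (s - t)\<^sup>2" by (simp add: rem_def algebra_simps)
  qed
  have cont: "(E \<omega> \<longlongrightarrow> E \<omega> t) (at t)" if "weight M \<omega>" for \<omega>
    using DERIV_isCont[OF E_deriv[OF that t]] by (simp add: isCont_def)
  have ev: "\<forall>\<^sub>F s in at t. s > 0 \<and> \<bar>s - t\<bar> \<le> 1 \<and> s \<noteq> t"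
  proof -
    have "\<forall>\<^sub>F s in at t. s \<in> {max 0 (t-1)<..<t+1} - {t}"
      by (rule eventually_at_in_open) (use t in auto)
    then show ?thesis by eventually_elim auto
  qed
  have "((\<lambda>s. K * \<bar>s - t\<bar> * E (\<lambda>_. 1) s) \<longlongrightarrow> K * \<bar>t - t\<bar> * E (\<lambda>_. 1) t) (at t)"
    by (intro tendsto_intros cont weight_const)
  then have lim0: "((\<lambda>s. K * \<bar>s - t\<bar> * E (\<lambda>_. 1) s) \<longlongrightarrow> 0) (at t)" by simp
  have "((\<lambda>s. E (rem s) s / (s - t)) \<longlongrightarrow> 0) (at t)"
  proof (rule Lim_null_comparison[OF _ lim0])
    show "\<forall>\<^sub>F s in at t. norm (E (rem s) s / (s - t)) \<le> K * \<bar>s - t\<bar> * E (\<lambda>_. 1) s"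
      using ev
    proof eventually_elim
      case (elim s)
      then have "\<bar>s - t\<bar> > 0" by simp
      moreover have "K * (s - t)\<^sup>2 * E (\<lambda>_. 1) s = K * \<bar>s - t\<bar> * E (\<lambda>_. 1) s * \<bar>s - t\<bar>"
        using power2_abs[of "s - t"] by (simp add: power2_eq_square mult.assoc mult.left_commute)
      ultimately show ?case
        using rem[of s] elim by (simp only: real_norm_def abs_divide pos_divide_le_eq)
    qed
  qed
  moreover have "((\<lambda>s. (E (w t) s - E (w t) t) / (s - t)) \<longlongrightarrow> ?d) (at t)"
    using E_deriv[OF weight_w t] by (simp add: has_field_derivative_iff)
  ultimately have "((\<lambda>s. (E (w t) s - E (w t) t) / (s - t) - E (w' t) s + E (rem s) s / (s - t)) \<longlongrightarrow> ?d - E (w' t) t + 0) (at t)"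
    by (intro tendsto_add tendsto_diff cont weight_w')
  then have "((\<lambda>s. (E (w s) s - E (w t) t) / (s - t)) \<longlongrightarrow> ?d - E (w' t) t + 0) (at t)"
  proof (rule Lim_transform_eventually)
    show "\<forall>\<^sub>F s in at t. (E (w t) s - E (w t) t) / (s - t) - E (w' t) s + E (rem s) s / (s - t) = (E (w s) s - E (w t) t) / (s - t)"
      using ev by eventually_elim (simp add: split diff_divide_distrib add_divide_distrib)
  qed
  then show ?thesis by (simp add: has_field_derivative_iff)
qed

lemma E_tendsto_0: "(E (\<lambda>_. 1) \<longlongrightarrow> 0) (at_right 0)"
proof -
  have "((\<lambda>t. uu (\<lambda>_. 1) (u t) (u t)) \<longlongrightarrow> uu (\<lambda>_. 1) (u 0) (u 0)) (at_right 0)"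
    by (intro uu_tendsto weight_const u_tendsto tendsto_ident_at) (auto simp: eventually_at_filter)
  moreover have "uu (\<lambda>_. 1) (u 0) (u 0) = 0"
    unfolding uu_def pairing_def using u_0
    by (intro integral_eq_zero_AE) (auto elim: eventually_mono)
  moreover have "((\<lambda>t. integral {0..t} (\<lambda>s. integral {0..s} (\<lambda>r. DD (\<lambda>_. 1) (D s) (D r)))) \<longlongrightarrow> 0) (at_right 0)"
  proof -
    have "continuous_on {0..1} (\<lambda>t. integral {0..t} (\<lambda>s. integral {0..s} (\<lambda>r. DD (\<lambda>_. 1) (D s) (D r))))"
      by (intro indefinite_integral_continuous_1 integrable_continuous_real
          continuous_on_triangle_integral kernel_continuous weight_const)
    then show ?thesis by (auto simp: continuous_on_def at_within_Icc_at_right dest!: bspec[of _ _ 0])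
  qed
  ultimately show ?thesis
    unfolding E_def[abs_def] using tendsto_add[OF _ tendsto_mult[OF tendsto_const[of 2]]] by fastforce
qed

text \<open>The energy with the moving weight is nonincreasing for positive times, and it tends to zero at time
zero since it is dominated by the energy with weight one.\<close>

theorem energy_vanishes:
  assumes t: "t > 0"
  shows "(LINT x|M. flat (q x - t) * (u t x)\<^sup>2) = 0"
proof -
  have mono: "E (w t) t \<le> E (\<lambda>_. 1) s" if s: "0 < s" "s < t" for s
  proof -
    have "E (w t) t \<le> E (w s) s"
    proof (rule DERIV_nonpos_imp_decreasing_open[where f = "\<lambda>t. E (w t) t" and a = s and b = t])
      fix r assume "s < r" "r < t"
      then show "\<exists>y. ((\<lambda>t. E (w t) t) has_real_derivative y) (at r) \<and> y \<le> 0"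
        using moving_energy_deriv[of r] energy_flux[of r] s by (intro exI conjI) auto
    next
      show "continuous_on {s..t} (\<lambda>t. E (w t) t)"
        by (rule continuous_at_imp_continuous_on) (use s in \<open>auto intro!: DERIV_isCont[OF moving_energy_deriv]\<close>)
    qed (use s in auto)
    also have "E (w s) s \<le> 1 * E (\<lambda>_. 1) s"
      by (rule order_trans[OF abs_ge_self abs_E_le[OF weight_w _ s(1)]]) (auto simp: flat_nonneg flat_le_1)
    finally show ?thesis by simp
  qed
  have "E (w t) t \<le> 0"
  proof (rule tendsto_lowerbound[OF E_tendsto_0])
    show "\<forall>\<^sub>F s in at_right 0. E (w t) t \<le> E (\<lambda>_. 1) s"
      using eventually_at_right_less[of 0] eventually_at_right_real[OF t]
      by eventually_elim (use mono in auto)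
  qed simp
  moreover have "0 \<le> uu (w t) (u t) (u t)"
    unfolding uu_def pairing_def by (rule Bochner_Integration.integral_nonneg) (simp add: flat_nonneg)
  moreover have "0 \<le> integral {0..t} (\<lambda>s. integral {0..s} (\<lambda>r. DD (w t) (D s) (D r)))"
    by (rule potential_nonneg[OF weight_w _ t]) (simp add: flat_nonneg)
  ultimately have "uu (w t) (u t) (u t) = 0" by (simp add: E_def)
  then show ?thesis by (simp add: uu_def pairing_def power2_eq_square)
qed

end

section \<open>The metric in coordinates\<close>

locale riemannian =
  fixes G :: "real^'n::finite \<Rightarrow> real^'n^'n"
  assumes metric: "riemannian_metric G"
begin

abbreviation H :: "real^'n \<Rightarrow> real^'n^'n" where "H x \<equiv> matrix_inv (G x)"
abbreviation \<gamma> :: "real^'n \<Rightarrow> real" where "\<gamma> x \<equiv> sqrt (det (G x))"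
definition cometric :: "real^'n \<Rightarrow> real^'n \<Rightarrow> real^'n \<Rightarrow> real" where
  "cometric x p p' = p \<bullet> (H x *v p')"

lemma G_pos: "v \<noteq> 0 \<Longrightarrow> v \<bullet> (G x *v v) > 0" and G_transpose: "transpose (G x) = G x"
  and Ck_on_G: "Ck_on k UNIV G"
  using metric by (auto simp: riemannian_metric_def smooth_on_def)

lemma G_nonneg: "v \<bullet> (G x *v v) \<ge> 0"
  using G_pos[of v x] by (cases "v = 0") auto

lemma det_pos: "det (G x) > 0"
  by (rule det_pos_if_positive_definite[OF G_pos])

lemma \<gamma>_pos: "\<gamma> x > 0" using det_pos by simp

lemma H_inverse: "G x *v (H x *v p) = p" "H x *v (G x *v p) = p"
  using matrix_inv_mult[of "G x"] det_pos[of x] by (auto simp: matrix_vector_mul_assoc)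

lemma G_sym: "p \<bullet> (G x *v p') = (G x *v p) \<bullet> p'"
  by (metis G_transpose dot_lmul_matrix transpose_matrix_vector)

lemma cometric_sym: "cometric x p p' = cometric x p' p"
  unfolding cometric_def by (metis G_sym H_inverse(1) inner_commute)

lemma cometric_bilinear: "bilinear (cometric x)"
  unfolding bilinear_def cometric_def
  by (auto intro!: linearI simp: inner_add_left inner_add_right matrix_vector_right_distrib
      matrix_vector_mult_scaleR)

lemma riem_norm_grad_sq: "(riem_norm G x (riem_grad G D x))\<^sup>2 = cometric x (D x) (D x)"
proof -
  have "riem_grad G D x \<bullet> (G x *v riem_grad G D x) = cometric x (D x) (D x)"
    unfolding riem_grad_def cometric_def by (simp add: H_inverse inner_commute)
  then show ?thesis unfolding riem_norm_def using G_nonneg[of "riem_grad G D x" x] by simp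
qed

lemma cometric_nonneg: "cometric x p p \<ge> 0"
  using G_nonneg[of "H x *v p" x] by (simp add: cometric_def H_inverse inner_commute)

text \<open>A unit vector fixed by \<open>G x\<close> is also its own dual covector, of norm one; the second claim is the
Cauchy-Schwarz inequality.\<close>

lemma cometric_unit:
  assumes "G x *v \<xi> = \<xi>" "norm \<xi> = 1"
  shows "cometric x p \<xi> = \<xi> \<bullet> p" and "(\<xi> \<bullet> p)\<^sup>2 \<le> cometric x p p"
proof -
  have H: "H x *v \<xi> = \<xi>" using H_inverse(2)[of x \<xi>] assms by simp
  then show 1: "cometric x p \<xi> = \<xi> \<bullet> p" by (simp add: cometric_def inner_commute)
  let ?l = "\<xi> \<bullet> p"
  have "0 \<le> cometric x (p - ?l *\<^sub>R \<xi>) (p - ?l *\<^sub>R \<xi>)" by (rule cometric_nonneg)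
  also have "\<dots> = cometric x p p - 2 * ?l * cometric x p \<xi> + ?l\<^sup>2 * cometric x \<xi> \<xi>"
    using cometric_sym[of x \<xi> p]
    by (simp add: bilinear_lsub[OF cometric_bilinear] bilinear_rsub[OF cometric_bilinear]
        bilinear_lmul[OF cometric_bilinear] bilinear_rmul[OF cometric_bilinear] power2_eq_square algebra_simps)
  also have "\<dots> = cometric x p p - ?l\<^sup>2"
    using assms(2) H by (simp add: 1 cometric_def power2_eq_square norm_eq_1 inner_commute[of p])
  finally show "?l\<^sup>2 \<le> cometric x p p" by simp
qed

lemma Ck_on_H: "Ck_on k UNIV (\<lambda>x. H x $ i $ j)"
  by (rule Ck_on_matrix_inv[OF open_UNIV Ck_on_G]) (metis det_pos less_irrefl)

lemma Ck_on_\<gamma>: "Ck_on k UNIV \<gamma>"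
  by (rule Ck_on_compose[OF Ck_on_sqrt Ck_on_det]) (use det_pos in \<open>auto intro: Ck_on_entry Ck_on_G\<close>)

lemma continuous_on_H: "continuous_on K (\<lambda>x. H x $ i $ j)" and continuous_on_\<gamma>: "continuous_on K \<gamma>"
  and continuous_on_G: "continuous_on K (\<lambda>x. G x $ i $ j)"
  using Ck_on_continuous[OF Ck_on_H] Ck_on_continuous[OF Ck_on_\<gamma>]
    Ck_on_continuous[OF Ck_on_entry[OF Ck_on_G open_UNIV]] continuous_on_subset by blast+

text \<open>The lower bound avoids eigenvalues: positivity of \<open>G\<close> on $y - p/C$, where $p = G y$ and \<open>C\<close> bounds the
norm of \<open>G\<close>, gives $|p|^2 \le C \, y \cdot p$.\<close>

lemma cometric_bound_on_compact:
  assumes "compact K"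
  obtains C where "C > 0" "\<And>x p p'. x \<in> K \<Longrightarrow> \<bar>cometric x p p'\<bar> \<le> C * norm p * norm p'"
    "\<And>x p. x \<in> K \<Longrightarrow> (norm p)\<^sup>2 \<le> C * cometric x p p"
proof -
  obtain C1 where C1: "C1 > 0" "\<And>x v. x \<in> K \<Longrightarrow> norm (H x *v v) \<le> C1 * norm v"
    using matrix_vector_bound_on_compact[OF assms continuous_on_H] by metis
  obtain C2 where C2: "C2 > 0" "\<And>x v. x \<in> K \<Longrightarrow> norm (G x *v v) \<le> C2 * norm v"
    using matrix_vector_bound_on_compact[OF assms continuous_on_G] by metis
  show thesis
  proof (rule that[of "max C1 C2"])
    fix x p p' assume x: "x \<in> K"
    have "\<bar>cometric x p p'\<bar> \<le> norm p * norm (H x *v p')"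
      unfolding cometric_def by (rule Cauchy_Schwarz_ineq2)
    also have "\<dots> \<le> norm p * (max C1 C2 * norm p')"
      by (intro mult_left_mono order_trans[OF C1(2)[OF x]] mult_right_mono) auto
    finally show "\<bar>cometric x p p'\<bar> \<le> max C1 C2 * norm p * norm p'" by (simp add: mult_ac)
  next
    fix x p assume x: "x \<in> K"
    define y where "y = H x *v p"
    have Gy: "G x *v y = p" by (simp add: y_def H_inverse)
    have cp: "cometric x p p = y \<bullet> p" by (simp add: cometric_def y_def inner_commute)
    \<comment> \<open>the choice of the factor that makes the quadratic polynomial in it smallest\<close>
    let ?l = "1 / C2"
    have "0 \<le> (y - ?l *\<^sub>R p) \<bullet> (G x *v (y - ?l *\<^sub>R p))" by (rule G_nonneg)
    also have "\<dots> = y \<bullet> p - 2 * ?l * (p \<bullet> p) + ?l\<^sup>2 * (p \<bullet> (G x *v p))"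
      using G_sym[of y x p]
      by (simp add: matrix_vector_mult_diff_distrib matrix_vector_mult_scaleR Gy inner_diff_left inner_diff_right power2_eq_square algebra_simps)
    also have "\<dots> \<le> y \<bullet> p - 2 * ?l * (p \<bullet> p) + ?l\<^sup>2 * (C2 * (p \<bullet> p))"
    proof -
      have "p \<bullet> (G x *v p) \<le> norm p * (C2 * norm p)"
        by (rule order_trans[OF norm_cauchy_schwarz mult_left_mono[OF C2(2)[OF x]]]) auto
      then show ?thesis by (intro add_left_mono mult_left_mono) (auto simp: dot_square_norm power2_eq_square mult_ac)
    qed
    also have "\<dots> = y \<bullet> p - ?l * (p \<bullet> p)" using C2(1) by (simp add: power2_eq_square field_simps)
    finally have "p \<bullet> p \<le> C2 * (y \<bullet> p)" using C2(1) by (simp add: field_simps)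
    also have "\<dots> \<le> max C1 C2 * (y \<bullet> p)"
      using cometric_nonneg[of x p] by (intro mult_right_mono) (auto simp: cp)
    finally show "(norm p)\<^sup>2 \<le> max C1 C2 * cometric x p p" by (simp add: dot_square_norm cp)
  qed (use C1 in auto)
qed

lemma cometric_sum: "cometric x p p' = (\<Sum>i\<in>UNIV. \<Sum>j\<in>UNIV. p $ i * (H x $ i $ j * p' $ j))"
  by (simp add: cometric_def inner_vec_def matrix_vector_mult_def sum_distrib_left)

lemma cometric_measurable:
  assumes "f \<in> borel_measurable N" "g \<in> borel_measurable N" "(\<lambda>x. x) \<in> N \<rightarrow>\<^sub>M borel"
  shows "(\<lambda>x. cometric x (f x) (g x)) \<in> borel_measurable N"
proof -
  have "(\<lambda>x. H x $ i $ j) \<in> borel_measurable N" for i j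
    by (rule measurable_compose[OF assms(3) borel_measurable_continuous_onI[OF continuous_on_H]])
  moreover have "(\<lambda>x. h x $ i) \<in> borel_measurable N" if "h \<in> borel_measurable N" for h :: "real^'n \<Rightarrow> real^'n" and i
    using that by (rule measurable_compose) (auto intro!: borel_measurable_continuous_onI continuous_intros)
  ultimately show ?thesis
    unfolding cometric_sum using assms by (intro borel_measurable_sum borel_measurable_times) auto
qed

section \<open>The Laplacian in divergence form\<close>

text \<open>The components of $\sqrt{\det G}\, G^{-1} \nabla \psi$, whose divergence is $\sqrt{\det G}\, \Delta_g \psi$.\<close>

definition flux :: "(real^'n \<Rightarrow> real) \<Rightarrow> 'n \<Rightarrow> real^'n \<Rightarrow> real" where
  "flux \<psi> i x = \<gamma> x * (H x *v grad \<psi> x) $ i"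

lemma Ck_on_flux: assumes "\<And>k. Ck_on k UNIV \<psi>" shows "Ck_on k UNIV (flux \<psi> i)"
  unfolding flux_def matrix_vector_mult_def grad_def
  by (simp, intro Ck_on_mult Ck_on_sum Ck_on_\<gamma> Ck_on_H Ck_on_partial assms open_UNIV)

lemma grad_eq_0_outside:
  assumes "closed K" "\<And>x. x \<notin> K \<Longrightarrow> \<psi> x = 0" "x \<notin> K" shows "grad \<psi> x = 0"
  by (simp add: grad_def vec_eq_iff partial_eq_0_outside[OF assms])

lemma flux_eq_0_outside:
  assumes "closed K" "\<And>x. x \<notin> K \<Longrightarrow> \<psi> x = 0" "x \<notin> K" shows "flux \<psi> i x = 0"
  unfolding flux_def by (simp add: grad_eq_0_outside[OF assms])

lemma laplace_beltrami_flux: "\<gamma> x * laplace_beltrami G \<psi> x = (\<Sum>i\<in>UNIV. partial i (flux \<psi> i) x)"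
  using det_pos[of x] unfolding laplace_beltrami_def riem_div_def riem_grad_def flux_def[abs_def] by simp

lemma laplace_beltrami_cmult:
  assumes "\<And>k. Ck_on k UNIV \<psi>"
  shows "laplace_beltrami G (\<lambda>y. c * \<psi> y) x = c * laplace_beltrami G \<psi> x"
proof -
  have p: "partial i (\<lambda>y. c * f y) x = c * partial i f x" if "\<And>k. Ck_on k UNIV f" for f :: "real^'n \<Rightarrow> real" and i x
    using partial_mult[of "\<lambda>_. c" x f i] Ck_on_differentiable[OF that] by (simp add: partial_def)
  have "grad (\<lambda>y. c * \<psi> y) x = c *\<^sub>R grad \<psi> x" for x
    by (simp add: grad_def vec_eq_iff p[OF assms])
  then have "flux (\<lambda>y. c * \<psi> y) i = (\<lambda>x. c * flux \<psi> i x)" for i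
    by (auto simp: flux_def matrix_vector_mult_scaleR)
  then have "\<gamma> x * laplace_beltrami G (\<lambda>y. c * \<psi> y) x = \<gamma> x * (c * laplace_beltrami G \<psi> x)"
    by (simp add: laplace_beltrami_flux p[OF Ck_on_flux[OF assms]] mult.left_commute[of _ c] sum_distrib_left)
  then show ?thesis using \<gamma>_pos[of x] by simp
qed

lemma sum_flux: "(\<Sum>i\<in>UNIV. d $ i * flux \<psi> i x) = \<gamma> x * cometric x d (grad \<psi> x)"
  by (simp add: flux_def cometric_def inner_vec_def sum_distrib_left mult.left_commute)

end

section \<open>The Riemannian volume on a compact set\<close>

locale riemannian_compact = riemannian G for G :: "real^'n::finite \<Rightarrow> real^'n^'n" +
  fixes K :: "(real^'n) set"
  assumes K_compact: "compact K"
begin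

definition M :: "(real^'n) measure" where "M = restrict_space (riem_vol G) K"

lemma K_lebesgue: "K \<in> sets lebesgue"
  using K_compact by (simp add: borel_compact)

lemma riem_vol_simps: "space (riem_vol G) = UNIV" "sets (riem_vol G) = sets lebesgue"
  by (simp_all add: riem_vol_def)

lemma space_M: "space M = K"
  by (simp add: M_def space_restrict_space riem_vol_simps)

lemma borel_measurable_M_iff:
  fixes f :: "real^'n \<Rightarrow> 'a::real_normed_vector"
  shows "f \<in> borel_measurable M \<longleftrightarrow> (\<lambda>x. indicator K x *\<^sub>R f x) \<in> borel_measurable lebesgue"
proof -
  have "f \<in> borel_measurable M \<longleftrightarrow> (\<lambda>x. indicator K x *\<^sub>R f x) \<in> borel_measurable (riem_vol G)"
    unfolding M_def using K_lebesgue
    by (subst borel_measurable_restrict_space_iff) (auto simp: riem_vol_simps)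
  then show ?thesis using measurable_cong_sets[OF riem_vol_simps(2) refl] by auto
qed

lemma borel_measurable_M_nn_iff:
  fixes f :: "real^'n \<Rightarrow> ennreal"
  shows "f \<in> borel_measurable M \<longleftrightarrow> (\<lambda>x. f x * indicator K x) \<in> borel_measurable lebesgue"
proof -
  have "f \<in> borel_measurable M \<longleftrightarrow> (\<lambda>x. f x * indicator K x) \<in> borel_measurable (riem_vol G)"
    unfolding M_def using K_lebesgue
    by (subst borel_measurable_restrict_space_iff_ennreal) (auto simp: riem_vol_simps)
  then show ?thesis using measurable_cong_sets[OF riem_vol_simps(2) refl] by auto
qed

lemma continuous_borel_measurable_M:
  fixes f :: "real^'n \<Rightarrow> 'a::{real_normed_vector}"
  shows "continuous_on K f \<Longrightarrow> f \<in> borel_measurable M"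
  unfolding borel_measurable_M_iff
  using borel_measurable_continuous_on_indicator[of K f] K_compact
  by (auto intro!: measurable_completion simp: borel_compact)

lemma \<gamma>_measurable: "\<gamma> \<in> borel_measurable lebesgue"
  using borel_measurable_continuous_onI[OF continuous_on_\<gamma>] by (auto intro: measurable_completion)

lemma nn_integral_M: "(\<integral>\<^sup>+x. F x \<partial>M) = (\<integral>\<^sup>+x\<in>K. F x \<partial>riem_vol G)"
  unfolding M_def using K_lebesgue by (intro nn_integral_restrict_space) (auto simp: riem_vol_simps)

lemma nn_integral_M_lebesgue:
  assumes "F \<in> borel_measurable M"
  shows "(\<integral>\<^sup>+x. F x \<partial>M) = (\<integral>\<^sup>+x\<in>K. ennreal (\<gamma> x) * F x \<partial>lebesgue)"
  unfolding nn_integral_M riem_vol_def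
  using assms \<gamma>_measurable
  by (subst nn_integral_density) (auto simp: borel_measurable_M_nn_iff mult.assoc)

lemma integral_M:
  fixes f :: "real^'n \<Rightarrow> real"
  assumes "f \<in> borel_measurable M"
  shows "(LINT x|M. f x) = (LINT x:K|lebesgue. \<gamma> x * f x)"
proof -
  have "(LINT x|M. f x) = (LINT x|riem_vol G. indicator K x *\<^sub>R f x)"
    unfolding M_def using K_lebesgue by (intro integral_restrict_space) (auto simp: riem_vol_simps)
  also have "\<dots> = (LINT x|lebesgue. \<gamma> x *\<^sub>R (indicator K x *\<^sub>R f x))"
    unfolding riem_vol_def
    by (rule integral_density) (use assms \<gamma>_measurable \<gamma>_pos in \<open>auto simp: borel_measurable_M_iff less_imp_le\<close>)
  finally show ?thesis by (simp add: set_lebesgue_integral_def mult.left_commute)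
qed

lemma AE_M: "(AE x in M. P x) \<longleftrightarrow> (AE x\<in>K in lebesgue. P x)"
proof -
  have "(AE x in M. P x) \<longleftrightarrow> (AE x in riem_vol G. x \<in> K \<longrightarrow> P x)"
    unfolding M_def using K_lebesgue by (subst AE_restrict_space_iff) (auto simp: riem_vol_simps)
  also have "\<dots> \<longleftrightarrow> (AE x\<in>K in lebesgue. P x)"
    unfolding riem_vol_def using \<gamma>_measurable
    by (subst AE_density) (auto simp: det_pos)
  finally show ?thesis .
qed

sublocale finite_measure M
proof
  obtain C where C: "C > 0" "\<And>x. x \<in> K \<Longrightarrow> \<gamma> x \<le> C"
    using bounded_on_compact[OF K_compact continuous_on_\<gamma>] abs_le_D1 unfolding real_norm_def by metis
  have "emeasure M (space M) = (\<integral>\<^sup>+x. 1 \<partial>M)" by simp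
  also have "\<dots> = (\<integral>\<^sup>+x\<in>K. ennreal (\<gamma> x) * 1 \<partial>lebesgue)" by (rule nn_integral_M_lebesgue) simp
  also have "\<dots> \<le> (\<integral>\<^sup>+x. ennreal C * indicator K x \<partial>lebesgue)"
    using C(2) by (intro nn_integral_mono) (auto simp: indicator_def ennreal_leI)
  also have "\<dots> = ennreal C * emeasure lebesgue K"
    using K_lebesgue by (rule nn_integral_cmult_indicator)
  also have "\<dots> < \<infinity>"
    using lmeasurable_compact[OF K_compact] by (auto simp: fmeasurable_def ennreal_mult_less_top)
  finally show "emeasure M (space M) \<noteq> \<infinity>" by simp
qed

lemma id_measurable_M: "(\<lambda>x. x) \<in> M \<rightarrow>\<^sub>M borel"
  by (rule continuous_borel_measurable_M) simp

lemma L2_M_continuous: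
  fixes f :: "real^'n \<Rightarrow> 'a::euclidean_space"
  assumes "continuous_on K f" shows "L2 M f"
  unfolding L2_def
proof
  obtain C where C: "C > 0" "\<And>x. x \<in> K \<Longrightarrow> norm (f x) \<le> C"
    using bounded_on_compact[OF K_compact assms] by blast
  show m: "f \<in> borel_measurable M" by (rule continuous_borel_measurable_M[OF assms])
  show "integrable M (\<lambda>x. (norm (f x))\<^sup>2)"
    by (rule integrable_const_bound[of _ "C\<^sup>2"])
      (use m C in \<open>auto simp: space_M intro!: AE_I2 power_mono\<close>)
qed

lemma L2_M_I:
  fixes f :: "real^'n \<Rightarrow> 'a::euclidean_space"
  assumes "f \<in> borel_measurable M" "(\<integral>\<^sup>+x. ennreal ((norm (f x))\<^sup>2) \<partial>M) < \<infinity>"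
  shows "L2 M f"
  unfolding L2_def using assms by (auto intro!: integrableI_bounded)

lemma L2_tendsto_I:
  fixes f :: "'i \<Rightarrow> real^'n \<Rightarrow> 'a::euclidean_space"
  assumes f: "\<forall>\<^sub>F s in F. L2 M (f s)" and g: "L2 M g"
    and le: "\<forall>\<^sub>F s in F. (\<integral>\<^sup>+x. ennreal ((norm (f s x - g x))\<^sup>2) \<partial>M) \<le> N s" and N: "(N \<longlongrightarrow> 0) F"
  shows "L2_tendsto M f g F"
proof -
  have lim: "((\<lambda>s. enn2real (N s)) \<longlongrightarrow> 0) F" by (rule tendsto_enn2real) (use N in simp_all)
  have fin: "\<forall>\<^sub>F s in F. N s < 1" using order_tendstoD(2)[OF N, of 1] by simp
  have "\<forall>\<^sub>F s in F. norm (LINT x|M. (norm (f s x - g x))\<^sup>2) \<le> enn2real (N s)"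
    using f le fin
  proof eventually_elim
    case (elim s)
    have "L2 M (\<lambda>x. f s x - g x)" using elim g by (intro L2_diff)
    then have "(LINT x|M. (norm (f s x - g x))\<^sup>2) = enn2real (\<integral>\<^sup>+x. ennreal ((norm (f s x - g x))\<^sup>2) \<partial>M)"
      by (intro integral_eq_nn_integral) (auto simp: L2_def)
    also have "\<dots> \<le> enn2real (N s)"
      using elim by (intro enn2real_mono) (auto simp: top.not_eq_extremum dest: less_trans[OF _ ennreal_one_less_top])
    finally show ?case by simp
  qed
  then have "((\<lambda>s. LINT x|M. (norm (f s x - g x))\<^sup>2) \<longlongrightarrow> 0) F"
    by (rule Lim_null_comparison[OF _ lim])
  then show ?thesis using f g by (simp add: L2_tendsto_def)
qed

lemma nn_integral_M_le_riem_vol: "K \<subseteq> S \<Longrightarrow> (\<integral>\<^sup>+x. ennreal ((norm (f x))\<^sup>2) \<partial>M) \<le> L2_sq (riem_vol G) S f"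
  unfolding nn_integral_M L2_sq_def by (intro nn_integral_mono) (auto simp: indicator_def)

lemma nn_integral_M_le_lebesgue:
  obtains C :: real where "\<And>f :: real^'n \<Rightarrow> 'a::euclidean_space. \<And>S. f \<in> borel_measurable M \<Longrightarrow> K \<subseteq> S \<Longrightarrow>
    (\<integral>\<^sup>+x. ennreal ((norm (f x))\<^sup>2) \<partial>M) \<le> ennreal C * L2_sq lebesgue S f"
proof -
  obtain C where C: "C > 0" "\<And>x. x \<in> K \<Longrightarrow> \<gamma> x \<le> C"
    using bounded_on_compact[OF K_compact continuous_on_\<gamma>] abs_le_D1 unfolding real_norm_def by metis
  show thesis
  proof (rule that[of C])
    fix f :: "real^'n \<Rightarrow> 'a" and S assume f: "f \<in> borel_measurable M" and S: "K \<subseteq> S"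
    have m: "(\<lambda>x. ennreal ((norm (f x))\<^sup>2)) \<in> borel_measurable M" using f by simp
    have "(\<integral>\<^sup>+x. ennreal ((norm (f x))\<^sup>2) \<partial>M) = (\<integral>\<^sup>+x\<in>K. ennreal (\<gamma> x) * ennreal ((norm (f x))\<^sup>2) \<partial>lebesgue)"
      by (rule nn_integral_M_lebesgue[OF m])
    also have "\<dots> \<le> (\<integral>\<^sup>+x. ennreal C * (ennreal ((norm (f x))\<^sup>2) * indicator K x) \<partial>lebesgue)"
      using C(2) by (intro nn_integral_mono) (auto simp: indicator_def ennreal_leI intro!: mult_right_mono)
    also have "\<dots> = ennreal C * (\<integral>\<^sup>+x\<in>K. ennreal ((norm (f x))\<^sup>2) \<partial>lebesgue)"
      using m by (intro nn_integral_cmult) (simp add: borel_measurable_M_nn_iff)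
    also have "\<dots> \<le> ennreal C * L2_sq lebesgue S f"
      unfolding L2_sq_def using S by (intro mult_left_mono nn_integral_mono) (auto simp: indicator_def)
    finally show "(\<integral>\<^sup>+x. ennreal ((norm (f x))\<^sup>2) \<partial>M) \<le> ennreal C * L2_sq lebesgue S f" .
  qed
qed

text \<open>A single finite distance puts the limit into $L^2$, since the members of the sequence lie there.\<close>

lemma L2_limit:
  fixes e :: "nat \<Rightarrow> real^'n \<Rightarrow> 'a::euclidean_space"
  assumes e: "\<And>k. L2 M (e k)" and g: "g \<in> borel_measurable M" and S: "K \<subseteq> S"
    and lim: "(\<lambda>k. L2_sq lebesgue S (\<lambda>x. e k x - g x)) \<longlonglongrightarrow> 0"
  shows "L2 M g" "L2_tendsto M e g sequentially"
proof -
  obtain C where C: "\<And>f :: real^'n \<Rightarrow> 'a. \<And>S. f \<in> borel_measurable M \<Longrightarrow> K \<subseteq> S \<Longrightarrow>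
    (\<integral>\<^sup>+x. ennreal ((norm (f x))\<^sup>2) \<partial>M) \<le> ennreal C * L2_sq lebesgue S f"
    using nn_integral_M_le_lebesgue by metis
  have m: "(\<lambda>x. e k x - g x) \<in> borel_measurable M" for k
    using e[of k] g by (auto simp: L2_def)
  have "(\<lambda>k. ennreal C * L2_sq lebesgue S (\<lambda>x. e k x - g x)) \<longlonglongrightarrow> ennreal C * 0"
    by (rule ennreal_tendsto_cmult[OF _ lim]) simp
  then have lim': "(\<lambda>k. ennreal C * L2_sq lebesgue S (\<lambda>x. e k x - g x)) \<longlonglongrightarrow> 0" by simp
  have le: "(\<integral>\<^sup>+x. ennreal ((norm (e k x - g x))\<^sup>2) \<partial>M) \<le> ennreal C * L2_sq lebesgue S (\<lambda>x. e k x - g x)" for k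
    by (rule C[OF m S])
  have "\<forall>\<^sub>F k in sequentially. ennreal C * L2_sq lebesgue S (\<lambda>x. e k x - g x) < 1"
    using order_tendstoD(2)[OF lim', of 1] by simp
  then obtain k where "ennreal C * L2_sq lebesgue S (\<lambda>x. e k x - g x) < 1"
    by (auto simp: eventually_sequentially)
  then have "(\<integral>\<^sup>+x. ennreal ((norm (e k x - g x))\<^sup>2) \<partial>M) < 1" using le[of k] by (rule le_less_trans[rotated])
  then have "(\<integral>\<^sup>+x. ennreal ((norm (e k x - g x))\<^sup>2) \<partial>M) < \<infinity>"
    using less_trans[OF _ ennreal_one_less_top] by simp
  from L2_diff[OF e[of k] L2_M_I[OF m this]] show g': "L2 M g" by simp
  show "L2_tendsto M e g sequentially"
    by (rule L2_tendsto_I[OF _ g' _ lim']) (use e le in auto)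
qed

end

lemma set_integrable_mult_continuous:
  fixes f :: "'a::euclidean_space \<Rightarrow> real"
  assumes "set_integrable lebesgue K f" "compact K" "K \<subseteq> S" "continuous_on K \<phi>" "\<And>x. x \<notin> K \<Longrightarrow> \<phi> x = 0"
  shows "set_integrable lebesgue S (\<lambda>x. f x * \<phi> x)"
proof -
  obtain C where C: "C > 0" "\<And>x. x \<in> K \<Longrightarrow> norm (\<phi> x) \<le> C"
    using bounded_on_compact[OF assms(2,4)] by blast
  have "(\<lambda>x. indicator K x *\<^sub>R \<phi> x) \<in> borel_measurable lebesgue"
    using borel_measurable_continuous_on_indicator[of K \<phi>] assms(2,4) by (auto intro!: measurable_completion simp: borel_compact)
  moreover have "(\<lambda>x. indicator K x *\<^sub>R f x) \<in> borel_measurable lebesgue"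
    using assms(1) by (auto simp: set_integrable_def)
  ultimately have m: "(\<lambda>x. (indicator K x *\<^sub>R f x) * (indicator K x *\<^sub>R \<phi> x)) \<in> borel_measurable lebesgue"
    by (rule borel_measurable_times[rotated])
  have "integrable lebesgue (\<lambda>x. (indicator K x *\<^sub>R f x) * (indicator K x *\<^sub>R \<phi> x))"
  proof (rule Bochner_Integration.integrable_bound[OF _ m])
    show "integrable lebesgue (\<lambda>x. C * (indicator K x *\<^sub>R f x))"
      using assms(1) by (auto simp: set_integrable_def)
    show "AE x in lebesgue. norm ((indicator K x *\<^sub>R f x) * (indicator K x *\<^sub>R \<phi> x)) \<le> norm (C * (indicator K x *\<^sub>R f x))"
      using C by (intro AE_I2) (auto simp: indicator_def abs_mult mult.commute intro!: mult_right_mono)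
  qed
  moreover have "(\<lambda>x. (indicator K x *\<^sub>R f x) * (indicator K x *\<^sub>R \<phi> x)) = (\<lambda>x. indicator S x *\<^sub>R (f x * \<phi> x))"
    using assms(3,5) by (force simp: indicator_def fun_eq_iff)
  ultimately show ?thesis by (simp add: set_integrable_def)
qed

section \<open>Weak gradients\<close>

lemma has_weak_grad_component_integrable:
  assumes "has_weak_grad \<Omega> w D" "compact K" "K \<subseteq> \<Omega>"
  shows "set_integrable lebesgue K (\<lambda>x. D x $ i)"
proof -
  have "set_integrable lebesgue K D" using assms by (auto simp: has_weak_grad_def)
  then show ?thesis
    unfolding set_integrable_def
    using integrable_bounded_linear[OF bounded_linear_vec_nth[of i]] by fastforce
qed

lemma test_mult_integrable:
  assumes "test_function \<Omega> \<phi>" "\<And>K. compact K \<Longrightarrow> K \<subseteq> \<Omega> \<Longrightarrow> set_integrable lebesgue K f"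
  shows "set_integrable lebesgue \<Omega> (\<lambda>x. f x * \<phi> x)" "set_integrable lebesgue \<Omega> (\<lambda>x. f x * partial i \<phi> x)"
proof -
  obtain K where K: "\<And>k. Ck_on k UNIV \<phi>" "compact K" "K \<subseteq> \<Omega>" "\<And>x. x \<notin> K \<Longrightarrow> \<phi> x = 0"
    by (rule test_functionE[OF assms(1)]) metis
  show "set_integrable lebesgue \<Omega> (\<lambda>x. f x * \<phi> x)"
    by (rule set_integrable_mult_continuous[OF assms(2) K(2,3) _ K(4)])
      (use K continuous_on_subset[OF Ck_on_continuous[OF K(1)]] in auto)
  show "set_integrable lebesgue \<Omega> (\<lambda>x. f x * partial i \<phi> x)"
    by (rule set_integrable_mult_continuous[OF assms(2) K(2,3) continuous_on_partial[OF K(1)] partial_eq_0_outside[OF _ K(4)]])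
      (use K in \<open>auto intro: compact_imp_closed\<close>)
qed

lemma has_weak_grad_diff:
  assumes "has_weak_grad \<Omega> w1 D1" "has_weak_grad \<Omega> w2 D2"
  shows "has_weak_grad \<Omega> (\<lambda>x. w1 x - w2 x) (\<lambda>x. D1 x - D2 x)"
  unfolding has_weak_grad_def
proof (intro conjI allI impI)
  fix K assume "compact K \<and> K \<subseteq> \<Omega>"
  then show "set_integrable lebesgue K (\<lambda>x. w1 x - w2 x)" "set_integrable lebesgue K (\<lambda>x. D1 x - D2 x)"
    using assms by (auto simp: has_weak_grad_def intro!: set_integral_diff)
next
  fix \<phi> i assume t: "test_function \<Omega> \<phi>"
  have i: "set_integrable lebesgue \<Omega> (\<lambda>x. w x * partial i \<phi> x)" "set_integrable lebesgue \<Omega> (\<lambda>x. D x $ i * \<phi> x)"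
    if "has_weak_grad \<Omega> w D" for w D
    using test_mult_integrable[OF t] has_weak_grad_component_integrable[OF that] that
    by (auto simp: has_weak_grad_def)
  show "(LINT x:\<Omega>|lebesgue. (w1 x - w2 x) * partial i \<phi> x) = - (LINT x:\<Omega>|lebesgue. (D1 x - D2 x) $ i * \<phi> x)"
    using assms t i[OF assms(1)] i[OF assms(2)] by (simp add: has_weak_grad_def left_diff_distrib)
qed

text \<open>The difference of two weak gradients is a weak gradient of zero, hence orthogonal to all test functions.\<close>

lemma weak_grad_unique:
  assumes "open \<Omega>" "has_weak_grad \<Omega> w D1" "has_weak_grad \<Omega> w D2"
  shows "AE x\<in>\<Omega> in lebesgue. D1 x = D2 x"
proof -
  have 0: "has_weak_grad \<Omega> (\<lambda>x. 0) (\<lambda>x. D1 x - D2 x)"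
    using has_weak_grad_diff[OF assms(2,3)] by simp
  have "AE x\<in>\<Omega> in lebesgue. (D1 x - D2 x) $ i = 0" for i
  proof (rule fundamental_lemma[OF assms(1)])
    fix \<phi> assume "test_function \<Omega> \<phi>"
    then show "(LINT x:\<Omega>|lebesgue. (D1 x - D2 x) $ i * \<phi> x) = 0"
      using 0 by (simp add: has_weak_grad_def set_lebesgue_integral_def)
  qed (rule has_weak_grad_component_integrable[OF 0])
  then have "AE x in lebesgue. \<forall>i. x \<in> \<Omega> \<longrightarrow> (D1 x - D2 x) $ i = 0"
    by (intro AE_all_countable[THEN iffD2] allI) auto
  then show ?thesis by eventually_elim (auto simp: vec_eq_iff)
qed

lemma has_weak_grad_weak_grad: "has_weak_grad \<Omega> w D \<Longrightarrow> has_weak_grad \<Omega> w (weak_grad \<Omega> w)"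
  unfolding weak_grad_def by (rule someI[where P = "has_weak_grad \<Omega> w"])

section \<open>The wave equation over a compact part of the domain\<close>

text \<open>The restriction of a wave to a compact set \<open>K\<close> on which both of its data vanish. All norms and
pairings are taken over \<open>K\<close>, where the metric is comparable to the Euclidean one.\<close>

locale exterior_wave = riemannian_compact G K for G :: "real^'n::finite \<Rightarrow> real^'n^'n" and K +
  fixes \<Omega> :: "(real^'n) set" and u v :: "real \<Rightarrow> real^'n \<Rightarrow> real"
  assumes \<Omega>_open: "open \<Omega>" and K_subset: "K \<subseteq> \<Omega>"
    and u_H10: "continuous_H10_hat G \<Omega> u" and wave: "wave_equation G \<Omega> u"
    and v_L2_space: "continuous_L2 (riem_vol G) \<Omega> v"
    and u_derivative_v: "has_L2_time_derivative (riem_vol G) \<Omega> u v"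
    and u_initial: "AE x\<in>K in lebesgue. u 0 x = 0" and v_initial: "AE x\<in>K in lebesgue. v 0 x = 0"
begin

definition D :: "real \<Rightarrow> real^'n \<Rightarrow> real^'n" where "D t = weak_grad \<Omega> (u t)"

lemma has_weak_grad_D: "t \<ge> 0 \<Longrightarrow> has_weak_grad \<Omega> (u t) (D t)"
  using u_H10 has_weak_grad_weak_grad
  unfolding continuous_H10_hat_def H10_hat_def weakly_differentiable_on_def D_def by blast

lemma weak_grad_measurable_M:
  assumes "has_weak_grad \<Omega> w d" shows "w \<in> borel_measurable M" "d \<in> borel_measurable M"
  using assms K_compact K_subset
  by (auto simp: borel_measurable_M_iff has_weak_grad_def set_integrable_def)

lemma approximation:
  assumes t: "t \<ge> 0"
  obtains \<phi> where "\<And>k. test_function \<Omega> (\<phi> k)" "L2_tendsto M \<phi> (u t) sequentially"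
    "L2_tendsto M (\<lambda>k. grad (\<phi> k)) (D t) sequentially"
proof -
  have "vanishes_on_boundary \<Omega> (u t)"
    using u_H10 t by (auto simp: continuous_H10_hat_def H10_hat_def)
  then obtain \<phi> where \<phi>: "\<And>k. test_function \<Omega> (\<phi> k)"
    "\<And>R. (\<lambda>k::nat. L2_sq lebesgue (\<Omega> \<inter> ball 0 R) (\<lambda>x. \<phi> k x - u t x)) \<longlonglongrightarrow> 0"
    "\<And>R. (\<lambda>k. L2_sq lebesgue (\<Omega> \<inter> ball 0 R) (\<lambda>x. grad (\<phi> k) x - D t x)) \<longlonglongrightarrow> 0"
    unfolding vanishes_on_boundary_def D_def by auto
  obtain R where R: "K \<subseteq> ball 0 R"
    using bounded_subset_ballD[OF compact_imp_bounded[OF K_compact], of 0] by blast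
  have ck: "Ck_on m UNIV (\<phi> k)" for m k using \<phi>(1)[of k] by (auto simp: test_function_def smooth_on_def)
  have L: "L2 M (\<phi> k)" "L2 M (grad (\<phi> k))" for k
    using continuous_on_subset[OF Ck_on_continuous[OF ck]] continuous_on_partial[OF ck]
    by (auto intro!: L2_M_continuous continuous_on_vec_lambda simp: grad_def[abs_def])
  have S: "K \<subseteq> \<Omega> \<inter> ball 0 R" using R K_subset by auto
  show thesis
    by (rule that[OF \<phi>(1)])
      (rule L2_limit(2)[OF L(1) _ S \<phi>(2)] L2_limit(2)[OF L(2) _ S \<phi>(3)], rule weak_grad_measurable_M[OF has_weak_grad_D[OF t]])+
qed

lemma u_L2: "t \<ge> 0 \<Longrightarrow> L2 M (u t)" and D_L2: "t \<ge> 0 \<Longrightarrow> L2 M (D t)"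
  by (rule approximation, assumption, simp add: L2_tendsto_def)+

text \<open>The assumption controls the gradient chosen for the difference \<open>u s - u t\<close>; by uniqueness it is
the difference of the gradients chosen for \<open>u s\<close> and \<open>u t\<close>.\<close>

lemma D_continuous: assumes t: "t \<ge> 0" shows "L2_tendsto M D (D t) (at t within {0..})"
proof -
  obtain C where C: "C > 0" "\<And>x p. x \<in> K \<Longrightarrow> (norm p)\<^sup>2 \<le> C * cometric x p p"
    using cometric_bound_on_compact[OF K_compact] by metis
  let ?N = "\<lambda>s. dirichlet G \<Omega> (\<lambda>x. u s x - u t x)"
  have nonneg: "\<forall>\<^sub>F s in at t within {0..}. s \<ge> 0" by (auto simp: eventually_at_filter)
  have "((\<lambda>s. ennreal C * ?N s) \<longlongrightarrow> ennreal C * 0) (at t within {0..})"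
    using u_H10 t by (intro ennreal_tendsto_cmult) (auto simp: continuous_H10_hat_def)
  then have lim: "((\<lambda>s. ennreal C * ?N s) \<longlongrightarrow> 0) (at t within {0..})" by simp
  have le: "(\<integral>\<^sup>+x. ennreal ((norm (D s x - D t x))\<^sup>2) \<partial>M) \<le> ennreal C * ?N s" if s: "s \<ge> 0" for s
  proof -
    define W where "W = weak_grad \<Omega> (\<lambda>x. u s x - u t x)"
    have wd: "has_weak_grad \<Omega> (\<lambda>x. u s x - u t x) (\<lambda>x. D s x - D t x)"
      by (rule has_weak_grad_diff[OF has_weak_grad_D[OF s] has_weak_grad_D[OF t]])
    have W: "has_weak_grad \<Omega> (\<lambda>x. u s x - u t x) W"
      unfolding W_def by (rule has_weak_grad_weak_grad[OF wd])
    have "AE x\<in>K in lebesgue. D s x - D t x = W x"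
      using weak_grad_unique[OF \<Omega>_open wd W] by eventually_elim (use K_subset in auto)
    then have ae: "AE x in M. D s x - D t x = W x" by (simp add: AE_M)
    have m: "(\<lambda>x. cometric x (W x) (W x)) \<in> borel_measurable M"
      by (intro cometric_measurable id_measurable_M weak_grad_measurable_M[OF W])
    have "(\<integral>\<^sup>+x. ennreal ((norm (D s x - D t x))\<^sup>2) \<partial>M) = (\<integral>\<^sup>+x. ennreal ((norm (W x))\<^sup>2) \<partial>M)"
      using ae by (intro nn_integral_cong_AE) (auto elim: eventually_mono)
    also have "\<dots> \<le> (\<integral>\<^sup>+x. ennreal C * ennreal ((norm (riem_norm G x (riem_grad G W x)))\<^sup>2) \<partial>M)"
      using C by (intro nn_integral_mono)
        (auto simp: space_M riem_norm_grad_sq ennreal_mult'[symmetric] cometric_nonneg intro!: ennreal_leI)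
    also have "\<dots> = ennreal C * (\<integral>\<^sup>+x. ennreal ((norm (riem_norm G x (riem_grad G W x)))\<^sup>2) \<partial>M)"
      using m by (intro nn_integral_cmult) (simp add: riem_norm_grad_sq)
    also have "\<dots> \<le> ennreal C * ?N s"
      unfolding dirichlet_def W_def[symmetric] by (intro mult_left_mono nn_integral_M_le_riem_vol K_subset) auto
    finally show ?thesis .
  qed
  show ?thesis
    by (rule L2_tendsto_I[OF _ D_L2[OF t] _ lim]) (use nonneg in \<open>auto elim!: eventually_mono intro: le D_L2\<close>)
qed

lemma v_L2: assumes t: "t \<ge> 0" shows "L2 M (v t)"
proof (rule L2_M_I)
  have v: "v t \<in> L2_space (riem_vol G) \<Omega>" using v_L2_space t by (auto simp: continuous_L2_def)
  then have m: "(\<lambda>x. indicator \<Omega> x *\<^sub>R v t x) \<in> borel_measurable lebesgue"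
    using measurable_cong_sets[OF riem_vol_simps(2) refl] by (auto simp: L2_space_def set_borel_measurable_def)
  have "(\<lambda>x. indicator K x *\<^sub>R (indicator \<Omega> x *\<^sub>R v t x)) \<in> borel_measurable lebesgue"
    by (rule borel_measurable_scaleR[OF borel_measurable_indicator[OF K_lebesgue] m])
  moreover have "(\<lambda>x. indicator K x *\<^sub>R (indicator \<Omega> x *\<^sub>R v t x)) = (\<lambda>x. indicator K x *\<^sub>R v t x)"
    using K_subset by (force simp: indicator_def fun_eq_iff)
  ultimately show "v t \<in> borel_measurable M" by (simp add: borel_measurable_M_iff)
  show "(\<integral>\<^sup>+x. ennreal ((norm (v t x))\<^sup>2) \<partial>M) < \<infinity>"
    using nn_integral_M_le_riem_vol[OF K_subset, of "v t"] v by (auto simp: L2_space_def intro: le_less_trans)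
qed

lemma v_continuous: assumes t: "t \<ge> 0" shows "L2_tendsto M v (v t) (at t within {0..})"
proof (rule L2_tendsto_I[OF _ v_L2[OF t]])
  show "((\<lambda>s. L2_sq (riem_vol G) \<Omega> (\<lambda>x. v s x - v t x)) \<longlongrightarrow> 0) (at t within {0..})"
    using v_L2_space t by (auto simp: continuous_L2_def)
  show "\<forall>\<^sub>F s in at t within {0..}. (\<integral>\<^sup>+x. ennreal ((norm (v s x - v t x))\<^sup>2) \<partial>M)
      \<le> L2_sq (riem_vol G) \<Omega> (\<lambda>x. v s x - v t x)"
    by (intro always_eventually allI nn_integral_M_le_riem_vol K_subset)
qed (auto simp: eventually_at_filter v_L2)

lemma u_derivative: assumes t: "t \<ge> 0"
  shows "L2_tendsto M (\<lambda>s x. (u s x - u t x) / (s - t)) (v t) (at t within {0..})"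
proof (rule L2_tendsto_I[OF _ v_L2[OF t]])
  show "((\<lambda>s. L2_sq (riem_vol G) \<Omega> (\<lambda>x. (u s x - u t x) / (s - t) - v t x)) \<longlongrightarrow> 0) (at t within {0..})"
    using u_derivative_v t by (auto simp: has_L2_time_derivative_def)
  have "L2 M (\<lambda>x. (u s x - u t x) / (s - t))" if "s \<ge> 0" for s
    using L2_scaleR[OF L2_diff[OF u_L2[OF that] u_L2[OF t]], of "inverse (s - t)"] by (simp add: divide_inverse mult.commute)
  then show "\<forall>\<^sub>F s in at t within {0..}. L2 M (\<lambda>x. (u s x - u t x) / (s - t))"
    by (auto simp: eventually_at_filter)
  show "\<forall>\<^sub>F s in at t within {0..}. (\<integral>\<^sup>+x. ennreal ((norm ((u s x - u t x) / (s - t) - v t x))\<^sup>2) \<partial>M)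
      \<le> L2_sq (riem_vol G) \<Omega> (\<lambda>x. (u s x - u t x) / (s - t) - v t x)"
    by (intro always_eventually allI nn_integral_M_le_riem_vol K_subset)
qed

lemma cometric_form: "L2_form M cometric"
proof -
  obtain C where C: "\<And>x p p'. x \<in> K \<Longrightarrow> \<bar>cometric x p p'\<bar> \<le> C * norm p * norm p'"
    using cometric_bound_on_compact[OF K_compact] by metis
  show ?thesis
    by unfold_locales
      (use C in \<open>auto simp: space_M intro: cometric_bilinear cometric_measurable id_measurable_M\<close>)
qed

lemma L2_M_smooth:
  assumes "\<And>k. Ck_on k UNIV \<psi>" shows "L2 M \<psi>" "L2 M (grad \<psi>)"
  using continuous_on_subset[OF Ck_on_continuous[OF assms]] continuous_on_partial[OF assms]
  by (auto intro!: L2_M_continuous continuous_on_vec_lambda simp: grad_def[abs_def])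

text \<open>Up to the volume density the Laplacian of \<open>\<psi>\<close> is a sum of derivatives of the test functions \<open>flux \<psi> i\<close>, to
which the definition of the weak gradient applies.\<close>

lemma integral_weak_laplacian:
  assumes ck: "\<And>k. Ck_on k UNIV \<psi>" and supp: "\<And>x. x \<notin> K \<Longrightarrow> \<psi> x = 0"
    and w: "has_weak_grad \<Omega> w d" "L2 M w" "L2 M d"
  shows "integrable M (\<lambda>x. w x * laplace_beltrami G \<psi> x)"
    and "(LINT x|M. w x * laplace_beltrami G \<psi> x) = - (LINT x|M. cometric x (d x) (grad \<psi> x))"
proof -
  have K_closed: "closed K" using K_compact by (rule compact_imp_closed)
  have flux0: "x \<notin> K \<Longrightarrow> flux \<psi> i x = 0" for x i by (rule flux_eq_0_outside[OF K_closed supp])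
  have flux0': "x \<notin> K \<Longrightarrow> partial j (flux \<psi> i) x = 0" for x i j by (rule partial_eq_0_outside[OF K_closed flux0])
  have test: "test_function \<Omega> (flux \<psi> i)" for i
    by (rule test_functionI[OF Ck_on_flux[OF ck] K_compact K_subset flux0])
  have lap: "laplace_beltrami G \<psi> x = inverse (\<gamma> x) * (\<Sum>i\<in>UNIV. partial i (flux \<psi> i) x)" for x
    using laplace_beltrami_flux[of x \<psi>] \<gamma>_pos[of x] by (simp add: field_simps)
  have "continuous_on K (laplace_beltrami G \<psi>)"
    unfolding lap[abs_def] using \<gamma>_pos
    by (intro continuous_intros continuous_on_\<gamma> continuous_on_partial Ck_on_flux ck) (auto simp: less_imp_neq[symmetric] det_pos)
  then have Llap: "L2 M (laplace_beltrami G \<psi>)" by (rule L2_M_continuous)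
  interpret f: L2_form M "\<lambda>x (r::real) s. r * s" by (rule L2_form_mult)
  show int: "integrable M (\<lambda>x. w x * laplace_beltrami G \<psi> x)"
    using f.integrable_form[OF w(2) Llap] .
  have i1: "set_integrable lebesgue \<Omega> (\<lambda>x. w x * partial i (flux \<psi> i) x)"
    and i2: "set_integrable lebesgue \<Omega> (\<lambda>x. d x $ i * flux \<psi> i x)" for i
    using test_mult_integrable[OF test] w(1) has_weak_grad_component_integrable[OF w(1)]
    by (auto simp: has_weak_grad_def)
  have ind: "(\<lambda>x. indicator K x *\<^sub>R f x) = (\<lambda>x. indicator \<Omega> x *\<^sub>R f x)" if "\<And>x. x \<notin> K \<Longrightarrow> f x = 0" for f :: "real^'n \<Rightarrow> real"
    using that K_subset by (force simp: indicator_def fun_eq_iff)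
  have "(LINT x|M. w x * laplace_beltrami G \<psi> x) = (LINT x:K|lebesgue. \<gamma> x * (w x * laplace_beltrami G \<psi> x))"
    using int by (intro integral_M) auto
  also have "\<dots> = (LINT x:K|lebesgue. (\<Sum>i\<in>UNIV. w x * partial i (flux \<psi> i) x))"
    by (simp add: laplace_beltrami_flux mult.left_commute[of "\<gamma> _"] sum_distrib_left)
  also have "\<dots> = (LINT x:\<Omega>|lebesgue. (\<Sum>i\<in>UNIV. w x * partial i (flux \<psi> i) x))"
    unfolding set_lebesgue_integral_def by (subst ind) (simp_all add: flux0')
  also have "\<dots> = (\<Sum>i\<in>UNIV. LINT x:\<Omega>|lebesgue. w x * partial i (flux \<psi> i) x)"
    unfolding set_lebesgue_integral_def scaleR_sum_right
    by (rule Bochner_Integration.integral_sum) (rule i1[unfolded set_integrable_def])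
  also have "\<dots> = (\<Sum>i\<in>UNIV. - (LINT x:\<Omega>|lebesgue. d x $ i * flux \<psi> i x))"
    using w(1) test by (simp add: has_weak_grad_def)
  also have "\<dots> = - (LINT x:\<Omega>|lebesgue. (\<Sum>i\<in>UNIV. d x $ i * flux \<psi> i x))"
    unfolding sum_negf set_lebesgue_integral_def scaleR_sum_right
    by (subst Bochner_Integration.integral_sum) (rule i2[unfolded set_integrable_def], rule refl)
  also have "\<dots> = - (LINT x:K|lebesgue. (\<Sum>i\<in>UNIV. d x $ i * flux \<psi> i x))"
    unfolding set_lebesgue_integral_def by (subst ind) (simp_all add: flux0)
  also have "\<dots> = - (LINT x:K|lebesgue. \<gamma> x * cometric x (d x) (grad \<psi> x))"
    by (simp only: sum_flux)
  also have "\<dots> = - (LINT x|M. cometric x (d x) (grad \<psi> x))"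
    using w(3) L2_M_smooth(2)[OF ck]
    by (subst integral_M) (auto simp: L2_def intro!: cometric_measurable id_measurable_M)
  finally show "(LINT x|M. w x * laplace_beltrami G \<psi> x) = - (LINT x|M. cometric x (d x) (grad \<psi> x))" .
qed

lemma wave_equation_separated:
  assumes ck: "\<And>k. Ck_on k UNIV \<psi>" and supp: "\<And>x. x \<notin> K \<Longrightarrow> \<psi> x = 0"
    and \<theta>: "test_function {0<..} \<theta>"
  shows "(LINT t:{0<..}|lebesgue. deriv (deriv \<theta>) t * (LINT x|M. u t x * \<psi> x)
    - \<theta> t * - (LINT x|M. cometric x (D t x) (grad \<psi> x))) = 0"
proof -
  obtain J where J: "\<And>k. Ck_on k UNIV \<theta>" "compact J" "J \<subseteq> {0<..}" "\<And>x. x \<notin> J \<Longrightarrow> \<theta> x = 0"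
    by (rule test_functionE[OF \<theta>]) metis
  let ?\<phi> = "\<lambda>p. \<theta> (fst p) * \<psi> (snd p)"
  have "test_function ({0<..} \<times> \<Omega>) ?\<phi>"
  proof (rule test_functionI[where K = "J \<times> K"])
    show "Ck_on k UNIV ?\<phi>" for k
      by (rule Ck_on_mult[OF Ck_on_compose_linear[OF bounded_linear_fst J(1)]
            Ck_on_compose_linear[OF bounded_linear_snd ck] open_UNIV])
    show "?\<phi> p = 0" if "p \<notin> J \<times> K" for p
      using J(4)[of "fst p"] supp[of "snd p"] that by (cases p) auto
  qed (use J K_compact K_subset in \<open>auto intro: compact_Times\<close>)
  then have 0: "(LINT t:{0<..}|lebesgue. (LINT x:\<Omega>|riem_vol G.
      u t x * ((deriv ^^ 2) (\<lambda>s. ?\<phi> (s, x)) t - laplace_beltrami G (\<lambda>y. ?\<phi> (t, y)) x))) = 0"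
    by (rule wave[unfolded wave_equation_def, rule_format])
  have d1: "\<theta> differentiable at t" for t by (rule Ck_on_differentiable[OF J(1)])
  have der: "deriv \<theta> t = frechet_derivative \<theta> (at t) 1" for t
    using fun_cong[OF frechet_derivative_at[OF DERIV_deriv_iff_real_differentiable[THEN iffD2, OF d1, unfolded has_field_derivative_def]], of t 1]
    by simp
  have d2: "deriv \<theta> differentiable at t" for t
    unfolding der[abs_def] by (rule Ck_on_differentiable[OF Ck_on_SucD(2)[OF open_UNIV J(1)]])
  have dd: "(deriv ^^ 2) (\<lambda>s. \<theta> s * c) t = deriv (deriv \<theta>) t * c" for c t
  proof -
    have "deriv (\<lambda>s. \<theta> s * c) = (\<lambda>s. deriv \<theta> s * c)"
      using d1 by (auto intro!: DERIV_imp_deriv DERIV_cmult_right simp: DERIV_deriv_iff_real_differentiable)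
    moreover have "deriv (\<lambda>s. deriv \<theta> s * c) t = deriv (deriv \<theta>) t * c"
      using d2 by (auto intro!: DERIV_imp_deriv DERIV_cmult_right simp: DERIV_deriv_iff_real_differentiable)
    ultimately show ?thesis by (simp add: numeral_2_eq_2)
  qed
  have K_closed: "closed K" using K_compact by (rule compact_imp_closed)
  have lap0: "laplace_beltrami G \<psi> x = 0" if "x \<notin> K" for x
  proof -
    have "\<gamma> x * laplace_beltrami G \<psi> x = 0"
      unfolding laplace_beltrami_flux
      using partial_eq_0_outside[OF K_closed flux_eq_0_outside[OF K_closed supp] that] by simp
    then show ?thesis using \<gamma>_pos[of x] by simp
  qed
  interpret f: L2_form M "\<lambda>x (r::real) s. r * s" by (rule L2_form_mult)
  have inner: "(LINT x:\<Omega>|riem_vol G. u t x * ((deriv ^^ 2) (\<lambda>s. ?\<phi> (s, x)) t - laplace_beltrami G (\<lambda>y. ?\<phi> (t, y)) x))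
      = deriv (deriv \<theta>) t * (LINT x|M. u t x * \<psi> x) - \<theta> t * - (LINT x|M. cometric x (D t x) (grad \<psi> x))"
    if t: "t > 0" for t
  proof -
    let ?F = "\<lambda>x. deriv (deriv \<theta>) t * (u t x * \<psi> x) - \<theta> t * (u t x * laplace_beltrami G \<psi> x)"
    have eq: "u t x * ((deriv ^^ 2) (\<lambda>s. ?\<phi> (s, x)) t - laplace_beltrami G (\<lambda>y. ?\<phi> (t, y)) x) = ?F x" for x
      by (simp only: fst_conv snd_conv dd laplace_beltrami_cmult[OF ck]) (simp add: algebra_simps)
    have "(LINT x:\<Omega>|riem_vol G. ?F x) = (LINT x|riem_vol G. indicator K x *\<^sub>R ?F x)"
      unfolding set_lebesgue_integral_def
      by (rule Bochner_Integration.integral_cong[OF refl]) (use supp lap0 K_subset in \<open>auto simp: indicator_def\<close>)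
    also have "\<dots> = (LINT x|M. ?F x)"
      unfolding M_def using K_lebesgue by (intro integral_restrict_space[symmetric]) (auto simp: riem_vol_simps)
    also have "\<dots> = deriv (deriv \<theta>) t * (LINT x|M. u t x * \<psi> x) - \<theta> t * (LINT x|M. u t x * laplace_beltrami G \<psi> x)"
      using integral_weak_laplacian(1)[OF ck supp has_weak_grad_D u_L2 D_L2, of t]
        f.integrable_form[OF u_L2 L2_M_smooth(1)[OF ck], of t] t
      by (subst Bochner_Integration.integral_diff) auto
    finally show ?thesis
      unfolding eq using integral_weak_laplacian(2)[OF ck supp has_weak_grad_D u_L2 D_L2, of t] t by simp
  qed
  show ?thesis
    using 0 inner by (subst set_lebesgue_integral_cong[where g = "\<lambda>t. (LINT x:\<Omega>|riem_vol G. u t x *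
      ((deriv ^^ 2) (\<lambda>s. ?\<phi> (s, x)) t - laplace_beltrami G (\<lambda>y. ?\<phi> (t, y)) x))"]) auto
qed

text \<open>The function $t \mapsto \int u(t) \psi$ is continuously differentiable, and its second derivative in the
sense of distributions is the continuous function $t \mapsto - \int \langle D(t), \nabla \psi\rangle$.\<close>

lemma wave_equation_tested:
  assumes ck: "\<And>k. Ck_on k UNIV \<psi>" and supp: "\<And>x. x \<notin> K \<Longrightarrow> \<psi> x = 0" and t: "t \<ge> 0"
  shows "(LINT x|M. v t x * \<psi> x) = - integral {0..t} (\<lambda>s. LINT x|M. cometric x (D s x) (grad \<psi> x))"
proof -
  interpret f: L2_form M "\<lambda>x (r::real) s. r * s" by (rule L2_form_mult)
  interpret c: L2_form M cometric by (rule cometric_form)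
  note L = L2_M_smooth[OF ck]
  let ?p = "\<lambda>t. f.form (v t) \<psi>" and ?g = "\<lambda>t. - c.form (D t) (grad \<psi>)"
  have "?p t - ?p 0 = integral {0..t} ?g"
  proof (rule distributional_second_derivative[where f = "\<lambda>t. f.form (u t) \<psi>", OF _ _ _ _ t])
    fix s :: real assume s: "s > 0"
    have at: "at s within {0..} = at s" by (rule at_within_interior) (use s in auto)
    have "((\<lambda>r. f.form (\<lambda>x. (u r x - u s x) / (r - s)) \<psi>) \<longlongrightarrow> f.form (v s) \<psi>) (at s)"
      using u_derivative[of s] s L unfolding at by (intro f.form_tendsto L2_tendsto_const) auto
    then have "((\<lambda>r. (f.form (u r) \<psi> - f.form (u s) \<psi>) / (r - s)) \<longlongrightarrow> f.form (v s) \<psi>) (at s)"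
    proof (rule Lim_transform_eventually)
      have "\<forall>\<^sub>F r in at s. r > 0" using s eventually_at_in_open'[of "{0<..}" s] by (auto elim: eventually_mono)
      then show "\<forall>\<^sub>F r in at s. f.form (\<lambda>x. (u r x - u s x) / (r - s)) \<psi> = (f.form (u r) \<psi> - f.form (u s) \<psi>) / (r - s)"
      proof eventually_elim
        case (elim r)
        have eq: "(\<lambda>x. (u r x - u s x) / (r - s)) = (\<lambda>x. inverse (r - s) *\<^sub>R (u r x - u s x))"
          by (auto simp: divide_inverse)
        show ?case
          unfolding eq f.form_scale_left using elim s u_L2 L
          by (subst f.form_diff_left) (auto simp: divide_inverse)
      qed
    qed
    then show "((\<lambda>t. f.form (u t) \<psi>) has_real_derivative ?p s) (at s)"
      by (simp add: has_field_derivative_iff)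
  next
    show "continuous_on {0..} ?p"
      unfolding continuous_on_def using v_continuous L by (auto intro!: f.form_tendsto L2_tendsto_const)
    show "continuous_on {0..} ?g"
      unfolding continuous_on_def using D_continuous L by (auto intro!: c.form_tendsto L2_tendsto_const tendsto_minus)
  next
    fix \<theta> :: "real \<Rightarrow> real" assume "test_function {0<..} \<theta>"
    from wave_equation_separated[OF ck supp this]
    show "(LINT t:{0<..}|lebesgue. deriv (deriv \<theta>) t * f.form (u t) \<psi> - \<theta> t * ?g t) = 0"
      by (simp add: pairing_def)
  qed
  moreover have "?p 0 = 0"
    unfolding pairing_def using v_initial by (intro integral_eq_zero_AE) (auto simp: AE_M elim: eventually_mono)
  ultimately show ?thesis by (simp add: pairing_def)
qed

lemma D_bounded: obtains B where "\<And>s. s \<in> {0..t} \<Longrightarrow> (LINT x|M. (norm (D s x))\<^sup>2) \<le> B"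
proof -
  interpret i: L2_form M "\<lambda>x (p::real^'n) p'. p \<bullet> p'"
    by unfold_locales (auto simp: bilinear_def inner_add_left inner_add_right norm_cauchy_schwarz_abs_eq
        intro!: linearI borel_measurable_inner exI[of _ 1] Cauchy_Schwarz_ineq2)
  have "continuous_on {0..t} (\<lambda>s. i.form (D s) (D s))"
    unfolding continuous_on_def
  proof
    fix s assume s: "s \<in> {0..t}"
    have "L2_tendsto M D (D s) (at s within {0..t})"
      using L2_tendsto_compose[OF D_continuous[of s] filterlim_ident[of "at s within {0..t}", THEN filterlim_mono]] s
      by (auto simp: at_le)
    then show "((\<lambda>s. i.form (D s) (D s)) \<longlongrightarrow> i.form (D s) (D s)) (at s within {0..t})"
      by (intro i.form_tendsto)
  qed
  then obtain B where "B > 0" "\<And>s. s \<in> {0..t} \<Longrightarrow> norm (i.form (D s) (D s)) \<le> B"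
    using bounded_on_compact[OF compact_Icc] by blast
  then show thesis
    by (intro that[of B]) (auto simp: pairing_def dot_square_norm dest: abs_le_D1)
qed

lemma grad_mult:
  assumes "\<And>k. Ck_on k UNIV w" "\<And>k. Ck_on k UNIV \<phi>"
  shows "grad (\<lambda>x. w x * \<phi> x) x = w x *\<^sub>R grad \<phi> x + \<phi> x *\<^sub>R grad w x"
  by (simp add: grad_def vec_eq_iff partial_mult[OF Ck_on_differentiable Ck_on_differentiable] assms mult.commute)

text \<open>The identity of \<open>wave_equation_tested\<close> passes to the limit along the approximations \<open>\<phi> k\<close> of \<open>u t\<close>. The factor
\<open>w\<close> confines everything to \<open>K\<close>, where the approximations converge together with their gradients.\<close>

lemma wave_equation_tested_solution:
  assumes ck: "\<And>k. Ck_on k UNIV w" and supp: "\<And>x. x \<notin> K \<Longrightarrow> w x = 0" and t: "t \<ge> 0"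
  shows "(LINT x|M. w x * (u t x * v t x)) = - integral {0..t} (\<lambda>s. (LINT x|M. w x * cometric x (D s x) (D t x)) +
    (LINT x|M. u t x * cometric x (D s x) (grad w x)))"
proof -
  obtain \<phi> where \<phi>: "\<And>k. test_function \<Omega> (\<phi> k)" "L2_tendsto M \<phi> (u t) sequentially"
    "L2_tendsto M (\<lambda>k. grad (\<phi> k)) (D t) sequentially"
    by (rule approximation[OF t]) metis
  have ck\<phi>: "Ck_on m UNIV (\<phi> k)" for m k using \<phi>(1)[of k] by (auto simp: test_function_def smooth_on_def)
  have gc: "continuous_on K (grad w)"
    using continuous_on_partial[OF ck] by (auto intro!: continuous_on_vec_lambda simp: grad_def[abs_def])
  obtain Cg where Cg: "Cg > 0" "\<And>x. x \<in> K \<Longrightarrow> norm (grad w x) \<le> Cg"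
    using bounded_on_compact[OF K_compact gc] by metis
  have wm: "w \<in> borel_measurable M" "grad w \<in> borel_measurable M"
    using L2_M_smooth[OF ck] by (auto simp: L2_def)
  interpret c: L2_form M cometric by (rule cometric_form)
  have weight: "weight M w"
  proof -
    obtain B where "\<And>x. x \<in> K \<Longrightarrow> norm (w x) \<le> B"
      using bounded_on_compact[OF K_compact] continuous_on_subset[OF Ck_on_continuous[OF ck] subset_UNIV] by metis
    then show ?thesis by (intro weightI[OF wm(1)]) (auto simp: space_M)
  qed
  interpret f0: L2_form M "\<lambda>x (r::real) s. w x * (r * s)"
    by (rule L2_form_weighted[OF L2_form_mult weight])
  interpret f1: L2_form M "\<lambda>x p p'. w x * cometric x p p'"
    by (rule L2_form_weighted[OF cometric_form weight])
  interpret f2: L2_form M "\<lambda>x p (r::real). r * cometric x p (grad w x)"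
  proof
    show "bilinear (\<lambda>p (r::real). r * cometric x p (grad w x))" for x
      using cometric_bilinear[of x] by (auto simp: bilinear_def linear_iff algebra_simps)
    have "\<bar>r * cometric x p (grad w x)\<bar> \<le> (c.C * Cg) * norm p * norm r" if x: "x \<in> space M" for x p and r :: real
    proof -
      have "\<bar>cometric x p (grad w x)\<bar> \<le> c.C * norm p * Cg"
        by (rule order_trans[OF c.bound[OF x] mult_left_mono[OF Cg(2)]])
          (use x c.C_nonneg in \<open>auto simp: space_M\<close>)
      then have "\<bar>r\<bar> * \<bar>cometric x p (grad w x)\<bar> \<le> \<bar>r\<bar> * (c.C * norm p * Cg)" by (rule mult_left_mono) simp
      then show ?thesis by (simp add: abs_mult mult_ac)
    qed
    then show "\<exists>C. \<forall>x\<in>space M. \<forall>p r. \<bar>r * cometric x p (grad w x)\<bar> \<le> C * norm p * norm r" by blast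
  qed (use wm in \<open>auto intro!: borel_measurable_times cometric_measurable id_measurable_M\<close>)
  obtain B where B: "\<And>s. s \<in> {0..t} \<Longrightarrow> (LINT x|M. (norm (D s x))\<^sup>2) \<le> B"
    using D_bounded by metis
  let ?I = "\<lambda>k s. f1.form (D s) (grad (\<phi> k)) + f2.form (D s) (\<phi> k)"
  let ?Lim = "\<lambda>s. f1.form (D s) (D t) + f2.form (D s) (u t)"
  have DL: "s \<in> {0..t} \<Longrightarrow> L2 M (D s)" for s by (simp add: D_L2)
  have eq: "f0.form (v t) (\<phi> k) = - integral {0..t} (?I k)" for k
  proof -
    have "(LINT x|M. v t x * (w x * \<phi> k x)) = - integral {0..t} (\<lambda>s. LINT x|M. cometric x (D s x) (grad (\<lambda>x. w x * \<phi> k x) x))"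
      by (rule wave_equation_tested[OF Ck_on_mult[OF ck ck\<phi> open_UNIV] _ t]) (simp add: supp)
    also have "integral {0..t} (\<lambda>s. LINT x|M. cometric x (D s x) (grad (\<lambda>x. w x * \<phi> k x) x)) = integral {0..t} (?I k)"
    proof (rule Henstock_Kurzweil_Integration.integral_cong)
      fix s assume s: "s \<in> {0..t}"
      have "(LINT x|M. cometric x (D s x) (grad (\<lambda>x. w x * \<phi> k x) x)) =
          (LINT x|M. w x * cometric x (D s x) (grad (\<phi> k) x) + \<phi> k x * cometric x (D s x) (grad w x))"
        by (simp add: grad_mult[OF ck ck\<phi>] bilinear_radd[OF cometric_bilinear] bilinear_rmul[OF cometric_bilinear])
      also have "\<dots> = ?I k s"
        unfolding pairing_def using f1.integrable_form[OF DL[OF s] L2_M_smooth(2)[OF ck\<phi>]]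
          f2.integrable_form[OF DL[OF s] L2_M_smooth(1)[OF ck\<phi>]] by simp
      finally show "(LINT x|M. cometric x (D s x) (grad (\<lambda>x. w x * \<phi> k x) x)) = ?I k s" .
    qed
    finally show ?thesis by (simp add: pairing_def mult.left_commute)
  qed
  have ul: "uniform_limit {0..t} ?I ?Lim sequentially"
    by (intro uniform_limit_add f1.uniform_limit_form[OF DL B \<phi>(3)] f2.uniform_limit_form[OF DL B \<phi>(2)])
  have cont: "continuous_on {0..t} (?I k)" for k
  proof -
    have "L2_tendsto M D (D s) (at s within {0..t})" if "s \<in> {0..t}" for s
      using L2_tendsto_compose[OF D_continuous[of s] filterlim_ident[of "at s within {0..t}", THEN filterlim_mono]] that
      by (auto simp: at_le)
    then show ?thesis
      unfolding continuous_on_def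
      by (intro ballI tendsto_add f1.form_tendsto f2.form_tendsto L2_tendsto_const L2_M_smooth[OF ck\<phi>]) auto
  qed
  obtain I J where IJ: "\<And>k. (?I k has_integral I k) {0..t}" "(?Lim has_integral J) {0..t}" "I \<longlonglongrightarrow> J"
    using uniform_limit_integral[OF ul cont sequentially_bot] by blast
  have "(\<lambda>k. f0.form (v t) (\<phi> k)) \<longlonglongrightarrow> f0.form (v t) (u t)"
    by (intro f0.form_tendsto L2_tendsto_const v_L2 t \<phi>(2))
  moreover have "(\<lambda>k. f0.form (v t) (\<phi> k)) \<longlonglongrightarrow> - J"
    unfolding eq integral_unique[OF IJ(1)] by (intro tendsto_intros IJ(3))
  ultimately have "f0.form (v t) (u t) = - J" by (rule LIMSEQ_unique)
  then have "f0.form (v t) (u t) = - integral {0..t} ?Lim" by (simp only: integral_unique[OF IJ(2)])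
  then show ?thesis by (simp add: pairing_def mult.commute[of "v t _"])
qed

end

section \<open>The domain of dependence at infinity\<close>

text \<open>The quadratic term makes the profile negative at large radii as well, and thus the weight compactly
supported, while the slope stays between -1 and 1 where the profile is nonnegative. As \<open>L\<close> grows the profile
approaches the distance from the sphere of radius \<open>R\<close>.\<close>

definition cone_profile :: "real \<Rightarrow> real \<Rightarrow> real \<Rightarrow> real" where
  "cone_profile R L r = (r - R) - (r - R)\<^sup>2 / (2 * L)"

lemma DERIV_cone_profile: "L > 0 \<Longrightarrow> (cone_profile R L has_real_derivative 1 - (r - R) / L) (at r)"
  unfolding cone_profile_def[abs_def] by (auto intro!: derivative_eq_intros simp: field_simps)

lemma cone_profile_pos:
  assumes "L > 0" "cone_profile R L r > 0" shows "R < r" "r < R + 2 * L"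
proof -
  have "(r - R) * (2 * L - (r - R)) > 0"
    using assms by (simp add: cone_profile_def power2_eq_square field_simps)
  then show "R < r" "r < R + 2 * L" using assms(1) by (auto simp: zero_less_mult_iff)
qed

locale cone_weight =
  fixes R L :: real
  assumes R: "R > 0" and L: "L > 0"
begin

definition q :: "real^'n::finite \<Rightarrow> real" where "q x = cone_profile R L (norm x)"
definition \<kappa> :: "real^'n::finite \<Rightarrow> real" where "\<kappa> x = 1 - (norm x - R) / L"
definition annulus :: "(real^'n::finite) set" where "annulus = {x. R \<le> norm x \<and> norm x \<le> R + 2 * L}"

lemma compact_annulus: "compact (annulus :: (real^'n::finite) set)"
proof -
  have "annulus = cball 0 (R + 2 * L) - ball (0 :: real^'n) R" by (auto simp: annulus_def)
  then show ?thesis by (simp add: compact_diff)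
qed

lemma flat_cone_zero: "\<tau> \<ge> 0 \<Longrightarrow> x \<notin> annulus \<Longrightarrow> flat (q x - \<tau>) = 0"
proof (rule flat_zero, rule ccontr)
  assume "\<tau> \<ge> 0" "x \<notin> annulus" "\<not> q x - \<tau> \<le> 0"
  then have "cone_profile R L (norm x) > 0" by (simp add: q_def)
  from cone_profile_pos[OF L this] \<open>x \<notin> annulus\<close> show False by (simp add: annulus_def)
qed

text \<open>The norm is not smooth at the origin, but the weight vanishes in the ball of radius \<open>R\<close>.\<close>

lemma Ck_on_flat_cone:
  assumes "\<tau> \<ge> 0" shows "Ck_on k UNIV (\<lambda>x::real^'n::finite. flat (q x - \<tau>))"
proof -
  have "Ck_on k (- {0}) (\<lambda>x::real^'n. flat (q x - \<tau>))"
  proof (rule Ck_on_compose[OF Ck_on_flat])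
    show "Ck_on k (- {0}) (\<lambda>x::real^'n. q x - \<tau>)"
      unfolding q_def cone_profile_def divide_inverse power2_eq_square
      by (intro Ck_on_diff Ck_on_mult Ck_on_const Ck_on_norm) auto
  qed auto
  moreover have "Ck_on k (ball 0 R) (\<lambda>x::real^'n. flat (q x - \<tau>))"
    by (rule Ck_on_cong[THEN iffD2, of _ _ "\<lambda>_. 0"])
      (use assms in \<open>auto intro!: flat_cone_zero Ck_on_const simp: annulus_def\<close>)
  ultimately have "Ck_on k (- {0} \<union> ball 0 R) (\<lambda>x::real^'n. flat (q x - \<tau>))"
    by (rule Ck_on_Un) auto
  moreover have "- {0::real^'n} \<union> ball 0 R = UNIV" using R by auto
  ultimately show ?thesis by simp
qed

lemma grad_flat_cone:
  assumes "x \<noteq> (0 :: real^'n::finite)"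
  shows "grad (\<lambda>x. flat (q x - \<tau>)) x = (flat' (q x - \<tau>) * \<kappa> x) *\<^sub>R (x /\<^sub>R norm x)"
proof -
  have "((\<lambda>x. cone_profile R L (norm x) - \<tau>) has_derivative (\<lambda>h. (1 - (norm x - R) / L) * (sgn x \<bullet> h))) (at x)"
    using has_derivative_compose[OF has_derivative_norm[OF assms] DERIV_cone_profile[OF L, unfolded has_field_derivative_def]]
    by (auto intro!: derivative_eq_intros simp: inner_commute)
  from has_derivative_compose[OF this DERIV_flat[unfolded has_field_derivative_def]]
  have "((\<lambda>x. flat (q x - \<tau>)) has_derivative (\<lambda>h. flat' (q x - \<tau>) * ((1 - (norm x - R) / L) * (sgn x \<bullet> h)))) (at x)"
    by (simp add: q_def)
  from frechet_derivative_at[OF this, symmetric] show ?thesis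
    unfolding grad_def partial_def by (simp add: vec_eq_iff \<kappa>_def sgn_div_norm inner_axis)
qed

end

theorem vanishing_in_cone:
  fixes G :: "real^'n::finite \<Rightarrow> real^'n^'n" and u v :: "real \<Rightarrow> real^'n \<Rightarrow> real"
  assumes G: "riemannian_metric G" and radial: "\<And>x. norm x \<ge> R \<Longrightarrow> G x *v (x /\<^sub>R norm x) = x /\<^sub>R norm x"
    and R: "R > 0" and L: "L > 0"
    and \<Omega>: "open \<Omega>" "{x. norm x \<ge> R} \<subseteq> \<Omega>"
    and u: "continuous_H10_hat G \<Omega> u" "wave_equation G \<Omega> u"
    and v: "continuous_L2 (riem_vol G) \<Omega> v" "has_L2_time_derivative (riem_vol G) \<Omega> u v"
    and init: "AE x\<in>\<Omega> in lebesgue. norm x \<ge> R \<longrightarrow> u 0 x = 0 \<and> v 0 x = 0"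
    and t: "t > 0"
  shows "AE x in lebesgue. norm x \<ge> R \<longrightarrow> cone_profile R L (norm x) > t \<longrightarrow> u t x = 0"
proof -
  interpret cone_weight R L by unfold_locales (rule R L)+
  define K where "K = (annulus :: (real^'n) set)"
  have K: "compact K" unfolding K_def by (rule compact_annulus)
  have KR: "norm x \<ge> R" "x \<noteq> 0" if "x \<in> K" for x using that R by (auto simp: K_def annulus_def)
  interpret exterior_wave G K \<Omega> u v
  proof unfold_locales
    show "AE x\<in>K in lebesgue. u 0 x = 0" "AE x\<in>K in lebesgue. v 0 x = 0"
      using init by (eventually_elim, use KR \<Omega> in auto)+
  qed (use G K \<Omega> u v KR in auto)
  define b where "b x p = (x /\<^sub>R norm x) \<bullet> p" for x p :: "real^'n"
  have unit: "norm (x /\<^sub>R norm x) = 1" if "x \<in> K" for x using KR[OF that] by simp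
  have qc: "continuous_on K q" and \<kappa>c: "continuous_on K \<kappa>"
    unfolding q_def \<kappa>_def cone_profile_def using L by (auto intro!: continuous_intros)
  obtain Q where Q: "Q > 0" "\<And>x. x \<in> K \<Longrightarrow> norm (q x) \<le> Q" using bounded_on_compact[OF K qc] by metis
  interpret energy_setting M cometric b q \<kappa> Q u v D
  proof (rule energy_setting.intro, rule finite_measure_axioms, rule energy_setting_axioms.intro)
    show "L2_form M cometric" by (rule cometric_form)
    show "cometric x p p' = cometric x p' p" for x p p' by (rule cometric_sym)
    show "L2_form M (\<lambda>x r p. r * b x p)"
    proof
      show "bilinear (\<lambda>r p. r * b x p)" for x
        by (auto simp: b_def bilinear_def inner_add_right algebra_simps intro!: linearI)
      have "\<bar>r * b x p\<bar> \<le> 1 * norm r * norm p" if "x \<in> space M" for x r p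
        unfolding b_def abs_mult using Cauchy_Schwarz_ineq2[of "x /\<^sub>R norm x" p] unit[of x] that
        by (simp add: space_M mult_left_mono)
      then show "\<exists>C. \<forall>x\<in>space M. \<forall>r p. \<bar>r * b x p\<bar> \<le> C * norm r * norm p" by blast
      show "(\<lambda>x. f x * b x (g x)) \<in> borel_measurable M" if "f \<in> borel_measurable M" "g \<in> borel_measurable M" for f g
        unfolding b_def using id_measurable_M measurable_compose[OF id_measurable_M borel_measurable_norm]
        by (intro borel_measurable_times borel_measurable_inner borel_measurable_scaleR borel_measurable_inverse that)
    qed
    show "(b x p)\<^sup>2 \<le> cometric x p p" if "x \<in> space M" for x p
      unfolding b_def by (rule cometric_unit(2)[OF radial unit]) (use that KR in \<open>auto simp: space_M\<close>)
    show "q \<in> borel_measurable M" "\<kappa> \<in> borel_measurable M"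
      by (rule continuous_borel_measurable_M[OF qc] continuous_borel_measurable_M[OF \<kappa>c])+
    show "\<bar>q x\<bar> \<le> Q" if "x \<in> space M" for x using Q(2) that by (simp add: space_M)
    show "\<bar>\<kappa> x\<bar> \<le> 1" if "x \<in> space M" for x
    proof -
      have "x \<in> K" using that by (simp add: space_M)
      then show ?thesis using L by (auto simp: K_def annulus_def \<kappa>_def abs_le_iff field_simps)
    qed
    show "AE x in M. u 0 x = 0" using u_initial by (simp add: AE_M)
    show "(LINT x|M. flat (q x - t) * (u t x * v t x)) =
      - integral {0..t} (\<lambda>s. (LINT x|M. flat (q x - t) * cometric x (D s x) (D t x)) +
          (LINT x|M. (flat' (q x - t) * \<kappa> x) * (u t x * b x (D s x))))" if t: "t > 0" for t
    proof -
      have "cometric x p (grad (\<lambda>x. flat (q x - t)) x) = (flat' (q x - t) * \<kappa> x) * b x p" if "x \<in> K" for x p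
        using cometric_unit(1)[OF radial[OF KR(1)[OF that]] unit[OF that]]
        by (simp add: grad_flat_cone[OF KR(2)[OF that]] bilinear_rmul[OF cometric_bilinear] b_def)
      then have e: "(LINT x|M. u t x * cometric x (D s x) (grad (\<lambda>x. flat (q x - t)) x)) =
          (LINT x|M. (flat' (q x - t) * \<kappa> x) * (u t x * b x (D s x)))" for s
        by (intro Bochner_Integration.integral_cong) (auto simp: space_M)
      have z: "flat (q x - t) = 0" if "x \<notin> K" for x
        using flat_cone_zero[of t x] t that by (simp add: K_def)
      have "t \<ge> 0" using t by simp
      from wave_equation_tested_solution[OF Ck_on_flat_cone[OF this] z this] show ?thesis
        unfolding e .
    qed
  qed (rule u_L2 u_derivative D_continuous; assumption)+
  have "AE x in M. flat (q x - t) * (u t x)\<^sup>2 = 0"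
  proof -
    have "integrable M (\<lambda>x. flat (q x - t) * (u t x)\<^sup>2)"
      using uu_integrable[OF weight_w u_L2 u_L2, of t t t] t by (simp add: power2_eq_square)
    then show ?thesis
      using energy_vanishes[OF t] integral_nonneg_eq_0_iff_AE[of M "\<lambda>x. flat (q x - t) * (u t x)\<^sup>2"]
      by (simp add: flat_nonneg)
  qed
  then have "AE x in lebesgue. x \<in> K \<longrightarrow> flat (q x - t) * (u t x)\<^sup>2 = 0" by (simp add: AE_M)
  then show ?thesis
  proof eventually_elim
    case (elim x)
    show ?case
    proof (intro impI)
      assume *: "norm x \<ge> R" "cone_profile R L (norm x) > t"
      then have "x \<in> K" using cone_profile_pos[OF L, of R "norm x"] t by (auto simp: K_def annulus_def)
      moreover have "flat (q x - t) > 0" using * by (intro flat_pos) (simp add: q_def)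
      ultimately show "u t x = 0" using elim by simp
    qed
  qed
qed

text \<open>A connected set that misses the boundary lies in \<open>\<Omega>\<close> or outside of it; the complement of \<open>\<Omega>\<close> is
bounded. In one dimension the complement of a ball would be disconnected.\<close>

lemma exterior_contains_complement_of_ball:
  fixes \<Omega> :: "(real^'n::finite) set"
  assumes "CARD('n) \<ge> 2" "exterior_domain \<Omega>" "R > (SUP x\<in>frontier \<Omega>. norm x)"
  shows "{x. norm x \<ge> R} \<subseteq> \<Omega>"
proof -
  have "bounded (- \<Omega>)" and cf: "compact (frontier \<Omega>)" using assms(2) by (auto simp: exterior_domain_def)
  then obtain B where B: "B > 0" "\<And>x. x \<notin> \<Omega> \<Longrightarrow> norm x \<le> B" by (auto simp: bounded_pos)
  have fr: "norm x < R" if "x \<in> frontier \<Omega>" for x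
  proof -
    have "bdd_above (norm ` frontier \<Omega>)"
      using compact_imp_bounded[OF cf] unfolding bounded_iff by (metis bdd_aboveI2)
    then show ?thesis using cSUP_upper[OF that, of norm] assms(3) by simp
  qed
  have "connected {x::real^'n. norm x \<ge> R}"
  proof -
    have "{x::real^'n. norm x \<ge> R} = - ball 0 R" by auto
    then show ?thesis
      using connected_complement_bounded_convex[of "ball (0::real^'n) R"] assms(1) by simp
  qed
  moreover have "{x. norm x \<ge> R} \<inter> \<Omega> \<noteq> {}"
  proof -
    obtain x :: "real^'n" where "norm x = \<bar>R\<bar> + B + 1"
      using vector_choose_size[of "\<bar>R\<bar> + B + 1"] B(1) by auto
    then have "R \<le> norm x" "\<not> norm x \<le> B" using B(1) by auto
    then have "x \<in> {x. norm x \<ge> R} \<inter> \<Omega>" using B(2)[of x] by blast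
    then show ?thesis by blast
  qed
  moreover have "{x. norm x \<ge> R} \<inter> frontier \<Omega> = {}" using fr by force
  ultimately show ?thesis using connected_Int_frontier by blast
qed

theorem theorem1p5:
  fixes G :: "real^'n::finite \<Rightarrow> real^'n^'n"
    and \<Omega> :: "(real^'n) set"
    and u0 u1 :: "real^'n \<Rightarrow> real"
    and u :: "real \<Rightarrow> real^'n \<Rightarrow> real"
    and r_c R0 :: real
  assumes "CARD('n) \<ge> 2"
    and "riemannian_metric G" and "riem_complete G"
    and "r_c > 0"
    and "\<forall>x. norm x \<ge> r_c \<longrightarrow> G x *v (x /\<^sub>R norm x) = x /\<^sub>R norm x"
    and "exterior_domain \<Omega>" and "smooth_boundary \<Omega>"
    and "\<forall>x\<in>\<Omega>. norm x \<ge> r_c"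
    and "u0 \<in> H10_hat G \<Omega>" and "u1 \<in> L2_space (riem_vol G) \<Omega>"
    and "wave_solution G \<Omega> u0 u1 u"
    and "R0 > (SUP x\<in>frontier \<Omega>. norm x)"
    and "AE x\<in>\<Omega> in lebesgue. norm x \<ge> R0 \<longrightarrow> u0 x = 0 \<and> u1 x = 0"
  shows "\<forall>t\<ge>0. AE x\<in>\<Omega> in lebesgue. norm x \<ge> R0 + t \<longrightarrow> u t x = 0"
proof (intro allI impI)
  fix t :: real assume t: "t \<ge> 0"
  have sub: "{x. norm x \<ge> R0} \<subseteq> \<Omega>"
    by (rule exterior_contains_complement_of_ball[OF assms(1,6,12)])
  have R0: "R0 \<ge> r_c" "R0 > 0"
  proof -
    \<comment> \<open>if the radius were negative, the origin would lie in the domain\<close>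
    obtain x :: "real^'n" where x: "norm x = max R0 0"
      using vector_choose_size[of "max R0 0"] by auto
    then have "x \<in> \<Omega>" using sub by auto
    then have "max R0 0 \<ge> r_c" using assms(8) x by auto
    then show "R0 \<ge> r_c" "R0 > 0" using assms(4) by auto
  qed
  obtain v where v: "continuous_L2 (riem_vol G) \<Omega> v" "has_L2_time_derivative (riem_vol G) \<Omega> u v"
    "AE x\<in>\<Omega> in lebesgue. v 0 x = u1 x"
    and u: "continuous_H10_hat G \<Omega> u" "wave_equation G \<Omega> u" "AE x\<in>\<Omega> in lebesgue. u 0 x = u0 x"
    using assms(11) by (auto simp: wave_solution_def)
  have init: "AE x\<in>\<Omega> in lebesgue. norm x \<ge> R0 \<longrightarrow> u 0 x = 0 \<and> v 0 x = 0"
    using u(3) v(3) assms(13) by eventually_elim auto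
  show "AE x\<in>\<Omega> in lebesgue. norm x \<ge> R0 + t \<longrightarrow> u t x = 0"
  proof (cases "t = 0")
    case True
    show ?thesis using init by eventually_elim (use True in auto)
  next
    case False
    then have t: "t > 0" using t by simp
    have "AE x in lebesgue. norm x \<ge> R0 \<longrightarrow> cone_profile R0 (real (Suc m)) (norm x) > t \<longrightarrow> u t x = 0" for m
      by (rule vanishing_in_cone[OF assms(2) _ R0(2) _ _ sub u(1,2) v(1,2) init t])
        (use assms(5,6) R0 in \<open>auto simp: exterior_domain_def\<close>)
    then have "AE x in lebesgue. \<forall>m. norm x \<ge> R0 \<longrightarrow> cone_profile R0 (real (Suc m)) (norm x) > t \<longrightarrow> u t x = 0"
      by (intro AE_all_countable[THEN iffD2] allI)
    \<comment> \<open>the profiles approach the distance from below, so that the boundary sphere is reached by none of them\<close>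
    moreover have "AE x in lebesgue. x \<notin> sphere (0::real^'n) (R0 + t)"
      using negligible_sphere[of "0::real^'n" "R0 + t"] by (intro AE_not_in) (simp add: negligible_iff_null_sets)
    ultimately show ?thesis
    proof eventually_elim
      case (elim x)
      show ?case
      proof (intro impI)
        assume "x \<in> \<Omega>" and x: "norm x \<ge> R0 + t"
        define s where "s = norm x - R0"
        have s: "s > t" using x elim(2) by (auto simp: s_def)
        have "(\<lambda>m. s - s\<^sup>2 * inverse (real (Suc m)) / 2) \<longlonglongrightarrow> s - s\<^sup>2 * 0 / 2"
          by (intro tendsto_intros LIMSEQ_inverse_real_of_nat) simp
        then have "\<forall>\<^sub>F m in sequentially. s - s\<^sup>2 * inverse (real (Suc m)) / 2 > t"
          using s by (intro order_tendstoD(1)) auto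
        then obtain m where m: "s - s\<^sup>2 * inverse (real (Suc m)) / 2 > t"
          using eventually_happens'[OF sequentially_bot] by blast
        have "cone_profile R0 (real (Suc m)) (norm x) = s - s\<^sup>2 * inverse (real (Suc m)) / 2"
          unfolding cone_profile_def s_def by (simp only: divide_inverse inverse_mult_distrib mult_ac)
        with m have "cone_profile R0 (real (Suc m)) (norm x) > t" by (simp only:)
        then show "u t x = 0" using elim(1) x t by auto
      qed
    qed
  qed
qed

end
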